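(* Let $\mathcal H\subseteq\mathcal G$ be a partial building set for a geometric lattice $L$, and let $y\in\mathcal L(L,\mathcal H)$ be such that $\pi(y)\neq\hat 1$ in $L$. Then, as graded algebras, $$\mathrm{DP}^\cdot_y(L,\mathcal H)\;\cong\;\bigotimes_{g\in F^+(y)}\mathrm{DP}^\cdot(L_{y,g},\mathcal H_{y,g})\;\cong\;\bigotimes_{g\in F^+(y)\cap\mathcal H^\circ}\mathrm{DP}^\cdot(L_{y,g},\mathcal H_{y,g}).$$
   Context: All posets are finite. For a meet-semilattice $P$ with least element $\hat 0$, write $P_+=P\setminus\{\hat 0\}$, $\mathrm{a}(P)$ for its set of atoms. Blowups. For $p\in P_+$, let $P_{(p)}=\{x\in P: x\not\ge p,\ p\vee x \text{ exists}\}$ and $\mathrm{Bl}_p(P)=\{x\in P:x\not\ge p\}\cup\{(p,x):x\in P_{(p)}\}$, ordered by: $y>x$ if $y>x$ in $P$; $(p,y)>(p,x)$ if $y>x$ in $P$; $(p,y)>x$ if $y\ge x$ in $P$. The blow-down map $\mathrm{Bl}_p(P)\to P$ sends $x\mapsto x$ and $(p,x)\mapsto p\vee x$. Building sets. For a geometric lattice $L$, $\mathcal G\subseteq L_+$ is a building set if for every $x\in L_+$ with $\max \mathcal G_{\le x}=\{x_1,\dots,x_k\}$ there is a poset isomorphism $\prod_j[\hat 0,x_j]\to[\hat 0,x]$ sending $(\hat 0,\dots,x_j,\dots,\hat 0)$ to $x_j$; always the maximum $\hat 1$ is in $\mathcal G$. A partial building set is $\mathcal H\subseteq\mathcal G$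 with $\mathrm{a}(L)\subseteq\mathcal H$ and $\mathcal H^\circ:=\mathcal H\setminus \mathrm{a}(L)$ upward closed in $\mathcal G$. Writing $\mathcal H^\circ=\{p_1,\dots,p_m\}$ with $p_i\ge p_j\Rightarrow i\le j$, set $\mathcal L(L,\mathcal H)=\mathrm{Bl}_{p_m}\circ\cdots\circ\mathrm{Bl}_{p_1}(L)$, a meet-semilattice whose lower intervals are geometric lattices and whose atoms are identified with $\mathcal H$; $\pi\colon\mathcal L(L,\mathcal H)\to L$ is the composite of the blow-down maps. $S\subseteq\mathcal H$ is $\mathcal H$-nested if the join in $L$ of any two or more pairwise incomparable elements of $S$ is not in $\mathcal H$; $N(L,\mathcal H)$ is the complex of nested sets (equivalently, sets of atoms of $\mathcal L(L,\mathcal H)$ with an upper bound). De Concini–Procesi algebras. Let $c_g=\sum_{h\in\mathcal H,\,h\ge g}x_h$, $x_T=\prod_{g\in T}x_g$, $\deg x_g=2$. $\mathrm{DP}(L,\mathcal H)=\mathbb Q[x_g:g\in\mathcal H]/(x_T: T\notin N(L,\mathcal H);\ c_g: g\in\mathrm{a}(L))$. For $y\in\mathcal L(L,\mathcal H)$ with $y=\bigvee S$ (join in $\mathcal L(L,\mathcal H)$), $S\in N(L,\mathcal H)$, $\mathrm{DP}_y(L,\mathcal H)=\mathbb Q[x_g:g\in\mathcal H]/(x_T: S\cup T\notin N(L,\mathcal H);\ c_g: g\in\mathrm{a}(L))$, independent of $S$. Local data. View $\mathcal G$ as a subset of $\mathcal L(L,\mathcal H)$: elements of $\mathcal H$ are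 the atoms, and elements of $\mathcal G\setminus\mathcal H$ are elements of $L$ that survive the blowups. Let $F(y)$ be the set of maximal elements of $\{g\in\mathcal G: g\le y\text{ in }\mathcal L(L,\mathcal H)\}$ (with respect to the order of $\mathcal L(L,\mathcal H)$), and $F^+(y)=F(y)\cup\{\hat 1\}\subseteq\mathcal G$. For $g\in F^+(y)$ let $z_y(g)=\bigvee\{f\in F(y): f<g\}$ (order and join in $L$) and let $L_{y,g}=[z_y(g),g]\subseteq L$, a geometric lattice. For $p\in\mathcal H$, the set $\{g\in F^+(y):p\le g \text{ in } L\}$ has a unique minimum $\hat p$, and $p\vee z_y(\hat p)>z_y(\hat p)$; put $\zeta(p)=p\vee z_y(\hat p)\in (L_{y,\hat p})_+$. The half-open intervals $(L_{y,g})_+=(z_y(g),g]$ are disjoint for distinct $g\in F^+(y)$, and $\mathcal H_{y,g}:=\zeta(\mathcal H)\cap (L_{y,g})_+$, which is a partial building set for $L_{y,g}$. *)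

theory Defs
  imports Complex_Main "HOL-Algebra.QuotRing" "HOL-Algebra.Module" "HOL-Algebra.Lattice" "HOL-Library.Poly_Mapping"
begin

section \<open>Geometric lattices and building sets\<close>

definition atoms :: "'a gorder \<Rightarrow> 'a set" where
  "atoms P = {a \<in> carrier P. a \<noteq> \<bottom>\<^bsub>P\<^esub> \<and> (\<forall>x\<in>carrier P. x \<sqsubseteq>\<^bsub>P\<^esub> a \<longrightarrow> x = \<bottom>\<^bsub>P\<^esub> \<or> x = a)}"

definition covers :: "'a gorder \<Rightarrow> 'a \<Rightarrow> 'a \<Rightarrow> bool" where
  "covers P y x \<longleftrightarrow> x \<noteq> y \<and> x \<sqsubseteq>\<^bsub>P\<^esub> y \<and>
     (\<forall>w\<in>carrier P. x \<sqsubseteq>\<^bsub>P\<^esub> w \<longrightarrow> w \<sqsubseteq>\<^bsub>P\<^esub> y \<longrightarrow> w = x \<or> w = y)"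

text \<open>Finite, atomistic and (upper) semimodular.\<close>

definition geometric_lattice :: "'a gorder \<Rightarrow> bool" where
  "geometric_lattice L \<longleftrightarrow>
     lattice L \<and> finite (carrier L) \<and> carrier L \<noteq> {} \<and>
     (\<forall>x\<in>carrier L. \<exists>A\<subseteq>atoms L. is_lub L x A) \<and>
     (\<forall>x\<in>carrier L. \<forall>y\<in>carrier L. covers L x (x \<sqinter>\<^bsub>L\<^esub> y) \<longrightarrow> covers L (x \<squnion>\<^bsub>L\<^esub> y) y)"

definition interval :: "'a gorder \<Rightarrow> 'a \<Rightarrow> 'a \<Rightarrow> 'a gorder" where
  "interval L a b = L\<lparr>carrier := \<lbrace>a..b\<rbrace>\<^bsub>L\<^esub>\<rparr>"

definition maximal_below :: "'a gorder \<Rightarrow> 'a set \<Rightarrow> 'a \<Rightarrow> 'a set" where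
  "maximal_below L G x = {g \<in> G. g \<sqsubseteq>\<^bsub>L\<^esub> x \<and> (\<forall>h\<in>G. h \<sqsubseteq>\<^bsub>L\<^esub> x \<longrightarrow> g \<sqsubseteq>\<^bsub>L\<^esub> h \<longrightarrow> h = g)}"

definition building_set :: "'a gorder \<Rightarrow> 'a set \<Rightarrow> bool" where
  "building_set L G \<longleftrightarrow>
     G \<subseteq> carrier L - {\<bottom>\<^bsub>L\<^esub>} \<and> \<top>\<^bsub>L\<^esub> \<in> G \<and>
     (\<forall>x \<in> carrier L - {\<bottom>\<^bsub>L\<^esub>}.
        let X = maximal_below L G x; Pr = (\<Pi>\<^sub>E g\<in>X. \<lbrace>\<bottom>\<^bsub>L\<^esub>..g\<rbrace>\<^bsub>L\<^esub>) in
        \<exists>\<phi>. bij_betw \<phi> Pr \<lbrace>\<bottom>\<^bsub>L\<^esub>..x\<rbrace>\<^bsub>L\<^esub> \<and>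
            (\<forall>u\<in>Pr. \<forall>v\<in>Pr. (\<forall>g\<in>X. u g \<sqsubseteq>\<^bsub>L\<^esub> v g) \<longleftrightarrow> \<phi> u \<sqsubseteq>\<^bsub>L\<^esub> \<phi> v) \<and>
            (\<forall>g\<in>X. \<phi> (\<lambda>h\<in>X. if h = g then g else \<bottom>\<^bsub>L\<^esub>) = g))"

definition partial_building_set :: "'a gorder \<Rightarrow> 'a set \<Rightarrow> 'a set \<Rightarrow> bool" where
  "partial_building_set L G H \<longleftrightarrow>
     building_set L G \<and> H \<subseteq> G \<and> atoms L \<subseteq> H \<and>
     (\<forall>p \<in> H - atoms L. \<forall>g\<in>G. p \<sqsubseteq>\<^bsub>L\<^esub> g \<longrightarrow> g \<in> H - atoms L)"

definition nested_sets :: "'a gorder \<Rightarrow> 'a set \<Rightarrow> 'a set set" where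
  "nested_sets L H = {S. S \<subseteq> H \<and>
     (\<forall>T\<subseteq>S. 2 \<le> card T \<and> (\<forall>a\<in>T. \<forall>b\<in>T. a \<noteq> b \<longrightarrow> \<not> a \<sqsubseteq>\<^bsub>L\<^esub> b) \<longrightarrow> \<Squnion>\<^bsub>L\<^esub> T \<notin> H)}"


section \<open>Blowups\<close>

text \<open>
  Iterated blowups of a poset on \<^typ>\<open>'a\<close> live on one common type: \<open>Orig x\<close> is an element
  of the initial poset, \<open>Exc p x\<close> is the pair \<open>(p, x)\<close> created by blowing up \<open>p\<close>. No pair
  \<open>Exc p x\<close> belongs to the poset \<open>P\<close> about to be blown up at \<open>p\<close> as long as no two
  blowups of an iteration are made at the same \<open>p\<close>.
\<close>

datatype 'a blow = Orig 'a | Exc "'a blow" "'a blow"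

definition blow_old :: "'a blow gorder \<Rightarrow> 'a blow \<Rightarrow> 'a blow set" where
  "blow_old P p = {x \<in> carrier P. \<not> p \<sqsubseteq>\<^bsub>P\<^esub> x}"

definition blow_link :: "'a blow gorder \<Rightarrow> 'a blow \<Rightarrow> 'a blow set" where
  "blow_link P p = {x \<in> carrier P. \<not> p \<sqsubseteq>\<^bsub>P\<^esub> x \<and> (\<exists>u. is_lub P u {p, x})}"

definition blowup :: "'a blow gorder \<Rightarrow> 'a blow \<Rightarrow> 'a blow gorder" where
  "blowup P p =
     \<lparr>carrier = blow_old P p \<union> Exc p ` blow_link P p,
      eq = (=),
      le = (\<lambda>u v.
        (u \<in> blow_old P p \<and> v \<in> blow_old P p \<and> u \<sqsubseteq>\<^bsub>P\<^esub> v) \<or>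
        (\<exists>x\<in>blow_link P p. \<exists>y\<in>blow_link P p. u = Exc p x \<and> v = Exc p y \<and> x \<sqsubseteq>\<^bsub>P\<^esub> y) \<or>
        (u \<in> blow_old P p \<and> (\<exists>y\<in>blow_link P p. v = Exc p y \<and> u \<sqsubseteq>\<^bsub>P\<^esub> y)))\<rparr>"

definition blow_down :: "'a blow gorder \<Rightarrow> 'a blow \<Rightarrow> 'a blow \<Rightarrow> 'a blow" where
  "blow_down P p u =
     (if u \<in> blow_old P p then u
      else p \<squnion>\<^bsub>P\<^esub> (THE x. x \<in> blow_link P p \<and> u = Exc p x))"

fun iter_blowup :: "'a blow gorder \<Rightarrow> 'a blow list \<Rightarrow> 'a blow gorder" where
  "iter_blowup P [] = P"
| "iter_blowup P (p # ps) = iter_blowup (blowup P p) ps"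

fun iter_blow_down :: "'a blow gorder \<Rightarrow> 'a blow list \<Rightarrow> 'a blow \<Rightarrow> 'a blow" where
  "iter_blow_down P [] u = u"
| "iter_blow_down P (p # ps) u = blow_down P p (iter_blow_down (blowup P p) ps u)"

fun unOrig :: "'a blow \<Rightarrow> 'a" where
  "unOrig (Orig x) = x"
| "unOrig (Exc p x) = undefined"

definition orig_poset :: "'a gorder \<Rightarrow> 'a blow gorder" where
  "orig_poset L = \<lparr>carrier = Orig ` carrier L, eq = (=), le = (\<lambda>u v. unOrig u \<sqsubseteq>\<^bsub>L\<^esub> unOrig v)\<rparr>"

text \<open>\<open>ps\<close> lists the non-atoms of \<open>H\<close> in such an order that larger elements come first.\<close>

definition blowup_order :: "'a gorder \<Rightarrow> 'a set \<Rightarrow> 'a list \<Rightarrow> bool" where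
  "blowup_order L H ps \<longleftrightarrow> distinct ps \<and> set ps = H - atoms L \<and>
     (\<forall>i<length ps. \<forall>j<length ps. ps ! j \<sqsubseteq>\<^bsub>L\<^esub> ps ! i \<longrightarrow> i \<le> j)"

definition blown_lattice :: "'a gorder \<Rightarrow> 'a list \<Rightarrow> 'a blow gorder" where
  "blown_lattice L ps = iter_blowup (orig_poset L) (map Orig ps)"

definition blown_proj :: "'a gorder \<Rightarrow> 'a list \<Rightarrow> 'a blow \<Rightarrow> 'a" where
  "blown_proj L ps y = unOrig (iter_blow_down (orig_poset L) (map Orig ps) y)"

text \<open>
  The inclusion of the building set \<open>G\<close> into the blown-up lattice: the blown-up elements of
  \<open>H\<close> become the atoms \<open>(p, 0)\<close>; the atoms of \<open>L\<close> and the elements of \<open>G - H\<close> survive all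
  blowups.
\<close>

definition blow_emb :: "'a gorder \<Rightarrow> 'a set \<Rightarrow> 'a \<Rightarrow> 'a blow" where
  "blow_emb L H g = (if g \<in> H - atoms L then Exc (Orig g) (Orig \<bottom>\<^bsub>L\<^esub>) else Orig g)"


section \<open>Graded algebras\<close>

text \<open>
  Graded \<open>'r\<close>-algebras as records over the library's algebra records; \<open>grade A d\<close> is the
  homogeneous component of degree \<open>d\<close>. The scalars are all of the type \<open>'r\<close>
  (here always \<^typ>\<open>rat\<close>).
\<close>

record ('r, 'b) graded_algebra = "('r, 'b) module" +
  grade :: "nat \<Rightarrow> 'b set"

definition graded_iso ::
    "('r, 'b) graded_algebra \<Rightarrow> ('r, 'c) graded_algebra \<Rightarrow> bool" (infix \<open>\<cong>\<^sub>g\<^sub>r\<close> 50) where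
  "A \<cong>\<^sub>g\<^sub>r B \<longleftrightarrow>
     (\<exists>\<phi>\<in>ring_iso A B.
        (\<forall>c. \<forall>a\<in>carrier A. \<phi> (c \<odot>\<^bsub>A\<^esub> a) = c \<odot>\<^bsub>B\<^esub> \<phi> a) \<and>
        (\<forall>d. \<phi> ` grade A d = grade B d))"

definition quot_algebra ::
    "('r, 'b) graded_algebra \<Rightarrow> 'b set \<Rightarrow> ('r, 'b set) graded_algebra" where
  "quot_algebra A I =
     \<lparr>carrier = carrier (A Quot I), mult = mult (A Quot I), one = \<one>\<^bsub>A Quot I\<^esub>,
      zero = \<zero>\<^bsub>A Quot I\<^esub>, add = add (A Quot I),
      smult = (\<lambda>c X. \<Union>a\<in>X. I +>\<^bsub>A\<^esub> (c \<odot>\<^bsub>A\<^esub> a)),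
      grade = (\<lambda>d. (\<lambda>a. I +>\<^bsub>A\<^esub> a) ` grade A d)\<rparr>"

subsection \<open>Polynomial algebras\<close>

text \<open>Polynomials with rational coefficients in the variables \<open>V\<close>, each of degree 2.\<close>

definition poly_algebra :: "'v set \<Rightarrow> (rat, ('v \<Rightarrow>\<^sub>0 nat) \<Rightarrow>\<^sub>0 rat) graded_algebra" where
  "poly_algebra V =
     \<lparr>carrier = {f. \<forall>m\<in>Poly_Mapping.keys f. Poly_Mapping.keys m \<subseteq> V},
      mult = (*), one = 1, zero = 0, add = (+),
      smult = (\<lambda>c f. Poly_Mapping.map ((*) c) f),
      grade = (\<lambda>d. {f. \<forall>m\<in>Poly_Mapping.keys f. Poly_Mapping.keys m \<subseteq> V \<and>
                 2 * (\<Sum>v\<in>Poly_Mapping.keys m. Poly_Mapping.lookup m v) = d})\<rparr>"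

definition pvar :: "'v \<Rightarrow> ('v \<Rightarrow>\<^sub>0 nat) \<Rightarrow>\<^sub>0 rat" where
  "pvar v = Poly_Mapping.single (Poly_Mapping.single v 1) 1"

subsection \<open>Tensor products of finite families\<close>

text \<open>
  The tensor product over \<open>I\<close> is the \<open>\<rat>\<close>-vector space on the tuples
  \<open>(a\<^sub>i)\<^sub>i\<close>, with the product of tuples taken componentwise, modulo
  the multilinearity relations. The linear span of the relations is already an ideal, as a tuple
  times a relation is a relation. A tuple of homogeneous elements has as degree the sum of
  the degrees; \<open>grade\<close> of \<open>free_tensor\<close> is only meant to be pushed to the quotient.
\<close>

definition free_tensor ::
    "'i set \<Rightarrow> ('i \<Rightarrow> (rat, 'b) graded_algebra) \<Rightarrow> (rat, ('i \<Rightarrow> 'b) \<Rightarrow>\<^sub>0 rat) graded_algebra" where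
  "free_tensor I A =
     \<lparr>carrier = {f. Poly_Mapping.keys f \<subseteq> (\<Pi>\<^sub>E i\<in>I. carrier (A i))},
      mult = (\<lambda>f h. \<Sum>u\<in>Poly_Mapping.keys f. \<Sum>v\<in>Poly_Mapping.keys h.
                Poly_Mapping.single (\<lambda>i\<in>I. u i \<otimes>\<^bsub>A i\<^esub> v i) (Poly_Mapping.lookup f u * Poly_Mapping.lookup h v)),
      one = Poly_Mapping.single (\<lambda>i\<in>I. \<one>\<^bsub>A i\<^esub>) 1, zero = 0, add = (+),
      smult = (\<lambda>c f. Poly_Mapping.map ((*) c) f),
      grade = (\<lambda>d. {f. \<forall>u\<in>Poly_Mapping.keys f. u \<in> (\<Pi>\<^sub>E i\<in>I. carrier (A i)) \<and>
                 (\<exists>\<delta>. (\<forall>i\<in>I. u i \<in> grade (A i) (\<delta> i)) \<and> (\<Sum>i\<in>I. \<delta> i) = d)})\<rparr>"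

definition multilinear_rels ::
    "'i set \<Rightarrow> ('i \<Rightarrow> (rat, 'b) graded_algebra) \<Rightarrow> (('i \<Rightarrow> 'b) \<Rightarrow>\<^sub>0 rat) set" where
  "multilinear_rels I A =
     {Poly_Mapping.single (u(i := a \<oplus>\<^bsub>A i\<^esub> b)) 1
        - Poly_Mapping.single (u(i := a)) 1 - Poly_Mapping.single (u(i := b)) 1 | u i a b.
        u \<in> (\<Pi>\<^sub>E i\<in>I. carrier (A i)) \<and> i \<in> I \<and> a \<in> carrier (A i) \<and> b \<in> carrier (A i)} \<union>
     {Poly_Mapping.single (u(i := c \<odot>\<^bsub>A i\<^esub> a)) 1 - Poly_Mapping.single (u(i := a)) c | u i c a.
        u \<in> (\<Pi>\<^sub>E i\<in>I. carrier (A i)) \<and> i \<in> I \<and> a \<in> carrier (A i)}"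

definition tensor_algebra ::
    "'i set \<Rightarrow> ('i \<Rightarrow> (rat, 'b) graded_algebra) \<Rightarrow> (rat, (('i \<Rightarrow> 'b) \<Rightarrow>\<^sub>0 rat) set) graded_algebra" where
  "tensor_algebra I A =
     quot_algebra (free_tensor I A) (Idl\<^bsub>free_tensor I A\<^esub> (multilinear_rels I A))"


section \<open>De Concini--Procesi algebras\<close>

definition DP_lin :: "'a gorder \<Rightarrow> 'a set \<Rightarrow> 'a \<Rightarrow> ('a \<Rightarrow>\<^sub>0 nat) \<Rightarrow>\<^sub>0 rat" where
  "DP_lin L H g = (\<Sum>h\<in>{h\<in>H. g \<sqsubseteq>\<^bsub>L\<^esub> h}. pvar h)"

definition DP_rels :: "'a gorder \<Rightarrow> 'a set \<Rightarrow> 'a set \<Rightarrow> (('a \<Rightarrow>\<^sub>0 nat) \<Rightarrow>\<^sub>0 rat) set" where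
  "DP_rels L H S =
     {(\<Prod>g\<in>T. pvar g) | T. T \<subseteq> H \<and> S \<union> T \<notin> nested_sets L H} \<union> DP_lin L H ` atoms L"

definition DP_rel ::
    "'a gorder \<Rightarrow> 'a set \<Rightarrow> 'a set \<Rightarrow> (rat, (('a \<Rightarrow>\<^sub>0 nat) \<Rightarrow>\<^sub>0 rat) set) graded_algebra" where
  "DP_rel L H S = quot_algebra (poly_algebra H) (Idl\<^bsub>poly_algebra H\<^esub> (DP_rels L H S))"

definition DP :: "'a gorder \<Rightarrow> 'a set \<Rightarrow> (rat, (('a \<Rightarrow>\<^sub>0 nat) \<Rightarrow>\<^sub>0 rat) set) graded_algebra" where
  "DP L H = DP_rel L H {}"

text \<open>The choice of \<open>S\<close> does not matter: the ideal depends only on the join of \<open>S\<close>.\<close>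

definition DP_at ::
    "'a gorder \<Rightarrow> 'a set \<Rightarrow> 'a list \<Rightarrow> 'a blow \<Rightarrow> (rat, (('a \<Rightarrow>\<^sub>0 nat) \<Rightarrow>\<^sub>0 rat) set) graded_algebra" where
  "DP_at L H ps y =
     DP_rel L H (SOME S. S \<in> nested_sets L H \<and> is_lub (blown_lattice L ps) y (blow_emb L H ` S))"


section \<open>Local data at an element of the blown-up lattice\<close>

definition factors :: "'a gorder \<Rightarrow> 'a set \<Rightarrow> 'a set \<Rightarrow> 'a list \<Rightarrow> 'a blow \<Rightarrow> 'a set" where
  "factors L G H ps y =
     (let B = blown_lattice L ps; A = {g \<in> G. blow_emb L H g \<sqsubseteq>\<^bsub>B\<^esub> y} in
      {g \<in> A. \<forall>h\<in>A. blow_emb L H g \<sqsubseteq>\<^bsub>B\<^esub> blow_emb L H h \<longrightarrow> h = g})"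

definition factors_top :: "'a gorder \<Rightarrow> 'a set \<Rightarrow> 'a set \<Rightarrow> 'a list \<Rightarrow> 'a blow \<Rightarrow> 'a set" where
  "factors_top L G H ps y = factors L G H ps y \<union> {\<top>\<^bsub>L\<^esub>}"

definition local_bot :: "'a gorder \<Rightarrow> 'a set \<Rightarrow> 'a set \<Rightarrow> 'a list \<Rightarrow> 'a blow \<Rightarrow> 'a \<Rightarrow> 'a" where
  "local_bot L G H ps y g = \<Squnion>\<^bsub>L\<^esub> {f \<in> factors L G H ps y. f \<sqsubseteq>\<^bsub>L\<^esub> g \<and> f \<noteq> g}"

definition local_lattice :: "'a gorder \<Rightarrow> 'a set \<Rightarrow> 'a set \<Rightarrow> 'a list \<Rightarrow> 'a blow \<Rightarrow> 'a \<Rightarrow> 'a gorder" where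
  "local_lattice L G H ps y g = interval L (local_bot L G H ps y g) g"

definition factor_over :: "'a gorder \<Rightarrow> 'a set \<Rightarrow> 'a set \<Rightarrow> 'a list \<Rightarrow> 'a blow \<Rightarrow> 'a \<Rightarrow> 'a" where
  "factor_over L G H ps y p = (THE g. least L g {g \<in> factors_top L G H ps y. p \<sqsubseteq>\<^bsub>L\<^esub> g})"

definition local_map :: "'a gorder \<Rightarrow> 'a set \<Rightarrow> 'a set \<Rightarrow> 'a list \<Rightarrow> 'a blow \<Rightarrow> 'a \<Rightarrow> 'a" where
  "local_map L G H ps y p = p \<squnion>\<^bsub>L\<^esub> local_bot L G H ps y (factor_over L G H ps y p)"

definition local_building ::
    "'a gorder \<Rightarrow> 'a set \<Rightarrow> 'a set \<Rightarrow> 'a list \<Rightarrow> 'a blow \<Rightarrow> 'a \<Rightarrow> 'a set" where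
  "local_building L G H ps y g =
     local_map L G H ps y ` H \<inter> (carrier (local_lattice L G H ps y g) - {local_bot L G H ps y g})"

definition local_DP ::
    "'a gorder \<Rightarrow> 'a set \<Rightarrow> 'a set \<Rightarrow> 'a list \<Rightarrow> 'a blow \<Rightarrow> 'a \<Rightarrow>
       (rat, (('a \<Rightarrow>\<^sub>0 nat) \<Rightarrow>\<^sub>0 rat) set) graded_algebra" where
  "local_DP L G H ps y g = DP (local_lattice L G H ps y g) (local_building L G H ps y g)"

end

(* Write y as the join of a nested set S. Only F = F(y) matters: a join of elements of F that lies
   in G is one of these elements, and S \<union> T is nested if and only if every join of elements of
   F \<union> T that lies in H - atoms L is one of these elements. Both algebras are quotients of
   polynomial rings; the tensor product is generated by the variables of all H_g, with the
   relations of all factors. The isomorphism sends x_p, for p outside F, to x_{zeta(p)} if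
   S \<union> {p} is nested and to 0 otherwise; on F it is determined by c_g \<mapsto> x_g, by descending
   induction. It then maps c_a to c_{zeta(a)} for each atom a. The inverse sends x_g to c_g for g
   in F and every other x_w to x_q, where zeta(q) = w and S \<union> {q} is nested. In the factors of
   those g that lie outside H - atoms L all variables vanish. *)

theory Submission
  imports Defs "HOL-Library.Disjoint_Sets"
begin

section \<open>Quotients of graded algebras\<close>

text \<open>That c_g goes to x_g for g in F has the following reason. Let a be an atom with hat a in
  \<open>H - atoms L\<close>. Of the elements above a, those not above hat a correspond under zeta,
  once the incompatible ones are dropped, to the elements of the local building set above zeta a
  other than its top hat a. So c_a becomes c_(zeta a) exactly when the elements above hat a add up
  to the variable of hat a. The obstacle is that zeta is not injective on compatible elements. It
  reflects the order as soon as one of the two elements lies in \<open>H - atoms L\<close>, the only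
  place where compatibility tests joins; but several atoms may share an image. Their variables then
  agree modulo the ideal, because the same compatible non-atoms lie above them and their linear
  relations can be subtracted. Hence the choice of q in the inverse is harmless, and the two
  substitutions are inverse to each other only modulo the ideals. The comparison is made for every
  index set between the nontrivial factors and all of F^+, so that both isomorphisms are instances
  of one.\<close>

definition good_algebra :: "('r, 'b) graded_algebra \<Rightarrow> bool" where
  "good_algebra A \<longleftrightarrow> cring A \<and>
     (\<forall>c. \<exists>k\<in>carrier A. \<forall>a\<in>carrier A. c \<odot>\<^bsub>A\<^esub> a = k \<otimes>\<^bsub>A\<^esub> a) \<and> (\<forall>d. grade A d \<subseteq> carrier A)"

lemma good_algebra_cring: "good_algebra A \<Longrightarrow> cring A"
  by (simp add: good_algebra_def)

lemma good_algebra_smult_closed: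
  assumes "good_algebra A" "a \<in> carrier A"
  shows "c \<odot>\<^bsub>A\<^esub> a \<in> carrier A"
proof -
  interpret cring A using assms(1) by (rule good_algebra_cring)
  show ?thesis using assms unfolding good_algebra_def by (metis m_closed)
qed

lemma good_algebra_grade: "good_algebra A \<Longrightarrow> a \<in> grade A d \<Longrightarrow> a \<in> carrier A"
  by (auto simp: good_algebra_def)

text \<open>\<open>quot_algebra\<close> copies the operations of \<open>A Quot I\<close> into a
  longer record, which is a different object; the ring axioms are therefore carried over operation
  by operation.\<close>

lemma cring_cong:
  assumes "cring R" "carrier S = carrier R" "mult S = mult R" "one S = one R"
    "zero S = zero R" "add S = add R"
  shows "cring S"
proof -
  interpret R: cring R by fact
  show ?thesis
  proof (intro cringI abelian_groupI comm_monoidI)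
    show "\<exists>y\<in>carrier S. y \<oplus>\<^bsub>S\<^esub> x = \<zero>\<^bsub>S\<^esub>" if "x \<in> carrier S" for x
      using that by (intro bexI[of _ "\<ominus>\<^bsub>R\<^esub> x"]) (simp_all add: assms R.l_neg)
  qed (simp_all only: assms R.a_closed R.m_closed R.a_assoc R.m_assoc R.l_distr R.zero_closed R.one_closed R.l_zero R.l_one,
      simp_all only: R.a_comm R.m_comm)
qed

lemma carrier_quot_algebra: "carrier (quot_algebra A I) = (\<lambda>a. I +>\<^bsub>A\<^esub> a) ` carrier A"
  by (auto simp: quot_algebra_def FactRing_def A_RCOSETS_def')

lemma grade_quot_algebra: "grade (quot_algebra A I) d = (\<lambda>a. I +>\<^bsub>A\<^esub> a) ` grade A d"
  by (simp add: quot_algebra_def)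

lemma one_quot_algebra: "\<one>\<^bsub>quot_algebra A I\<^esub> = I +>\<^bsub>A\<^esub> \<one>\<^bsub>A\<^esub>"
  by (simp add: quot_algebra_def FactRing_def)

context
  fixes A :: "('r, 'b) graded_algebra" and I
  assumes A: "good_algebra A" and I: "ideal I A"
begin

interpretation A: cring A using A by (rule good_algebra_cring)
interpretation I: ideal I A by (rule I)

lemma coset_eq_iff:
  assumes "a \<in> carrier A" "b \<in> carrier A"
  shows "I +>\<^bsub>A\<^esub> a = I +>\<^bsub>A\<^esub> b \<longleftrightarrow> a \<ominus>\<^bsub>A\<^esub> b \<in> I"
  using A.quotient_eq_iff_same_a_r_cos[OF I assms] by simp

lemma add_quot_algebra:
  assumes "a \<in> carrier A" "b \<in> carrier A"
  shows "(I +>\<^bsub>A\<^esub> a) \<oplus>\<^bsub>quot_algebra A I\<^esub> (I +>\<^bsub>A\<^esub> b) = I +>\<^bsub>A\<^esub> (a \<oplus>\<^bsub>A\<^esub> b)"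
  using assms by (simp add: quot_algebra_def FactRing_def I.a_rcos_sum)

lemma mult_quot_algebra:
  assumes "a \<in> carrier A" "b \<in> carrier A"
  shows "(I +>\<^bsub>A\<^esub> a) \<otimes>\<^bsub>quot_algebra A I\<^esub> (I +>\<^bsub>A\<^esub> b) = I +>\<^bsub>A\<^esub> (a \<otimes>\<^bsub>A\<^esub> b)"
  using assms by (simp add: quot_algebra_def FactRing_def I.rcoset_mult_add)

text \<open>A scalar acts as multiplication by some ring element \<open>k\<close>. So changing
  \<open>a\<close> by an element of the ideal changes the result by an element of the ideal, and the
  union that defines the scalar action on a coset is a single coset.\<close>

lemma smult_quot_algebra:
  assumes a: "a \<in> carrier A"
  shows "c \<odot>\<^bsub>quot_algebra A I\<^esub> (I +>\<^bsub>A\<^esub> a) = I +>\<^bsub>A\<^esub> (c \<odot>\<^bsub>A\<^esub> a)"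
proof -
  obtain k where k: "k \<in> carrier A" "\<And>a. a \<in> carrier A \<Longrightarrow> c \<odot>\<^bsub>A\<^esub> a = k \<otimes>\<^bsub>A\<^esub> a"
    using A unfolding good_algebra_def by metis
  have *: "I +>\<^bsub>A\<^esub> (c \<odot>\<^bsub>A\<^esub> b) = I +>\<^bsub>A\<^esub> (c \<odot>\<^bsub>A\<^esub> a)" if b: "b \<in> I +>\<^bsub>A\<^esub> a" for b
  proof -
    obtain i where i: "i \<in> I" "b = i \<oplus>\<^bsub>A\<^esub> a"
      using b by (auto simp: a_r_coset_def')
    have ic: "i \<in> carrier A" using i I.a_Hcarr by blast
    have "c \<odot>\<^bsub>A\<^esub> b \<ominus>\<^bsub>A\<^esub> c \<odot>\<^bsub>A\<^esub> a = k \<otimes>\<^bsub>A\<^esub> i"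
      using k i ic a by (simp add: A.r_distr) (simp add: A.minus_eq A.a_assoc A.r_neg)
    then show ?thesis
      using coset_eq_iff[of "c \<odot>\<^bsub>A\<^esub> b" "c \<odot>\<^bsub>A\<^esub> a"] good_algebra_smult_closed[OF A] a i ic k
      by (simp add: I.I_l_closed)
  qed
  have "a \<in> I +>\<^bsub>A\<^esub> a" using a I.a_rcos_self by blast
  then have "(\<Union>b\<in>I +>\<^bsub>A\<^esub> a. I +>\<^bsub>A\<^esub> (c \<odot>\<^bsub>A\<^esub> b)) = I +>\<^bsub>A\<^esub> (c \<odot>\<^bsub>A\<^esub> a)"
    using * by blast
  then show ?thesis by (simp add: quot_algebra_def)
qed

lemma good_quot_algebra: "good_algebra (quot_algebra A I)"
proof -
  let ?Q = "quot_algebra A I"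
  interpret Q: cring "A Quot I" using I.quotient_is_cring A.is_cring by blast
  have cr: "cring ?Q"
    by (rule cring_cong[OF Q.is_cring]) (simp_all only: quot_algebra_def partial_object.simps monoid.simps ring.simps)
  have sm: "\<exists>k\<in>carrier ?Q. \<forall>a\<in>carrier ?Q. c \<odot>\<^bsub>?Q\<^esub> a = k \<otimes>\<^bsub>?Q\<^esub> a" for c
  proof -
    obtain k where k: "k \<in> carrier A" "\<And>a. a \<in> carrier A \<Longrightarrow> c \<odot>\<^bsub>A\<^esub> a = k \<otimes>\<^bsub>A\<^esub> a"
      using A unfolding good_algebra_def by metis
    have "c \<odot>\<^bsub>?Q\<^esub> X = (I +>\<^bsub>A\<^esub> k) \<otimes>\<^bsub>?Q\<^esub> X" if X: "X \<in> carrier ?Q" for X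
    proof -
      obtain a where a: "a \<in> carrier A" "X = I +>\<^bsub>A\<^esub> a" using X unfolding carrier_quot_algebra by blast
      show ?thesis
        unfolding a(2) smult_quot_algebra[OF a(1)] mult_quot_algebra[OF k(1) a(1)] k(2)[OF a(1)] ..
    qed
    moreover have "I +>\<^bsub>A\<^esub> k \<in> carrier ?Q" using k(1) by (simp add: carrier_quot_algebra)
    ultimately show ?thesis by blast
  qed
  have gr: "grade ?Q d \<subseteq> carrier ?Q" for d
    unfolding carrier_quot_algebra grade_quot_algebra
    by (rule image_mono) (use good_algebra_grade[OF A] in blast)
  show ?thesis unfolding good_algebra_def by (intro conjI allI cr sm gr)
qed

end

text \<open>The map \<open>h\<close> has to respect the operations only modulo \<open>J\<close>: for
  tensor products it will be built from chosen representatives of cosets, and is then multiplicative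
  only up to \<open>J\<close>. Additivity modulo \<open>J\<close> together with \<open>ker\<close>
  makes the induced map well defined and injective.\<close>

lemma graded_iso_quot_algebra:
  fixes A :: "('r, 'b) graded_algebra" and C :: "('r, 'c) graded_algebra"
  assumes A: "good_algebra A" and I: "ideal I A" and C: "good_algebra C" and J: "ideal J C"
    and h: "\<And>a. a \<in> carrier A \<Longrightarrow> h a \<in> carrier C"
    and add: "\<And>a b. a \<in> carrier A \<Longrightarrow> b \<in> carrier A \<Longrightarrow> J +>\<^bsub>C\<^esub> h (a \<oplus>\<^bsub>A\<^esub> b) = J +>\<^bsub>C\<^esub> (h a \<oplus>\<^bsub>C\<^esub> h b)"
    and mult: "\<And>a b. a \<in> carrier A \<Longrightarrow> b \<in> carrier A \<Longrightarrow> J +>\<^bsub>C\<^esub> h (a \<otimes>\<^bsub>A\<^esub> b) = J +>\<^bsub>C\<^esub> (h a \<otimes>\<^bsub>C\<^esub> h b)"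
    and one: "J +>\<^bsub>C\<^esub> h \<one>\<^bsub>A\<^esub> = J +>\<^bsub>C\<^esub> \<one>\<^bsub>C\<^esub>"
    and smult: "\<And>c a. a \<in> carrier A \<Longrightarrow> J +>\<^bsub>C\<^esub> h (c \<odot>\<^bsub>A\<^esub> a) = J +>\<^bsub>C\<^esub> (c \<odot>\<^bsub>C\<^esub> h a)"
    and ker: "\<And>a. a \<in> carrier A \<Longrightarrow> h a \<in> J \<longleftrightarrow> a \<in> I"
    and surj: "\<And>f. f \<in> carrier C \<Longrightarrow> \<exists>a\<in>carrier A. J +>\<^bsub>C\<^esub> h a = J +>\<^bsub>C\<^esub> f"
    and grade1: "\<And>d a. a \<in> grade A d \<Longrightarrow> \<exists>f\<in>grade C d. J +>\<^bsub>C\<^esub> h a = J +>\<^bsub>C\<^esub> f"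
    and grade2: "\<And>d f. f \<in> grade C d \<Longrightarrow> \<exists>a\<in>grade A d. J +>\<^bsub>C\<^esub> h a = J +>\<^bsub>C\<^esub> f"
  shows "quot_algebra A I \<cong>\<^sub>g\<^sub>r quot_algebra C J"
proof -
  interpret A: cring A using A by (rule good_algebra_cring)
  interpret I: ideal I A by (rule I)
  interpret C: cring C using C by (rule good_algebra_cring)
  interpret J: ideal J C by (rule J)
  define \<phi> where "\<phi> X = J +>\<^bsub>C\<^esub> h (SOME a. a \<in> carrier A \<and> X = I +>\<^bsub>A\<^esub> a)" for X
  have eq: "I +>\<^bsub>A\<^esub> a = I +>\<^bsub>A\<^esub> b \<longleftrightarrow> J +>\<^bsub>C\<^esub> h a = J +>\<^bsub>C\<^esub> h b"
    if ab: "a \<in> carrier A" "b \<in> carrier A" for a b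
  proof -
    have d: "a \<ominus>\<^bsub>A\<^esub> b \<in> carrier A" using ab by simp
    \<comment> \<open>Writing \<open>a\<close> as a difference plus \<open>b\<close> brings the
      claim back to additivity, as no rule for \<open>h\<close> on differences is assumed.\<close>
    have "a = (a \<ominus>\<^bsub>A\<^esub> b) \<oplus>\<^bsub>A\<^esub> b" using ab by (simp add: A.minus_eq A.a_assoc A.l_neg)
    then have "J +>\<^bsub>C\<^esub> h a = J +>\<^bsub>C\<^esub> (h (a \<ominus>\<^bsub>A\<^esub> b) \<oplus>\<^bsub>C\<^esub> h b)" using add[OF d ab(2)] by simp
    then have "J +>\<^bsub>C\<^esub> h a = J +>\<^bsub>C\<^esub> h b \<longleftrightarrow> (h (a \<ominus>\<^bsub>A\<^esub> b) \<oplus>\<^bsub>C\<^esub> h b) \<ominus>\<^bsub>C\<^esub> h b \<in> J"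
      using coset_eq_iff[OF C J, of "h (a \<ominus>\<^bsub>A\<^esub> b) \<oplus>\<^bsub>C\<^esub> h b" "h b"] h d ab by simp
    also have "(h (a \<ominus>\<^bsub>A\<^esub> b) \<oplus>\<^bsub>C\<^esub> h b) \<ominus>\<^bsub>C\<^esub> h b = h (a \<ominus>\<^bsub>A\<^esub> b)"
      using h d ab by (simp add: C.minus_eq C.a_assoc C.r_neg)
    finally show ?thesis using ker[OF d] coset_eq_iff[OF A I ab] by simp
  qed
  have \<phi>: "\<phi> (I +>\<^bsub>A\<^esub> a) = J +>\<^bsub>C\<^esub> h a" if a: "a \<in> carrier A" for a
  proof -
    define b where "b = (SOME b. b \<in> carrier A \<and> I +>\<^bsub>A\<^esub> a = I +>\<^bsub>A\<^esub> b)"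
    have b: "b \<in> carrier A \<and> I +>\<^bsub>A\<^esub> a = I +>\<^bsub>A\<^esub> b"
      unfolding b_def by (rule someI_ex) (use a in blast)
    have "\<phi> (I +>\<^bsub>A\<^esub> a) = J +>\<^bsub>C\<^esub> h b" unfolding \<phi>_def b_def ..
    then show ?thesis using eq[OF a conjunct1[OF b]] conjunct2[OF b] by metis
  qed
  have hom: "\<phi> \<in> ring_hom (quot_algebra A I) (quot_algebra C J)"
  proof (rule ring_hom_memI)
    fix X Y assume "X \<in> carrier (quot_algebra A I)" "Y \<in> carrier (quot_algebra A I)"
    then obtain a b where ab: "a \<in> carrier A" "b \<in> carrier A" "X = I +>\<^bsub>A\<^esub> a" "Y = I +>\<^bsub>A\<^esub> b"
      by (auto simp: carrier_quot_algebra)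
    show "\<phi> X \<in> carrier (quot_algebra C J)"
      unfolding ab \<phi>[OF ab(1)] carrier_quot_algebra using h[OF ab(1)] by blast
    show "\<phi> (X \<otimes>\<^bsub>quot_algebra A I\<^esub> Y) = \<phi> X \<otimes>\<^bsub>quot_algebra C J\<^esub> \<phi> Y"
      unfolding ab \<phi>[OF ab(1)] \<phi>[OF ab(2)] mult_quot_algebra[OF A I ab(1,2)]
        mult_quot_algebra[OF C J h[OF ab(1)] h[OF ab(2)]] \<phi>[OF A.m_closed[OF ab(1,2)]]
      by (rule mult[OF ab(1,2)])
    show "\<phi> (X \<oplus>\<^bsub>quot_algebra A I\<^esub> Y) = \<phi> X \<oplus>\<^bsub>quot_algebra C J\<^esub> \<phi> Y"
      unfolding ab \<phi>[OF ab(1)] \<phi>[OF ab(2)] add_quot_algebra[OF A I ab(1,2)]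
        add_quot_algebra[OF C J h[OF ab(1)] h[OF ab(2)]] \<phi>[OF A.a_closed[OF ab(1,2)]]
      by (rule add[OF ab(1,2)])
  next
    show "\<phi> \<one>\<^bsub>quot_algebra A I\<^esub> = \<one>\<^bsub>quot_algebra C J\<^esub>"
      unfolding one_quot_algebra \<phi>[OF A.one_closed] by (rule one)
  qed
  have bij: "bij_betw \<phi> (carrier (quot_algebra A I)) (carrier (quot_algebra C J))"
    unfolding bij_betw_def
  proof
    show "inj_on \<phi> (carrier (quot_algebra A I))"
    proof (rule inj_onI)
      fix X Y assume "X \<in> carrier (quot_algebra A I)" "Y \<in> carrier (quot_algebra A I)" and XY: "\<phi> X = \<phi> Y"
      then obtain a b where ab: "a \<in> carrier A" "b \<in> carrier A" "X = I +>\<^bsub>A\<^esub> a" "Y = I +>\<^bsub>A\<^esub> b"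
        by (auto simp: carrier_quot_algebra)
      show "X = Y" using XY unfolding ab \<phi>[OF ab(1)] \<phi>[OF ab(2)] using eq[OF ab(1,2)] by blast
    qed
    have "\<phi> ` carrier (quot_algebra A I) = (\<lambda>a. J +>\<^bsub>C\<^esub> h a) ` carrier A"
      unfolding carrier_quot_algebra image_image by (rule image_cong) (simp_all add: \<phi>)
    also have "\<dots> = (\<lambda>f. J +>\<^bsub>C\<^esub> f) ` carrier C"
    proof (intro equalityI subsetI)
      fix X assume "X \<in> (\<lambda>f. J +>\<^bsub>C\<^esub> f) ` carrier C"
      then obtain f where "f \<in> carrier C" "X = J +>\<^bsub>C\<^esub> f" by blast
      with surj[OF this(1)] show "X \<in> (\<lambda>a. J +>\<^bsub>C\<^esub> h a) ` carrier A" by auto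
    qed (use h in blast)
    finally show "\<phi> ` carrier (quot_algebra A I) = carrier (quot_algebra C J)"
      by (simp add: carrier_quot_algebra)
  qed
  have iso: "\<phi> \<in> ring_iso (quot_algebra A I) (quot_algebra C J)"
    using hom bij by (simp add: ring_iso_def)
  have sm: "\<phi> (c \<odot>\<^bsub>quot_algebra A I\<^esub> X) = c \<odot>\<^bsub>quot_algebra C J\<^esub> \<phi> X"
    if X: "X \<in> carrier (quot_algebra A I)" for c X
  proof -
    obtain a where a: "a \<in> carrier A" "X = I +>\<^bsub>A\<^esub> a" using X by (auto simp: carrier_quot_algebra)
    show ?thesis
      unfolding a(2) smult_quot_algebra[OF A I a(1)] \<phi>[OF a(1)] smult_quot_algebra[OF C J h[OF a(1)]]
        \<phi>[OF good_algebra_smult_closed[OF A a(1)]] by (rule smult[OF a(1)])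
  qed
  have gr: "\<phi> ` grade (quot_algebra A I) d = grade (quot_algebra C J) d" for d
  proof -
    have "\<phi> ` grade (quot_algebra A I) d = (\<lambda>a. J +>\<^bsub>C\<^esub> h a) ` grade A d"
      unfolding grade_quot_algebra image_image
      by (rule image_cong) (simp_all add: \<phi> good_algebra_grade[OF A])
    also have "\<dots> = (\<lambda>f. J +>\<^bsub>C\<^esub> f) ` grade C d"
    proof (intro equalityI subsetI)
      fix X assume "X \<in> (\<lambda>a. J +>\<^bsub>C\<^esub> h a) ` grade A d"
      then obtain a where "a \<in> grade A d" "X = J +>\<^bsub>C\<^esub> h a" by blast
      with grade1[OF this(1)] show "X \<in> (\<lambda>f. J +>\<^bsub>C\<^esub> f) ` grade C d" by auto
    next
      fix X assume "X \<in> (\<lambda>f. J +>\<^bsub>C\<^esub> f) ` grade C d"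
      then obtain f where "f \<in> grade C d" "X = J +>\<^bsub>C\<^esub> f" by blast
      with grade2[OF this(1)] show "X \<in> (\<lambda>a. J +>\<^bsub>C\<^esub> h a) ` grade A d" by auto
    qed
    finally show ?thesis by (simp add: grade_quot_algebra)
  qed
  show ?thesis unfolding graded_iso_def using iso sm gr by blast
qed

lemma graded_iso_trans:
  assumes "A \<cong>\<^sub>g\<^sub>r B" "B \<cong>\<^sub>g\<^sub>r C"
  shows "A \<cong>\<^sub>g\<^sub>r C"
proof -
  obtain f where f: "f \<in> ring_iso A B" "\<And>c a. a \<in> carrier A \<Longrightarrow> f (c \<odot>\<^bsub>A\<^esub> a) = c \<odot>\<^bsub>B\<^esub> f a"
    "\<And>d. f ` grade A d = grade B d" using assms(1) unfolding graded_iso_def by blast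
  obtain g where g: "g \<in> ring_iso B C" "\<And>c a. a \<in> carrier B \<Longrightarrow> g (c \<odot>\<^bsub>B\<^esub> a) = c \<odot>\<^bsub>C\<^esub> g a"
    "\<And>d. g ` grade B d = grade C d" using assms(2) unfolding graded_iso_def by blast
  have 1: "g \<circ> f \<in> ring_iso A C" using f(1) g(1) by (rule ring_iso_set_trans)
  have 2: "\<forall>c. \<forall>a\<in>carrier A. (g \<circ> f) (c \<odot>\<^bsub>A\<^esub> a) = c \<odot>\<^bsub>C\<^esub> (g \<circ> f) a"
  proof (intro allI ballI)
    fix c a assume a: "a \<in> carrier A"
    have "f a \<in> carrier B" using f(1) a by (rule ring_iso_memE(1))
    then show "(g \<circ> f) (c \<odot>\<^bsub>A\<^esub> a) = c \<odot>\<^bsub>C\<^esub> (g \<circ> f) a"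
      unfolding comp_def f(2)[OF a] by (rule g(2))
  qed
  have 3: "\<forall>d. (g \<circ> f) ` grade A d = grade C d"
    by (simp only: image_comp[symmetric] f(3) g(3) simp_thms)
  show ?thesis unfolding graded_iso_def by (rule bexI[OF _ 1]) (rule conjI[OF 2 3])
qed

lemma graded_iso_sym:
  assumes A: "good_algebra A" and "A \<cong>\<^sub>g\<^sub>r B"
  shows "B \<cong>\<^sub>g\<^sub>r A"
proof -
  obtain f where f: "f \<in> ring_iso A B" "\<forall>c. \<forall>a\<in>carrier A. f (c \<odot>\<^bsub>A\<^esub> a) = c \<odot>\<^bsub>B\<^esub> f a"
    "\<forall>d. f ` grade A d = grade B d"
    using assms(2) unfolding graded_iso_def by (elim bexE conjE)
  note f = f(1) f(2)[rule_format] f(3)[rule_format]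
  interpret A: cring A using A by (rule good_algebra_cring)
  let ?g = "inv_into (carrier A) f"
  have bij: "bij_betw f (carrier A) (carrier B)" using f(1) by (simp add: ring_iso_def)
  have gf: "?g (f a) = a" if "a \<in> carrier A" for a
    using bij that by (simp add: bij_betw_def)
  have 1: "?g \<in> ring_iso B A" by (rule ring_iso_set_sym[OF A.ring_axioms f(1)])
  have 2: "?g (c \<odot>\<^bsub>B\<^esub> b) = c \<odot>\<^bsub>A\<^esub> ?g b" if b: "b \<in> carrier B" for c b
  proof -
    obtain a where a: "a \<in> carrier A" "b = f a" using bij_betw_imp_surj_on[OF bij] b by blast
    show ?thesis
      unfolding a(2) f(2)[OF a(1), symmetric] gf[OF a(1)] gf[OF good_algebra_smult_closed[OF A a(1)]] ..
  qed
  have 3: "?g ` grade B d = grade A d" for d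
  proof -
    have "?g ` f ` grade A d = (\<lambda>a. a) ` grade A d"
      unfolding image_image by (rule image_cong[OF refl]) (rule gf[OF good_algebra_grade[OF A]])
    then show ?thesis unfolding f(3) image_ident .
  qed
  show ?thesis unfolding graded_iso_def by (rule bexI[OF _ 1]) (intro conjI allI ballI 2 3)
qed

section \<open>Polynomial algebras\<close>

abbreviation lkp :: "('a \<Rightarrow>\<^sub>0 'b::zero) \<Rightarrow> 'a \<Rightarrow> 'b" where "lkp \<equiv> Poly_Mapping.lookup"
abbreviation kys :: "('a \<Rightarrow>\<^sub>0 'b::zero) \<Rightarrow> 'a set" where "kys \<equiv> Poly_Mapping.keys"
abbreviation sgl :: "'a \<Rightarrow> 'b \<Rightarrow> 'a \<Rightarrow>\<^sub>0 'b::zero" where "sgl \<equiv> Poly_Mapping.single"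

lemma sum_single_keys: "(\<Sum>m\<in>kys f. sgl m (lkp f m)) = (f :: 'm \<Rightarrow>\<^sub>0 'c::comm_monoid_add)"
proof (rule poly_mapping_eqI)
  fix k
  have "lkp (\<Sum>m\<in>kys f. sgl m (lkp f m)) k = (\<Sum>m\<in>kys f. if m = k then lkp f k else 0)"
    by (auto simp: lookup_sum lookup_single when_def intro!: sum.cong)
  also have "\<dots> = lkp f k" by (simp add: in_keys_iff)
  finally show "lkp (\<Sum>m\<in>kys f. sgl m (lkp f m)) k = lkp f k" .
qed

text \<open>A finitely supported function is the sum of its single terms. Carrying \<open>X\<close>
  along keeps the induction inside the span of the permitted monomials or tuples.\<close>

lemma poly_mapping_additive_induct [consumes 1, case_names zero single add]:
  fixes f :: "'m \<Rightarrow>\<^sub>0 'c::comm_monoid_add"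
  assumes keys: "kys f \<subseteq> X" and zero: "P 0" and single: "\<And>m c. m \<in> X \<Longrightarrow> P (sgl m c)"
    and add: "\<And>g h. kys g \<subseteq> X \<Longrightarrow> kys h \<subseteq> X \<Longrightarrow> P g \<Longrightarrow> P h \<Longrightarrow> P (g + h)"
  shows "P f"
proof -
  have "P (\<Sum>m\<in>M. sgl m (lkp f m)) \<and> kys (\<Sum>m\<in>M. sgl m (lkp f m)) \<subseteq> X"
    if "finite M" "M \<subseteq> X" for M
    using that
  proof (induction M)
    case (insert m M)
    have k: "kys (sgl m (lkp f m)) \<subseteq> X" using insert.prems by simp
    have "kys (sgl m (lkp f m) + (\<Sum>m\<in>M. sgl m (lkp f m))) \<subseteq> X"
      using keys_add[of "sgl m (lkp f m)" "\<Sum>m\<in>M. sgl m (lkp f m)"] k insert by blast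
    then show ?case using insert k by (simp add: add single)
  qed (simp add: zero)
  from this[OF finite_keys keys] show ?thesis by (simp add: sum_single_keys)
qed

text \<open>The coefficient is handed to \<open>k\<close> instead of being multiplied in from
  outside. One operator thus serves targets without a common scalar multiplication: polynomials,
  where a coefficient becomes the constant \<open>sgl 0 c\<close>, and formal combinations of
  tuples, where it stays a coefficient.\<close>

definition lin_ext :: "('m \<Rightarrow> 'c \<Rightarrow> 'd::comm_monoid_add) \<Rightarrow> ('m \<Rightarrow>\<^sub>0 'c::comm_monoid_add) \<Rightarrow> 'd" where
  "lin_ext k f = (\<Sum>m\<in>kys f. k m (lkp f m))"

lemma lin_ext_zero [simp]: "lin_ext k 0 = 0"
  by (simp add: lin_ext_def)

lemma lin_ext_add:
  assumes "\<And>m. k m 0 = 0" "\<And>m c d. k m (c + d) = k m c + k m d"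
  shows "lin_ext k (f + g) = lin_ext k f + lin_ext k g"
  unfolding lin_ext_def by (rule setsum_keys_plus_distrib) (simp_all add: assms)

lemma lin_ext_single:
  assumes "\<And>m. k m 0 = 0"
  shows "lin_ext k (sgl m c) = k m c"
  by (simp add: lin_ext_def assms)

subsection \<open>The algebra structure\<close>

lemma carrier_poly_algebra: "f \<in> carrier (poly_algebra V) \<longleftrightarrow> (\<forall>m\<in>kys f. kys m \<subseteq> V)"
  by (simp add: poly_algebra_def)

lemma poly_algebra_simps [simp]:
  "mult (poly_algebra V) = (*)" "one (poly_algebra V) = 1" "zero (poly_algebra V) = 0"
  "add (poly_algebra V) = (+)" "smult (poly_algebra V) c f = sgl 0 c * f"
  by (simp_all add: poly_algebra_def mult_map_scale_conv_mult)

lemma keys_add_nat: "kys (m + n) = kys m \<union> kys (n :: 'v \<Rightarrow>\<^sub>0 nat)"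
  by (auto simp: in_keys_iff lookup_add)

lemma poly_carrier_add: "f \<in> carrier (poly_algebra V) \<Longrightarrow> g \<in> carrier (poly_algebra V) \<Longrightarrow>
    f + g \<in> carrier (poly_algebra V)"
  unfolding carrier_poly_algebra using keys_add[of f g] by blast

lemma poly_carrier_mult: "f \<in> carrier (poly_algebra V) \<Longrightarrow> g \<in> carrier (poly_algebra V) \<Longrightarrow>
    f * g \<in> carrier (poly_algebra V)"
  unfolding carrier_poly_algebra using keys_mult[of f g] by (fastforce simp: keys_add_nat)

lemma poly_carrier_uminus: "f \<in> carrier (poly_algebra V) \<Longrightarrow> - f \<in> carrier (poly_algebra V)"
  by (simp add: carrier_poly_algebra in_keys_iff)

lemma poly_carrier_single: "kys m \<subseteq> V \<Longrightarrow> sgl m c \<in> carrier (poly_algebra V)"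
  by (simp add: carrier_poly_algebra)

lemma poly_carrier_0 [simp]: "0 \<in> carrier (poly_algebra V)"
  by (simp add: carrier_poly_algebra)

lemma poly_carrier_1 [simp]: "1 \<in> carrier (poly_algebra V)"
  by (simp add: carrier_poly_algebra)

lemma poly_carrier_const [simp]: "sgl 0 c \<in> carrier (poly_algebra V)"
  by (simp add: poly_carrier_single)

lemma poly_carrier_pvar: "v \<in> V \<Longrightarrow> pvar v \<in> carrier (poly_algebra V)"
  by (simp add: carrier_poly_algebra pvar_def)

lemma poly_carrier_sum: "(\<And>a. a \<in> A \<Longrightarrow> f a \<in> carrier (poly_algebra V)) \<Longrightarrow> sum f A \<in> carrier (poly_algebra V)"
  by (induction A rule: infinite_finite_induct) (simp_all add: poly_carrier_add)

lemma poly_carrier_prod: "(\<And>a. a \<in> A \<Longrightarrow> f a \<in> carrier (poly_algebra V)) \<Longrightarrow> prod f A \<in> carrier (poly_algebra V)"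
  by (induction A rule: infinite_finite_induct) (simp_all add: poly_carrier_mult)

lemma poly_carrier_power: "f \<in> carrier (poly_algebra V) \<Longrightarrow> f ^ n \<in> carrier (poly_algebra V)"
  by (induction n) (simp_all add: poly_carrier_mult)

lemma poly_carrier_mono: "V \<subseteq> W \<Longrightarrow> f \<in> carrier (poly_algebra V) \<Longrightarrow> f \<in> carrier (poly_algebra W)"
  by (force simp: carrier_poly_algebra)

lemma cring_poly_algebra: "cring (poly_algebra V)"
proof (intro cringI abelian_groupI comm_monoidI)
  show "\<exists>y\<in>carrier (poly_algebra V). y \<oplus>\<^bsub>poly_algebra V\<^esub> x = \<zero>\<^bsub>poly_algebra V\<^esub>"
    if "x \<in> carrier (poly_algebra V)" for x
    using that by (intro bexI[of _ "- x"]) (simp_all add: poly_carrier_uminus)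
qed (simp_all add: poly_carrier_add poly_carrier_mult algebra_simps)

lemma good_poly_algebra: "good_algebra (poly_algebra V)"
  unfolding good_algebra_def
proof (intro conjI allI)
  show "\<exists>k\<in>carrier (poly_algebra V). \<forall>a\<in>carrier (poly_algebra V). c \<odot>\<^bsub>poly_algebra V\<^esub> a = k \<otimes>\<^bsub>poly_algebra V\<^esub> a" for c
    by (rule bexI[of _ "sgl 0 c"]) simp_all
  show "cring (poly_algebra V)" by (rule cring_poly_algebra)
  show "grade (poly_algebra V) d \<subseteq> carrier (poly_algebra V)" for d by (auto simp: poly_algebra_def)
qed

lemma poly_ominus:
  assumes "a \<in> carrier (poly_algebra V)" "b \<in> carrier (poly_algebra V)"
  shows "a \<ominus>\<^bsub>poly_algebra V\<^esub> b = a - b"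
proof -
  interpret cring "poly_algebra V" by (rule cring_poly_algebra)
  have "\<ominus>\<^bsub>poly_algebra V\<^esub> b = - b"
    by (rule minus_equality) (use assms poly_carrier_uminus in auto)
  then show ?thesis by (simp add: minus_eq)
qed

lemma poly_coset_eq_iff:
  assumes "ideal J (poly_algebra V)" "f \<in> carrier (poly_algebra V)" "g \<in> carrier (poly_algebra V)"
  shows "J +>\<^bsub>poly_algebra V\<^esub> f = J +>\<^bsub>poly_algebra V\<^esub> g \<longleftrightarrow> f - g \<in> J"
  using coset_eq_iff[OF good_poly_algebra assms(1-3)] poly_ominus[OF assms(2,3)] by simp

text \<open>Closure under negatives follows, since the negative is the product with the constant
  -1.\<close>

lemma poly_idealI:
  assumes "I \<subseteq> carrier (poly_algebra V)" "0 \<in> I" "\<And>a b. a \<in> I \<Longrightarrow> b \<in> I \<Longrightarrow> a + b \<in> I"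
    "\<And>a r. a \<in> I \<Longrightarrow> r \<in> carrier (poly_algebra V) \<Longrightarrow> r * a \<in> I"
  shows "ideal I (poly_algebra V)"
proof -
  interpret cring "poly_algebra V" by (rule cring_poly_algebra)
  show ?thesis
  proof (rule idealI[OF ring_axioms])
    show "subgroup I (add_monoid (poly_algebra V))"
    proof (rule add.subgroupI)
      fix a assume a: "a \<in> I"
      have "\<ominus>\<^bsub>poly_algebra V\<^esub> a = (- 1) * a"
        using poly_ominus[of 0 V a] a assms(1) by (auto simp: minus_eq)
      then show "\<ominus>\<^bsub>poly_algebra V\<^esub> a \<in> I" using assms(4)[OF a, of "- 1"] poly_carrier_uminus[of 1 V] by simp
    qed (use assms in auto)
  qed (use assms in \<open>auto simp: mult.commute\<close>)
qed

context
  fixes J :: "(('v \<Rightarrow>\<^sub>0 nat) \<Rightarrow>\<^sub>0 rat) set" and V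
  assumes J: "ideal J (poly_algebra V)"
begin

interpretation ideal J "poly_algebra V" by (rule J)

lemma poly_ideal_0: "0 \<in> J"
  using additive_subgroup.zero_closed[OF additive_subgroup_axioms] by simp

lemma poly_ideal_add: "f \<in> J \<Longrightarrow> g \<in> J \<Longrightarrow> f + g \<in> J"
  using additive_subgroup.a_closed[OF additive_subgroup_axioms] by simp

lemma poly_ideal_mult: "f \<in> J \<Longrightarrow> r \<in> carrier (poly_algebra V) \<Longrightarrow> r * f \<in> J"
  using I_l_closed by simp

lemma poly_ideal_uminus: "f \<in> J \<Longrightarrow> - f \<in> J"
  using poly_ideal_mult[of f "- 1"] poly_carrier_uminus[of 1 V] by simp

lemma poly_ideal_diff: "f \<in> J \<Longrightarrow> g \<in> J \<Longrightarrow> f - g \<in> J"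
  using poly_ideal_add[of f "- g"] poly_ideal_uminus[of g] by simp

lemma poly_ideal_sum: "(\<And>a. a \<in> A \<Longrightarrow> f a \<in> J) \<Longrightarrow> sum f A \<in> J"
  by (induction A rule: infinite_finite_induct) (simp_all add: poly_ideal_add poly_ideal_0)

lemma poly_ideal_mult_cong:
  assumes "a - b \<in> J" "c - d \<in> J" "b \<in> carrier (poly_algebra V)" "c \<in> carrier (poly_algebra V)"
  shows "a * c - b * d \<in> J"
proof -
  have "a * c - b * d = c * (a - b) + b * (c - d)" by (simp add: algebra_simps)
  then show ?thesis using assms by (simp add: poly_ideal_add poly_ideal_mult)
qed

lemma poly_ideal_prod_cong:
  assumes "\<And>i. i \<in> A \<Longrightarrow> f i - g i \<in> J"
    "\<And>i. i \<in> A \<Longrightarrow> f i \<in> carrier (poly_algebra V)" "\<And>i. i \<in> A \<Longrightarrow> g i \<in> carrier (poly_algebra V)"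
  shows "prod f A - prod g A \<in> J"
  using assms
  by (induction A rule: infinite_finite_induct)
    (auto simp: poly_ideal_0 intro!: poly_ideal_mult_cong poly_carrier_prod)

lemma poly_ideal_prod_dvd:
  assumes "B \<subseteq> A" "finite A" "prod f B \<in> J" "\<And>i. i \<in> A \<Longrightarrow> f i \<in> carrier (poly_algebra V)"
  shows "prod f A \<in> J"
  using poly_ideal_mult[OF assms(3), of "prod f (A - B)"] assms(4) poly_carrier_prod[of "A - B" f V]
  by (simp add: prod.subset_diff[OF assms(1,2)])

end

lemma poly_genideal:
  assumes "R \<subseteq> carrier (poly_algebra V)"
  shows "ideal (Idl\<^bsub>poly_algebra V\<^esub> R) (poly_algebra V)" "R \<subseteq> Idl\<^bsub>poly_algebra V\<^esub> R"
proof -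
  interpret cring "poly_algebra V" by (rule cring_poly_algebra)
  show "ideal (Idl\<^bsub>poly_algebra V\<^esub> R) (poly_algebra V)" by (rule genideal_ideal[OF assms])
  show "R \<subseteq> Idl\<^bsub>poly_algebra V\<^esub> R" by (rule genideal_self[OF assms])
qed

lemma poly_genideal_minimal:
  "ideal I (poly_algebra V) \<Longrightarrow> R \<subseteq> I \<Longrightarrow> Idl\<^bsub>poly_algebra V\<^esub> R \<subseteq> I"
  by (rule ring.genideal_minimal[OF cring.axioms(1)[OF cring_poly_algebra]])

subsection \<open>Grading\<close>

definition mdeg :: "('v \<Rightarrow>\<^sub>0 nat) \<Rightarrow> nat" where
  "mdeg m = (\<Sum>v\<in>kys m. lkp m v)"

lemma mdeg_add: "mdeg (m + n) = mdeg m + mdeg n"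
  unfolding mdeg_def by (rule setsum_keys_plus_distrib) simp_all

lemma grade_poly_algebra:
  "f \<in> grade (poly_algebra V) d \<longleftrightarrow> (\<forall>m\<in>kys f. kys m \<subseteq> V \<and> 2 * mdeg m = d)"
  by (simp add: poly_algebra_def mdeg_def)

lemma grade_poly_carrier: "f \<in> grade (poly_algebra V) d \<Longrightarrow> f \<in> carrier (poly_algebra V)"
  by (simp add: grade_poly_algebra carrier_poly_algebra)

lemma grade_poly_0 [simp]: "0 \<in> grade (poly_algebra V) d"
  by (simp add: grade_poly_algebra)

lemma grade_poly_add: "f \<in> grade (poly_algebra V) d \<Longrightarrow> g \<in> grade (poly_algebra V) d \<Longrightarrow>
    f + g \<in> grade (poly_algebra V) d"
  unfolding grade_poly_algebra using keys_add[of f g] by blast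

lemma grade_poly_uminus: "f \<in> grade (poly_algebra V) d \<Longrightarrow> - f \<in> grade (poly_algebra V) d"
  by (simp add: grade_poly_algebra in_keys_iff)

lemma grade_poly_diff: "f \<in> grade (poly_algebra V) d \<Longrightarrow> g \<in> grade (poly_algebra V) d \<Longrightarrow>
    f - g \<in> grade (poly_algebra V) d"
  using grade_poly_add[of f V d "- g"] grade_poly_uminus[of g V d] by simp

lemma grade_poly_sum: "(\<And>a. a \<in> A \<Longrightarrow> f a \<in> grade (poly_algebra V) d) \<Longrightarrow> sum f A \<in> grade (poly_algebra V) d"
  by (induction A rule: infinite_finite_induct) (simp_all add: grade_poly_add)

lemma grade_poly_single: "kys m \<subseteq> V \<Longrightarrow> sgl m c \<in> grade (poly_algebra V) (2 * mdeg m)"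
  by (simp add: grade_poly_algebra)

lemma grade_poly_mult: 
  assumes "f \<in> grade (poly_algebra V) d" "g \<in> grade (poly_algebra V) e"
  shows "f * g \<in> grade (poly_algebra V) (d + e)"
  unfolding grade_poly_algebra
proof
  fix k assume "k \<in> kys (f * g)"
  then obtain a b where "a \<in> kys f" "b \<in> kys g" "k = a + b" using keys_mult[of f g] by blast
  then show "kys k \<subseteq> V \<and> 2 * mdeg k = d + e"
    using assms by (auto simp: grade_poly_algebra mdeg_add keys_add_nat)
qed

lemma grade_poly_prod: "finite A \<Longrightarrow> (\<And>a. a \<in> A \<Longrightarrow> f a \<in> grade (poly_algebra V) (d a)) \<Longrightarrow>
    prod f A \<in> grade (poly_algebra V) (sum d A)"
proof (induction A rule: finite_induct)
  case empty
  then show ?case using grade_poly_single[of 0 V 1] by (simp add: mdeg_def)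
qed (simp add: grade_poly_mult)

lemma grade_poly_power: "f \<in> grade (poly_algebra V) d \<Longrightarrow> f ^ n \<in> grade (poly_algebra V) (n * d)"
  using grade_poly_prod[of "{..<n}" "\<lambda>_. f" V "\<lambda>_. d"] by simp

lemma grade_poly_const: "f \<in> grade (poly_algebra V) d \<Longrightarrow> sgl 0 c * f \<in> grade (poly_algebra V) d"
  using grade_poly_mult[OF grade_poly_single[of 0 V c], of f d] by (simp add: mdeg_def)

lemma grade_poly_pvar: "v \<in> V \<Longrightarrow> pvar v \<in> grade (poly_algebra V) 2"
  by (simp add: grade_poly_algebra pvar_def mdeg_def)

subsection \<open>Substitution\<close>

definition meval :: "('v \<Rightarrow> 'r::comm_ring_1) \<Rightarrow> ('v \<Rightarrow>\<^sub>0 nat) \<Rightarrow> 'r" where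
  "meval s m = (\<Prod>v\<in>kys m. s v ^ lkp m v)"

definition psubst ::
    "('v \<Rightarrow> ('w \<Rightarrow>\<^sub>0 nat) \<Rightarrow>\<^sub>0 rat) \<Rightarrow> (('v \<Rightarrow>\<^sub>0 nat) \<Rightarrow>\<^sub>0 rat) \<Rightarrow> ('w \<Rightarrow>\<^sub>0 nat) \<Rightarrow>\<^sub>0 rat" where
  "psubst s = lin_ext (\<lambda>m c. sgl 0 c * meval s m)"

lemma meval_superset: "finite M \<Longrightarrow> kys m \<subseteq> M \<Longrightarrow> meval s m = (\<Prod>v\<in>M. s v ^ lkp m v)"
  unfolding meval_def by (rule prod.mono_neutral_left) (auto simp: in_keys_iff)

lemma meval_0 [simp]: "meval s 0 = 1"
  by (simp add: meval_def)

lemma meval_add: "meval s (m + n) = meval s m * meval s n"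
  using meval_superset[of "kys m \<union> kys n" "m + n" s] meval_superset[of "kys m \<union> kys n" m s]
    meval_superset[of "kys m \<union> kys n" n s]
  by (simp add: keys_add_nat lookup_add power_add prod.distrib)

lemma psubst_0 [simp]: "psubst s 0 = 0"
  by (simp add: psubst_def)

lemma psubst_single: "psubst s (sgl m c) = sgl 0 c * meval s m"
  by (simp add: psubst_def lin_ext_single)

lemma psubst_add: "psubst s (f + g) = psubst s f + psubst s g"
  unfolding psubst_def by (rule lin_ext_add) (simp_all add: single_add distrib_right)

lemma psubst_sum: "psubst s (sum f A) = (\<Sum>a\<in>A. psubst s (f a))"
  by (induction A rule: infinite_finite_induct) (simp_all add: psubst_add)

lemma psubst_const [simp]: "psubst s (sgl 0 c) = sgl 0 c"
  by (simp add: psubst_single)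

lemma psubst_1 [simp]: "psubst s 1 = 1"
  using psubst_const[of s 1] by simp

lemma psubst_pvar [simp]: "psubst s (pvar v) = s v"
  by (simp add: pvar_def psubst_single meval_def)

lemma psubst_mult: "psubst s (f * g) = psubst s f * psubst s g"
proof -
  have "psubst s (sgl m c * g) = psubst s (sgl m c) * psubst s g" for m c
  proof (induction g rule: poly_mapping_additive_induct[OF subset_UNIV])
    case (2 m' c')
    have "psubst s (sgl m c * sgl m' c') = sgl 0 (c * c') * (meval s m * meval s m')"
      by (simp add: mult_single psubst_single meval_add)
    also have "\<dots> = (sgl 0 c * sgl 0 c') * (meval s m * meval s m')" by (simp add: mult_single)
    also have "\<dots> = psubst s (sgl m c) * psubst s (sgl m' c')" by (simp add: psubst_single mult_ac)
    finally show ?case .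
  qed (simp_all add: psubst_add distrib_left)
  then show ?thesis
    by (induction f rule: poly_mapping_additive_induct[OF subset_UNIV]) (simp_all add: psubst_add distrib_right)
qed

lemma psubst_uminus: "psubst s (- f) = - psubst s f"
  using psubst_add[of s f "- f"] by (simp add: eq_neg_iff_add_eq_0 add.commute)

lemma psubst_diff: "psubst s (f - g) = psubst s f - psubst s g"
  using psubst_add[of s f "- g"] by (simp add: psubst_uminus)

lemma psubst_prod: "psubst s (prod f A) = (\<Prod>a\<in>A. psubst s (f a))"
  by (induction A rule: infinite_finite_induct) (simp_all add: psubst_mult)

lemma psubst_grade:
  assumes s: "\<And>v. v \<in> V \<Longrightarrow> s v \<in> grade (poly_algebra W) 2" and f: "f \<in> grade (poly_algebra V) d"
  shows "psubst s f \<in> grade (poly_algebra W) d"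
  unfolding psubst_def lin_ext_def meval_def
proof (rule grade_poly_sum)
  fix m assume m: "m \<in> kys f"
  have "(\<Prod>v\<in>kys m. s v ^ lkp m v) \<in> grade (poly_algebra W) (\<Sum>v\<in>kys m. lkp m v * 2)"
  proof (rule grade_poly_prod)
    fix v assume "v \<in> kys m"
    then have "v \<in> V" using m f by (auto simp: grade_poly_algebra)
    then show "s v ^ lkp m v \<in> grade (poly_algebra W) (lkp m v * 2)" by (intro grade_poly_power s)
  qed simp
  also have "(\<Sum>v\<in>kys m. lkp m v * 2) = d"
    using m f unfolding sum_distrib_right[symmetric] by (auto simp: grade_poly_algebra mdeg_def)
  finally show "sgl 0 (lkp f m) * (\<Prod>v\<in>kys m. s v ^ lkp m v) \<in> grade (poly_algebra W) d"
    by (rule grade_poly_const)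
qed

lemma psubst_carrier:
  assumes s: "\<And>v. v \<in> V \<Longrightarrow> s v \<in> carrier (poly_algebra W)" and f: "f \<in> carrier (poly_algebra V)"
  shows "psubst s f \<in> carrier (poly_algebra W)"
  unfolding psubst_def lin_ext_def meval_def
  by (intro poly_carrier_sum poly_carrier_mult poly_carrier_const poly_carrier_prod poly_carrier_power s)
    (use f in \<open>auto simp: carrier_poly_algebra\<close>)

text \<open>The polynomials that the substitution sends into \<open>J\<close> form an ideal, so
  testing generators is enough.\<close>

lemma psubst_genideal:
  assumes s: "\<And>v. v \<in> V \<Longrightarrow> s v \<in> carrier (poly_algebra W)" and J: "ideal J (poly_algebra W)"
    and R: "R \<subseteq> carrier (poly_algebra V)" "\<And>r. r \<in> R \<Longrightarrow> psubst s r \<in> J"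
    and f: "f \<in> Idl\<^bsub>poly_algebra V\<^esub> R"
  shows "psubst s f \<in> J"
proof -
  have "ideal {f \<in> carrier (poly_algebra V). psubst s f \<in> J} (poly_algebra V)"
    by (rule poly_idealI)
      (auto simp: poly_ideal_0[OF J] psubst_add psubst_mult poly_carrier_add poly_carrier_mult
        intro: poly_ideal_add[OF J] poly_ideal_mult[OF J] psubst_carrier[OF s])
  then have "Idl\<^bsub>poly_algebra V\<^esub> R \<subseteq> {f \<in> carrier (poly_algebra V). psubst s f \<in> J}"
    by (rule poly_genideal_minimal) (use R in blast)
  then show ?thesis using f by blast
qed

text \<open>Polynomials congruent to their image under an endomorphism form a subalgebra.\<close>

lemma psubst_psubst_cong:
  assumes s: "\<And>v. v \<in> V \<Longrightarrow> s v \<in> carrier (poly_algebra W)"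
    and t: "\<And>w. w \<in> W \<Longrightarrow> t w \<in> carrier (poly_algebra V)"
    and I: "ideal I (poly_algebra V)"
    and ts: "\<And>v. v \<in> V \<Longrightarrow> psubst t (s v) - pvar v \<in> I"
    and f: "f \<in> carrier (poly_algebra V)"
  shows "psubst t (psubst s f) - f \<in> I"
proof -
  have tc: "psubst t g \<in> carrier (poly_algebra V)" if "g \<in> carrier (poly_algebra W)" for g
    by (rule psubst_carrier[OF t that])
  have mono: "psubst t (meval s m) - sgl m 1 \<in> I" if m: "kys m \<subseteq> V" for m
  proof -
    have pw: "psubst t (s v ^ n) - pvar v ^ n \<in> I" if "v \<in> V" for v n
      using poly_ideal_prod_cong[OF I, of "{..<n}" "\<lambda>_. psubst t (s v)" "\<lambda>_. pvar v"]
        ts[OF that] tc[OF s[OF that]] poly_carrier_pvar[OF that] psubst_prod[of t "\<lambda>_. s v" "{..<n}"] by simp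
    have "psubst t (meval s m) - (\<Prod>v\<in>kys m. pvar v ^ lkp m v) \<in> I"
      unfolding meval_def psubst_prod
      by (rule poly_ideal_prod_cong[OF I])
        (use m pw in \<open>auto intro!: poly_carrier_power poly_carrier_pvar tc s\<close>)
    moreover have "(\<Prod>v\<in>kys m. pvar v ^ lkp m v) = sgl m 1"
    proof -
      have p: "pvar v ^ n = sgl (sgl v n) 1" for v :: 'a and n
        by (induction n) (simp_all add: pvar_def mult_single single_add[symmetric] flip: single_one)
      have "(\<Prod>v\<in>A. sgl (sgl v (lkp m v)) (1::rat)) = sgl (\<Sum>v\<in>A. sgl v (lkp m v)) 1" for A
        by (induction A rule: infinite_finite_induct) (simp_all add: mult_single)
      then show ?thesis by (simp add: p sum_single_keys)
    qed
    ultimately show ?thesis by simp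
  qed
  have "kys f \<subseteq> {m. kys m \<subseteq> V}" using f by (auto simp: carrier_poly_algebra)
  then show ?thesis
  proof (induction f rule: poly_mapping_additive_induct)
    case (single m c)
    have "psubst t (psubst s (sgl m c)) - sgl m c = sgl 0 c * (psubst t (meval s m) - sgl m 1)"
      by (simp add: psubst_single psubst_mult right_diff_distrib mult_single)
    then show ?case using mono[of m] single by (simp add: poly_ideal_mult[OF I])
  next
    case (add g h)
    have "psubst t (psubst s (g + h)) - (g + h) = (psubst t (psubst s g) - g) + (psubst t (psubst s h) - h)"
      by (simp add: psubst_add)
    then show ?case using add by (simp only: poly_ideal_add[OF I])
  qed (simp add: poly_ideal_0[OF I])
qed

text \<open>Being mutually inverse is tested on variables and modulo the ideals. The kernel of
  \<open>psubst s\<close> is then found by applying \<open>psubst t\<close>, which returns a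
  polynomial to itself modulo the ideal; surjectivity is the same argument on the other side.
  Variables go to homogeneous elements of degree 2, which settles the grading.\<close>

lemma presentation_iso:
  assumes R: "R \<subseteq> carrier (poly_algebra V)" and Q: "Q \<subseteq> carrier (poly_algebra W)"
    and s: "\<And>v. v \<in> V \<Longrightarrow> s v \<in> grade (poly_algebra W) 2"
    and t: "\<And>w. w \<in> W \<Longrightarrow> t w \<in> grade (poly_algebra V) 2"
    and sR: "\<And>r. r \<in> R \<Longrightarrow> psubst s r \<in> Idl\<^bsub>poly_algebra W\<^esub> Q"
    and tQ: "\<And>q. q \<in> Q \<Longrightarrow> psubst t q \<in> Idl\<^bsub>poly_algebra V\<^esub> R"
    and ts: "\<And>v. v \<in> V \<Longrightarrow> psubst t (s v) - pvar v \<in> Idl\<^bsub>poly_algebra V\<^esub> R"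
    and st: "\<And>w. w \<in> W \<Longrightarrow> psubst s (t w) - pvar w \<in> Idl\<^bsub>poly_algebra W\<^esub> Q"
  shows "quot_algebra (poly_algebra V) (Idl\<^bsub>poly_algebra V\<^esub> R) \<cong>\<^sub>g\<^sub>r
         quot_algebra (poly_algebra W) (Idl\<^bsub>poly_algebra W\<^esub> Q)"
proof -
  let ?I = "Idl\<^bsub>poly_algebra V\<^esub> R" and ?J = "Idl\<^bsub>poly_algebra W\<^esub> Q"
  note I = poly_genideal(1)[OF R] and J = poly_genideal(1)[OF Q]
  have s': "s v \<in> carrier (poly_algebra W)" if "v \<in> V" for v by (rule grade_poly_carrier[OF s[OF that]])
  have t': "t w \<in> carrier (poly_algebra V)" if "w \<in> W" for w by (rule grade_poly_carrier[OF t[OF that]])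
  have sI: "psubst s f \<in> ?J" if "f \<in> ?I" for f by (rule psubst_genideal[OF s' J R sR that])
  have tJ: "psubst t f \<in> ?I" if "f \<in> ?J" for f by (rule psubst_genideal[OF t' I Q tQ that])
  have tsf: "psubst t (psubst s f) - f \<in> ?I" if "f \<in> carrier (poly_algebra V)" for f
    by (rule psubst_psubst_cong[OF s' t' I ts that])
  have stf: "psubst s (psubst t f) - f \<in> ?J" if "f \<in> carrier (poly_algebra W)" for f
    by (rule psubst_psubst_cong[OF t' s' J st that])
  have car: "f \<in> carrier (poly_algebra V) \<Longrightarrow> psubst s f \<in> carrier (poly_algebra W)"
    "g \<in> carrier (poly_algebra W) \<Longrightarrow> psubst t g \<in> carrier (poly_algebra V)" for f g
    by (rule psubst_carrier[OF s'], assumption+) (rule psubst_carrier[OF t'], assumption+)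
  have tg: "psubst t f \<in> grade (poly_algebra V) d" if "f \<in> grade (poly_algebra W) d" for f d
    by (rule psubst_grade[OF t that])
  show ?thesis
  proof (rule graded_iso_quot_algebra[OF good_poly_algebra I good_poly_algebra J, of "psubst s"])
    show "psubst s a \<in> ?J \<longleftrightarrow> a \<in> ?I" if a: "a \<in> carrier (poly_algebra V)" for a
    proof
      assume "psubst s a \<in> ?J"
      from tJ[OF this] tsf[OF a] have "psubst t (psubst s a) - (psubst t (psubst s a) - a) \<in> ?I"
        by (rule poly_ideal_diff[OF I])
      then show "a \<in> ?I" by simp
    qed (rule sI)
    show "\<exists>a\<in>carrier (poly_algebra V). ?J +>\<^bsub>poly_algebra W\<^esub> psubst s a = ?J +>\<^bsub>poly_algebra W\<^esub> f"
      if f: "f \<in> carrier (poly_algebra W)" for f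
      by (rule bexI[OF _ car(2)[OF f]]) (simp add: poly_coset_eq_iff[OF J] car f stf)
    show "\<exists>f\<in>grade (poly_algebra W) d. ?J +>\<^bsub>poly_algebra W\<^esub> psubst s a = ?J +>\<^bsub>poly_algebra W\<^esub> f"
      if "a \<in> grade (poly_algebra V) d" for d a
      by (rule bexI[OF _ psubst_grade[OF s that]]) (rule refl)
    show "\<exists>a\<in>grade (poly_algebra V) d. ?J +>\<^bsub>poly_algebra W\<^esub> psubst s a = ?J +>\<^bsub>poly_algebra W\<^esub> f"
      if f: "f \<in> grade (poly_algebra W) d" for d f
      by (rule bexI[OF _ tg[OF f]])
        (simp add: poly_coset_eq_iff[OF J] car grade_poly_carrier[OF f] stf)
  qed (simp_all add: car psubst_add psubst_mult)
qed

section \<open>Tensor products of presented algebras\<close>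

definition tuple_mult :: "'i set \<Rightarrow> ('i \<Rightarrow> (rat, 'b) graded_algebra) \<Rightarrow> ('i \<Rightarrow> 'b) \<Rightarrow> ('i \<Rightarrow> 'b) \<Rightarrow> 'i \<Rightarrow> 'b" where
  "tuple_mult I A u v = (\<lambda>i\<in>I. u i \<otimes>\<^bsub>A i\<^esub> v i)"

text \<open>This is the double sum in the product of \<open>free_tensor\<close>, arranged as two
  nested linear extensions so that bilinearity follows from \<open>lin_ext_add\<close>.\<close>

definition tensor_mult ::
    "'i set \<Rightarrow> ('i \<Rightarrow> (rat, 'b) graded_algebra) \<Rightarrow> (('i \<Rightarrow> 'b) \<Rightarrow>\<^sub>0 rat) \<Rightarrow> (('i \<Rightarrow> 'b) \<Rightarrow>\<^sub>0 rat) \<Rightarrow> (('i \<Rightarrow> 'b) \<Rightarrow>\<^sub>0 rat)" where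
  "tensor_mult I A f h = lin_ext (\<lambda>u c. lin_ext (\<lambda>v d. sgl (tuple_mult I A u v) (c * d)) h) f"

lemma free_tensor_simps [simp]:
  "mult (free_tensor I A) = tensor_mult I A"
  "one (free_tensor I A) = sgl (\<lambda>i\<in>I. \<one>\<^bsub>A i\<^esub>) 1"
  "zero (free_tensor I A) = 0" "add (free_tensor I A) = (+)"
  by (simp_all add: free_tensor_def tensor_mult_def lin_ext_def tuple_mult_def fun_eq_iff)

lemma smult_free_tensor: "smult (free_tensor I A) c f = Poly_Mapping.map ((*) c) f"
  by (simp add: free_tensor_def)

lemma carrier_free_tensor: "f \<in> carrier (free_tensor I A) \<longleftrightarrow> kys f \<subseteq> (\<Pi>\<^sub>E i\<in>I. carrier (A i))"
  by (simp add: free_tensor_def)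

lemma map_scale_add: "Poly_Mapping.map ((*) c) (f + g) = Poly_Mapping.map ((*) c) f + Poly_Mapping.map ((*) (c::rat)) g"
  by (rule poly_mapping_eqI) (auto simp: lookup_add map.rep_eq when_def distrib_left[symmetric])

lemma map_scale_single: "Poly_Mapping.map ((*) c) (sgl u d) = sgl u (c * d :: rat)"
  by (rule poly_mapping_eqI) (simp add: map.rep_eq lookup_single when_def)

lemma map_scale_zero: "Poly_Mapping.map ((*) c) 0 = (0 :: _ \<Rightarrow>\<^sub>0 rat)"
  by (rule poly_mapping_eqI) (simp add: map.rep_eq)

lemma tensor_mult_add_left: "tensor_mult I A (f + g) h = tensor_mult I A f h + tensor_mult I A g h"
proof -
  have *: "lin_ext (\<lambda>v d. sgl (tuple_mult I A u v) ((a + b) * d)) h =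
      lin_ext (\<lambda>v d. sgl (tuple_mult I A u v) (a * d)) h + lin_ext (\<lambda>v d. sgl (tuple_mult I A u v) (b * d)) h" for u a b
    by (simp add: lin_ext_def distrib_right single_add sum.distrib)
  show ?thesis unfolding tensor_mult_def by (rule lin_ext_add) (simp_all only: *, simp_all add: lin_ext_def)
qed

lemma tensor_mult_add_right: "tensor_mult I A f (g + h) = tensor_mult I A f g + tensor_mult I A f h"
proof -
  have "lin_ext (\<lambda>v d. sgl (tuple_mult I A u v) (c * d)) (g + h) =
      lin_ext (\<lambda>v d. sgl (tuple_mult I A u v) (c * d)) g + lin_ext (\<lambda>v d. sgl (tuple_mult I A u v) (c * d)) h" for u c
    by (rule lin_ext_add) (simp_all add: distrib_left single_add)
  then show ?thesis by (simp add: tensor_mult_def) (simp add: lin_ext_def sum.distrib)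
qed

lemma tensor_mult_0 [simp]: "tensor_mult I A 0 h = 0" "tensor_mult I A h 0 = 0"
  by (simp_all add: tensor_mult_def) (simp add: lin_ext_def)

lemma tensor_mult_single: "tensor_mult I A (sgl u c) (sgl v d) = sgl (tuple_mult I A u v) (c * d)"
  by (simp add: tensor_mult_def lin_ext_def)

lemma tensor_mult_diff_left: "tensor_mult I A (f - g) h = tensor_mult I A f h - tensor_mult I A g h"
  using tensor_mult_add_left[of I A "f - g" g h] by simp

lemma tensor_mult_diff_right: "tensor_mult I A h (f - g) = tensor_mult I A h f - tensor_mult I A h g"
  using tensor_mult_add_right[of I A h "f - g" g] by simp

lemma free_tensor_add_closed: "f \<in> carrier (free_tensor I A) \<Longrightarrow> g \<in> carrier (free_tensor I A) \<Longrightarrow>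
    f + g \<in> carrier (free_tensor I A)"
  unfolding carrier_free_tensor using keys_add[of f g] by blast

lemma free_tensor_uminus_closed: "f \<in> carrier (free_tensor I A) \<Longrightarrow> - f \<in> carrier (free_tensor I A)"
  by (auto simp: carrier_free_tensor in_keys_iff)

lemma free_tensor_diff_closed: "f \<in> carrier (free_tensor I A) \<Longrightarrow> g \<in> carrier (free_tensor I A) \<Longrightarrow>
    f - g \<in> carrier (free_tensor I A)"
  using free_tensor_add_closed[of f I A "- g"] free_tensor_uminus_closed[of g I A] by simp

lemma free_tensor_single: "u \<in> (\<Pi>\<^sub>E i\<in>I. carrier (A i)) \<Longrightarrow> sgl u c \<in> carrier (free_tensor I A)"
  by (simp add: carrier_free_tensor)

lemma free_tensor_zero: "0 \<in> carrier (free_tensor I A)"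
  by (simp add: carrier_free_tensor)

lemma free_tensor_induct [consumes 1, case_names zero single add]:
  assumes "f \<in> carrier (free_tensor I A)" and "P 0"
    and "\<And>u c. u \<in> (\<Pi>\<^sub>E i\<in>I. carrier (A i)) \<Longrightarrow> P (sgl u c)"
    and "\<And>g h. g \<in> carrier (free_tensor I A) \<Longrightarrow> h \<in> carrier (free_tensor I A) \<Longrightarrow> P g \<Longrightarrow> P h \<Longrightarrow> P (g + h)"
  shows "P f"
  using assms unfolding carrier_free_tensor by (rule poly_mapping_additive_induct)

context
  fixes I :: "'i set" and A :: "'i \<Rightarrow> (rat, 'b) graded_algebra"
  assumes A: "\<And>i. i \<in> I \<Longrightarrow> good_algebra (A i)"
begin

lemma tuple_mult_closed:
  assumes "u \<in> (\<Pi>\<^sub>E i\<in>I. carrier (A i))" "v \<in> (\<Pi>\<^sub>E i\<in>I. carrier (A i))"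
  shows "tuple_mult I A u v \<in> (\<Pi>\<^sub>E i\<in>I. carrier (A i))"
proof -
  have "u i \<otimes>\<^bsub>A i\<^esub> v i \<in> carrier (A i)" if "i \<in> I" for i
  proof -
    interpret cring "A i" using good_algebra_cring[OF A[OF that]] .
    show ?thesis using assms that by (intro m_closed) auto
  qed
  then show ?thesis by (simp add: tuple_mult_def)
qed

lemma tuple_mult_laws:
  assumes "u \<in> (\<Pi>\<^sub>E i\<in>I. carrier (A i))" "v \<in> (\<Pi>\<^sub>E i\<in>I. carrier (A i))" "w \<in> (\<Pi>\<^sub>E i\<in>I. carrier (A i))"
  shows "tuple_mult I A (tuple_mult I A u v) w = tuple_mult I A u (tuple_mult I A v w)"
    and "tuple_mult I A u v = tuple_mult I A v u"
    and "tuple_mult I A (\<lambda>i\<in>I. \<one>\<^bsub>A i\<^esub>) u = u"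
proof -
  have *: "u i \<otimes>\<^bsub>A i\<^esub> v i \<otimes>\<^bsub>A i\<^esub> w i = u i \<otimes>\<^bsub>A i\<^esub> (v i \<otimes>\<^bsub>A i\<^esub> w i) \<and>
      u i \<otimes>\<^bsub>A i\<^esub> v i = v i \<otimes>\<^bsub>A i\<^esub> u i \<and> \<one>\<^bsub>A i\<^esub> \<otimes>\<^bsub>A i\<^esub> u i = u i" if "i \<in> I" for i
  proof -
    interpret cring "A i" using good_algebra_cring[OF A[OF that]] .
    have "u i \<in> carrier (A i)" "v i \<in> carrier (A i)" "w i \<in> carrier (A i)" using assms that by auto
    then show ?thesis by (intro conjI m_assoc m_comm l_one)
  qed
  show "tuple_mult I A (tuple_mult I A u v) w = tuple_mult I A u (tuple_mult I A v w)"
    unfolding tuple_mult_def by (rule restrict_ext) (simp add: *[THEN conjunct1])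
  show "tuple_mult I A u v = tuple_mult I A v u"
    unfolding tuple_mult_def by (rule restrict_ext) (simp add: *)
  have "tuple_mult I A (\<lambda>i\<in>I. \<one>\<^bsub>A i\<^esub>) u = restrict u I"
    unfolding tuple_mult_def by (rule restrict_ext) (simp add: *)
  then show "tuple_mult I A (\<lambda>i\<in>I. \<one>\<^bsub>A i\<^esub>) u = u" using assms(1) PiE_restrict by metis
qed

lemma tuple_one: "(\<lambda>i\<in>I. \<one>\<^bsub>A i\<^esub>) \<in> (\<Pi>\<^sub>E i\<in>I. carrier (A i))"
  using cring.cring_simprules(6)[OF good_algebra_cring[OF A]] by simp

lemma free_tensor_scalar: "sgl (\<lambda>i\<in>I. \<one>\<^bsub>A i\<^esub>) c \<in> carrier (free_tensor I A)"
  by (rule free_tensor_single[OF tuple_one])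

lemma tensor_mult_closed:
  assumes f: "f \<in> carrier (free_tensor I A)" and h: "h \<in> carrier (free_tensor I A)"
  shows "tensor_mult I A f h \<in> carrier (free_tensor I A)"
  using f
proof (induction f rule: free_tensor_induct)
  case (single u c)
  show ?case using h
    by (induction h rule: free_tensor_induct)
      (simp_all add: tensor_mult_add_right free_tensor_zero tensor_mult_single free_tensor_single
        tuple_mult_closed single free_tensor_add_closed)
qed (simp_all add: tensor_mult_add_left free_tensor_zero free_tensor_add_closed)

lemma tensor_mult_comm:
  assumes f: "f \<in> carrier (free_tensor I A)" and h: "h \<in> carrier (free_tensor I A)"
  shows "tensor_mult I A f h = tensor_mult I A h f"
  using f
proof (induction f rule: free_tensor_induct)
  case (single u c)
  show ?case using h
  proof (induction h rule: free_tensor_induct)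
    case (single v d)
    show ?case using tuple_mult_laws(2)[OF \<open>u \<in> _\<close> single single]
      by (simp add: tensor_mult_single mult.commute)
  qed (simp_all add: tensor_mult_add_right tensor_mult_add_left)
qed (simp_all add: tensor_mult_add_left tensor_mult_add_right)

lemma tensor_mult_assoc:
  assumes f: "f \<in> carrier (free_tensor I A)" and g: "g \<in> carrier (free_tensor I A)"
    and h: "h \<in> carrier (free_tensor I A)"
  shows "tensor_mult I A (tensor_mult I A f g) h = tensor_mult I A f (tensor_mult I A g h)"
  using f
proof (induction f rule: free_tensor_induct)
  case u: (single u c)
  show ?case using g
  proof (induction g rule: free_tensor_induct)
    case v: (single v d)
    show ?case using h
    proof (induction h rule: free_tensor_induct)
      case (single w e)
      show ?case using tuple_mult_laws(1)[OF u v single] by (simp add: tensor_mult_single mult.assoc)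
    qed (simp_all add: tensor_mult_add_right)
  qed (simp_all add: tensor_mult_add_right tensor_mult_add_left)
qed (simp_all add: tensor_mult_add_left)

lemma tensor_mult_one:
  assumes "f \<in> carrier (free_tensor I A)"
  shows "tensor_mult I A (sgl (\<lambda>i\<in>I. \<one>\<^bsub>A i\<^esub>) c) f = Poly_Mapping.map ((*) c) f"
  using assms
proof (induction f rule: free_tensor_induct)
  case (single u c)
  show ?case unfolding tensor_mult_single map_scale_single tuple_mult_laws(3)[OF single single single] ..
qed (simp_all add: tensor_mult_add_right map_scale_add map_scale_zero)

text \<open>The free tensor is the monoid algebra of the product of the multiplicative monoids of
  the factors, so its ring laws reduce to those of single tuples.\<close>

lemma cring_free_tensor: "cring (free_tensor I A)"
proof (intro cringI abelian_groupI comm_monoidI)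
  show "\<exists>y\<in>carrier (free_tensor I A). y \<oplus>\<^bsub>free_tensor I A\<^esub> x = \<zero>\<^bsub>free_tensor I A\<^esub>"
    if "x \<in> carrier (free_tensor I A)" for x
    using that by (intro bexI[of _ "- x"]) (simp_all add: free_tensor_uminus_closed)
  show "\<one>\<^bsub>free_tensor I A\<^esub> \<otimes>\<^bsub>free_tensor I A\<^esub> x = x" if "x \<in> carrier (free_tensor I A)" for x
  proof -
    have "Poly_Mapping.map ((*) 1) x = x" by (rule poly_mapping_eqI) (simp add: map.rep_eq when_def)
    then show ?thesis by (simp add: tensor_mult_one[OF that])
  qed
  show "x \<otimes>\<^bsub>free_tensor I A\<^esub> y = y \<otimes>\<^bsub>free_tensor I A\<^esub> x"
    if "x \<in> carrier (free_tensor I A)" "y \<in> carrier (free_tensor I A)" for x y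
    using tensor_mult_comm[OF that] by simp
qed (simp_all add: free_tensor_add_closed tensor_mult_closed tensor_mult_assoc free_tensor_zero
      free_tensor_scalar add.assoc tensor_mult_add_left add.commute)

lemma good_free_tensor: "good_algebra (free_tensor I A)"
  unfolding good_algebra_def
proof (intro conjI allI cring_free_tensor)
  show "\<exists>k\<in>carrier (free_tensor I A). \<forall>a\<in>carrier (free_tensor I A).
      c \<odot>\<^bsub>free_tensor I A\<^esub> a = k \<otimes>\<^bsub>free_tensor I A\<^esub> a" for c
    by (rule bexI[of _ "sgl (\<lambda>i\<in>I. \<one>\<^bsub>A i\<^esub>) c"])
      (simp_all add: tensor_mult_one smult_free_tensor free_tensor_scalar)
  show "grade (free_tensor I A) d \<subseteq> carrier (free_tensor I A)" for d
    by (auto simp: free_tensor_def)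
qed

lemma free_tensor_ominus:
  assumes "a \<in> carrier (free_tensor I A)"
  shows "\<ominus>\<^bsub>free_tensor I A\<^esub> a = - a"
proof -
  interpret cring "free_tensor I A" by (rule cring_free_tensor)
  show ?thesis by (rule minus_equality) (use assms free_tensor_uminus_closed in auto)
qed

text \<open>The updated index lies in \<open>I\<close>, so an updated tuple is still extensional and
  its entries stay in the carriers.\<close>

lemma multilinear_rels_carrier: "multilinear_rels I A \<subseteq> carrier (free_tensor I A)"
proof
  fix f assume "f \<in> multilinear_rels I A"
  then consider (add) u i a b where
      "f = sgl (u(i := a \<oplus>\<^bsub>A i\<^esub> b)) 1 - sgl (u(i := a)) 1 - sgl (u(i := b)) 1"
      "u \<in> (\<Pi>\<^sub>E i\<in>I. carrier (A i))" "i \<in> I" "a \<in> carrier (A i)" "b \<in> carrier (A i)"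
    | (smult) u i c a where "f = sgl (u(i := c \<odot>\<^bsub>A i\<^esub> a)) 1 - sgl (u(i := a)) c"
      "u \<in> (\<Pi>\<^sub>E i\<in>I. carrier (A i))" "i \<in> I" "a \<in> carrier (A i)"
    unfolding multilinear_rels_def by blast
  then show "f \<in> carrier (free_tensor I A)"
  proof cases
    case add
    interpret cring "A i" using good_algebra_cring[OF A[OF add(3)]] .
    show ?thesis unfolding add(1)
      by (intro free_tensor_diff_closed free_tensor_single)
        (use add a_closed[OF add(4,5)] in \<open>auto simp: PiE_iff extensional_def\<close>)
  next
    case smult
    show ?thesis unfolding smult(1)
      by (intro free_tensor_diff_closed free_tensor_single)
        (use smult good_algebra_smult_closed[OF A[OF smult(3)] smult(4)] in \<open>auto simp: PiE_iff extensional_def\<close>)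
  qed
qed

lemma free_tensor_idealI:
  assumes "K \<subseteq> carrier (free_tensor I A)" "0 \<in> K" "\<And>a b. a \<in> K \<Longrightarrow> b \<in> K \<Longrightarrow> a + b \<in> K"
    "\<And>a r. a \<in> K \<Longrightarrow> r \<in> carrier (free_tensor I A) \<Longrightarrow> tensor_mult I A r a \<in> K"
    "\<And>a. a \<in> K \<Longrightarrow> - a \<in> K"
  shows "ideal K (free_tensor I A)"
proof -
  interpret cring "free_tensor I A" by (rule cring_free_tensor)
  show ?thesis
  proof (rule idealI[OF ring_axioms])
    show "subgroup K (add_monoid (free_tensor I A))"
      by (rule add.subgroupI) (use assms free_tensor_ominus in \<open>auto simp: subset_iff\<close>)
  qed (use assms tensor_mult_comm in \<open>auto simp: subset_iff\<close>)
qed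

abbreviation (input) "tensor_ideal \<equiv> Idl\<^bsub>free_tensor I A\<^esub> (multilinear_rels I A)"

lemma tensor_ideal: "ideal tensor_ideal (free_tensor I A)"
  using ring.genideal_ideal[OF cring.axioms(1)[OF cring_free_tensor] multilinear_rels_carrier] .

lemma tensor_ideal_rels: "f \<in> multilinear_rels I A \<Longrightarrow> f \<in> tensor_ideal"
  using ring.genideal_self[OF cring.axioms(1)[OF cring_free_tensor] multilinear_rels_carrier] by blast

lemma tensor_ideal_add: "f \<in> tensor_ideal \<Longrightarrow> g \<in> tensor_ideal \<Longrightarrow> f + g \<in> tensor_ideal"
  using additive_subgroup.a_closed[OF ideal.axioms(1)[OF tensor_ideal]] by simp

lemma tensor_ideal_0: "0 \<in> tensor_ideal"
  using additive_subgroup.zero_closed[OF ideal.axioms(1)[OF tensor_ideal]] by simp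

lemma tensor_ideal_carrier: "f \<in> tensor_ideal \<Longrightarrow> f \<in> carrier (free_tensor I A)"
  using additive_subgroup.a_subset[OF ideal.axioms(1)[OF tensor_ideal]] by blast

lemma tensor_ideal_uminus: "f \<in> tensor_ideal \<Longrightarrow> - f \<in> tensor_ideal"
  using additive_subgroup.a_inv_closed[OF ideal.axioms(1)[OF tensor_ideal]]
    abelian_group.a_inv_closed free_tensor_ominus tensor_ideal_carrier by metis

lemma tensor_ideal_diff: "f \<in> tensor_ideal \<Longrightarrow> g \<in> tensor_ideal \<Longrightarrow> f - g \<in> tensor_ideal"
  using tensor_ideal_add[of f "- g"] tensor_ideal_uminus[of g] by simp

lemma tensor_ideal_mult: "f \<in> tensor_ideal \<Longrightarrow> r \<in> carrier (free_tensor I A) \<Longrightarrow> tensor_mult I A r f \<in> tensor_ideal"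
  using ideal.I_l_closed[OF tensor_ideal] by simp

lemma tensor_ideal_mult_cong:
  assumes "a - b \<in> tensor_ideal" "c - d \<in> tensor_ideal"
    "b \<in> carrier (free_tensor I A)" "c \<in> carrier (free_tensor I A)"
  shows "tensor_mult I A a c - tensor_mult I A b d \<in> tensor_ideal"
proof -
  have "tensor_mult I A a c - tensor_mult I A b d = tensor_mult I A (a - b) c + tensor_mult I A b (c - d)"
    by (simp add: tensor_mult_diff_left tensor_mult_diff_right)
  also have "tensor_mult I A (a - b) c = tensor_mult I A c (a - b)"
    by (rule tensor_mult_comm[OF tensor_ideal_carrier[OF assms(1)] assms(4)])
  finally show ?thesis using assms by (simp add: tensor_ideal_add tensor_ideal_mult)
qed

end

section \<open>Restriction of a monomial to a block of variables\<close>

definition mres :: "'v set \<Rightarrow> ('v \<Rightarrow>\<^sub>0 nat) \<Rightarrow> 'v \<Rightarrow>\<^sub>0 nat" where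
  "mres S m = (\<Sum>v\<in>kys m \<inter> S. sgl v (lkp m v))"

lemma lookup_mres: "lkp (mres S m) v = (if v \<in> S then lkp m v else 0)"
proof -
  have "lkp (mres S m) v = (\<Sum>w\<in>kys m \<inter> S. if w = v then lkp m v else 0)"
    by (auto simp: mres_def lookup_sum lookup_single when_def intro!: sum.cong)
  also have "\<dots> = (if v \<in> S then lkp m v else 0)" by (simp add: in_keys_iff)
  finally show ?thesis .
qed

lemma keys_mres: "kys (mres S m) = kys m \<inter> S"
  by (auto simp: in_keys_iff lookup_mres split: if_splits)

lemma mres_add: "mres S (m + n) = mres S m + mres S n"
  by (rule poly_mapping_eqI) (simp add: lookup_mres lookup_add)

lemma mres_zero [simp]: "mres S 0 = 0"
  by (simp add: mres_def)

lemma mres_id: "kys m \<subseteq> S \<Longrightarrow> mres S m = m"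
  by (rule poly_mapping_eqI) (auto simp: lookup_mres in_keys_iff)

lemma mres_disjoint: "kys m \<inter> S = {} \<Longrightarrow> mres S m = 0"
  by (simp add: mres_def)

text \<open>Each variable of \<open>m\<close> lies in exactly one block, so exactly one of the
  restrictions keeps its exponent.\<close>

lemma sum_mres:
  assumes "finite I" "disjoint_family_on V I" "kys m \<subseteq> (\<Union>i\<in>I. V i)"
  shows "(\<Sum>i\<in>I. mres (V i) m) = m"
proof (rule poly_mapping_eqI)
  fix v
  show "lkp (\<Sum>i\<in>I. mres (V i) m) v = lkp m v"
  proof (cases "v \<in> kys m")
    case True
    then obtain j where j: "j \<in> I" "v \<in> V j" using assms(3) by blast
    have "v \<in> V i \<longleftrightarrow> i = j" if "i \<in> I" for i
      using assms(2) that j unfolding disjoint_family_on_def by blast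
    then have "(\<Sum>i\<in>I. lkp (mres (V i) m) v) = (\<Sum>i\<in>I. if i = j then lkp m v else 0)"
      by (intro sum.cong) (simp_all add: lookup_mres)
    also have "\<dots> = lkp m v" using j assms(1) by simp
    finally show ?thesis by (simp add: lookup_sum)
  qed (auto simp: lookup_sum lookup_mres in_keys_iff intro!: sum.neutral)
qed

lemma mdeg_sum: "mdeg (sum f A) = (\<Sum>a\<in>A. mdeg (f a))"
  by (induction A rule: infinite_finite_induct) (simp_all add: mdeg_add, simp_all add: mdeg_def)

section \<open>A tensor product of presented algebras as a quotient of one polynomial
  algebra\<close>

locale presented_family =
  fixes I :: "'i set" and V :: "'i \<Rightarrow> 'v set" and R :: "'i \<Rightarrow> (('v \<Rightarrow>\<^sub>0 nat) \<Rightarrow>\<^sub>0 rat) set"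
  assumes fin: "finite I" and disj: "disjoint_family_on V I"
    and R: "\<And>i. i \<in> I \<Longrightarrow> R i \<subseteq> carrier (poly_algebra (V i))"
begin

definition W where "W = (\<Union>i\<in>I. V i)"
definition J where "J = Idl\<^bsub>poly_algebra W\<^esub> (\<Union>i\<in>I. R i)"
definition N where "N i = Idl\<^bsub>poly_algebra (V i)\<^esub> (R i)"
definition A where "A i = quot_algebra (poly_algebra (V i)) (N i)"
definition cls where "cls i f = N i +>\<^bsub>poly_algebra (V i)\<^esub> f"
definition tup where "tup m = (\<lambda>i\<in>I. cls i (sgl (mres (V i) m) 1))"
text \<open>A monomial becomes the tuple of the classes of its blocks. This map is exactly
  multiplicative, because restriction to a block is additive in the exponents.\<close>

definition split_poly :: "(('v \<Rightarrow>\<^sub>0 nat) \<Rightarrow>\<^sub>0 rat) \<Rightarrow> _" where "split_poly f = lin_ext (\<lambda>m c. sgl (tup m) c) f"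
definition rep where "rep i X = (SOME f. f \<in> carrier (poly_algebra (V i)) \<and> X = cls i f)"
text \<open>The inverse of \<open>split_poly\<close> modulo the ideals. The entries of a tuple are
  cosets, so representatives have to be chosen, and the map is multiplicative only modulo
  \<open>J\<close>.\<close>

definition mult_poly where "mult_poly f = lin_ext (\<lambda>u c. sgl 0 c * (\<Prod>i\<in>I. rep i (u i))) f"
definition tupP where "tupP g = (\<lambda>i\<in>I. cls i (g i))"

abbreviation "F \<equiv> free_tensor I A"
abbreviation "K \<equiv> Idl\<^bsub>F\<^esub> (multilinear_rels I A)"

lemma V_W: "i \<in> I \<Longrightarrow> V i \<subseteq> W"
  by (auto simp: W_def)

lemma R_W: "(\<Union>i\<in>I. R i) \<subseteq> carrier (poly_algebra W)"
  using R poly_carrier_mono[OF V_W] by blast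

lemma J: "ideal J (poly_algebra W)"
  unfolding J_def by (rule poly_genideal(1)[OF R_W])

lemma N: "i \<in> I \<Longrightarrow> ideal (N i) (poly_algebra (V i))"
  unfolding N_def by (rule poly_genideal(1)[OF R])

lemma good_A: "i \<in> I \<Longrightarrow> good_algebra (A i)"
  unfolding A_def by (rule good_quot_algebra[OF good_poly_algebra N])

text \<open>The elements of \<open>J\<close> in the variables of one block form an ideal there, and
  it contains the relations of that block.\<close>

lemma N_J:
  assumes "i \<in> I" "f \<in> N i"
  shows "f \<in> J"
proof -
  have "ideal {f \<in> carrier (poly_algebra (V i)). f \<in> J} (poly_algebra (V i))"
    by (rule poly_idealI)
      (auto simp: poly_ideal_0[OF J] poly_carrier_add poly_carrier_mult
        intro: poly_ideal_add[OF J] poly_ideal_mult[OF J] poly_carrier_mono[OF V_W[OF assms(1)]])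
  then have "N i \<subseteq> {f \<in> carrier (poly_algebra (V i)). f \<in> J}"
    unfolding N_def
    by (rule poly_genideal_minimal)
      (use R[OF assms(1)] poly_genideal(2)[OF R_W] assms(1) in \<open>auto simp: J_def\<close>)
  then show ?thesis using assms(2) by blast
qed

lemma cls_eq: "i \<in> I \<Longrightarrow> f \<in> carrier (poly_algebra (V i)) \<Longrightarrow> g \<in> carrier (poly_algebra (V i)) \<Longrightarrow>
    cls i f = cls i g \<longleftrightarrow> f - g \<in> N i"
  unfolding cls_def by (rule poly_coset_eq_iff[OF N])

lemma cls_carrier: "f \<in> carrier (poly_algebra (V i)) \<Longrightarrow> cls i f \<in> carrier (A i)"
  by (auto simp: A_def cls_def carrier_quot_algebra)

lemma carrier_A: "X \<in> carrier (A i) \<Longrightarrow> \<exists>f\<in>carrier (poly_algebra (V i)). X = cls i f"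
  by (auto simp: A_def cls_def carrier_quot_algebra)

lemma cls_mult: "i \<in> I \<Longrightarrow> f \<in> carrier (poly_algebra (V i)) \<Longrightarrow> g \<in> carrier (poly_algebra (V i)) \<Longrightarrow>
    cls i f \<otimes>\<^bsub>A i\<^esub> cls i g = cls i (f * g)"
  unfolding cls_def A_def by (subst mult_quot_algebra[OF good_poly_algebra N]) simp_all

lemma cls_add: "i \<in> I \<Longrightarrow> f \<in> carrier (poly_algebra (V i)) \<Longrightarrow> g \<in> carrier (poly_algebra (V i)) \<Longrightarrow>
    cls i f \<oplus>\<^bsub>A i\<^esub> cls i g = cls i (f + g)"
  unfolding cls_def A_def by (subst add_quot_algebra[OF good_poly_algebra N]) simp_all

lemma cls_smult: "i \<in> I \<Longrightarrow> f \<in> carrier (poly_algebra (V i)) \<Longrightarrow>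
    c \<odot>\<^bsub>A i\<^esub> cls i f = cls i (sgl 0 c * f)"
  unfolding cls_def A_def by (subst smult_quot_algebra[OF good_poly_algebra N]) simp_all

lemma cls_one: "cls i 1 = \<one>\<^bsub>A i\<^esub>"
  by (simp add: cls_def A_def one_quot_algebra)

lemma rep:
  assumes "X \<in> carrier (A i)"
  shows "rep i X \<in> carrier (poly_algebra (V i))" "cls i (rep i X) = X"
proof -
  have "\<exists>f. f \<in> carrier (poly_algebra (V i)) \<and> X = cls i f" using carrier_A[OF assms] by blast
  from someI_ex[OF this] show "rep i X \<in> carrier (poly_algebra (V i))" "cls i (rep i X) = X"
    unfolding rep_def by simp_all
qed

lemma rep_cls: "i \<in> I \<Longrightarrow> f \<in> carrier (poly_algebra (V i)) \<Longrightarrow> rep i (cls i f) - f \<in> N i"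
  using rep[OF cls_carrier] cls_eq by metis

lemma rep_W: "i \<in> I \<Longrightarrow> X \<in> carrier (A i) \<Longrightarrow> rep i X \<in> carrier (poly_algebra W)"
  using rep(1) poly_carrier_mono[OF V_W] by blast

lemma tupP_carrier: "(\<And>i. i \<in> I \<Longrightarrow> g i \<in> carrier (poly_algebra (V i))) \<Longrightarrow>
    tupP g \<in> (\<Pi>\<^sub>E i\<in>I. carrier (A i))"
  by (simp add: tupP_def cls_carrier)

lemma tup_tupP: "tup m = tupP (\<lambda>i. sgl (mres (V i) m) 1)"
  by (simp add: tup_def tupP_def)

lemma tup_carrier: "tup m \<in> (\<Pi>\<^sub>E i\<in>I. carrier (A i))"
  unfolding tup_tupP by (rule tupP_carrier) (simp add: poly_carrier_single keys_mres)

lemma tupP_mult: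
  assumes "\<And>i. i \<in> I \<Longrightarrow> g i \<in> carrier (poly_algebra (V i))" "\<And>i. i \<in> I \<Longrightarrow> h i \<in> carrier (poly_algebra (V i))"
  shows "tuple_mult I A (tupP g) (tupP h) = tupP (\<lambda>i. g i * h i)"
  unfolding tuple_mult_def tupP_def by (rule restrict_ext) (simp add: cls_mult assms)

lemma tupP_upd: "i \<in> I \<Longrightarrow> (tupP g)(i := cls i f) = tupP (g(i := f))"
  by (auto simp: tupP_def fun_eq_iff)

lemma tupP_cong: "(\<And>i. i \<in> I \<Longrightarrow> cls i (g i) = cls i (h i)) \<Longrightarrow> tupP g = tupP h"
  unfolding tupP_def by (rule restrict_ext)

lemma tup_zero: "tup 0 = (\<lambda>i\<in>I. \<one>\<^bsub>A i\<^esub>)"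
  by (simp add: tup_def cls_one)

subsection \<open>Splitting polynomials\<close>

lemma split_poly_add: "split_poly (f + g) = split_poly f + split_poly g"
  unfolding split_poly_def by (rule lin_ext_add) (simp_all add: single_add)

lemma split_poly_0 [simp]: "split_poly 0 = 0"
  by (simp add: split_poly_def)

lemma split_poly_single: "split_poly (sgl m c) = sgl (tup m) c"
  by (simp add: split_poly_def lin_ext_single)

lemma split_poly_mult: "split_poly (f * g) = tensor_mult I A (split_poly f) (split_poly g)"
proof -
  have t: "tup (m + n) = tuple_mult I A (tup m) (tup n)" for m n
    unfolding tup_tupP
    by (subst tupP_mult) (simp_all add: poly_carrier_single keys_mres mult_single mres_add)
  have "split_poly (sgl m c * g) = tensor_mult I A (split_poly (sgl m c)) (split_poly g)" for m c
    by (induction g rule: poly_mapping_additive_induct[OF subset_UNIV])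
      (simp_all add: mult_single split_poly_single t tensor_mult_single distrib_left split_poly_add
        tensor_mult_add_right)
  then show ?thesis
    by (induction f rule: poly_mapping_additive_induct[OF subset_UNIV])
      (simp_all add: distrib_right split_poly_add tensor_mult_add_left)
qed

lemma split_poly_carrier: "split_poly f \<in> carrier F"
  by (induction f rule: poly_mapping_additive_induct[OF subset_UNIV])
    (simp_all add: free_tensor_zero split_poly_single free_tensor_single tup_carrier split_poly_add
      free_tensor_add_closed)

lemma K_add: "f \<in> K \<Longrightarrow> g \<in> K \<Longrightarrow> f + g \<in> K"
  using good_A by (rule tensor_ideal_add)

lemma K_diff: "f \<in> K \<Longrightarrow> g \<in> K \<Longrightarrow> f - g \<in> K"
  using good_A by (rule tensor_ideal_diff)

lemma K_0: "0 \<in> K"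
  using good_A by (rule tensor_ideal_0)

lemma K_uminus: "f \<in> K \<Longrightarrow> - f \<in> K"
  using good_A by (rule tensor_ideal_uminus)

lemma K_mult: "f \<in> K \<Longrightarrow> r \<in> carrier F \<Longrightarrow> tensor_mult I A r f \<in> K"
  using good_A by (rule tensor_ideal_mult)

lemma K_mult_cong: "a - b \<in> K \<Longrightarrow> c - d \<in> K \<Longrightarrow> b \<in> carrier F \<Longrightarrow> c \<in> carrier F \<Longrightarrow>
    tensor_mult I A a c - tensor_mult I A b d \<in> K"
  using good_A by (rule tensor_ideal_mult_cong)

lemma rel_K: "f \<in> multilinear_rels I A \<Longrightarrow> f \<in> K"
  using good_A by (rule tensor_ideal_rels)

lemma rels_F: "multilinear_rels I A \<subseteq> carrier F"
  using good_A by (rule multilinear_rels_carrier)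

lemma cring_F: "cring F"
  using good_A by (rule cring_free_tensor)

lemma F_mult_closed: "f \<in> carrier F \<Longrightarrow> g \<in> carrier F \<Longrightarrow> tensor_mult I A f g \<in> carrier F"
  using good_A by (rule tensor_mult_closed)

lemma rel_add:
  assumes "\<And>j. j \<in> I \<Longrightarrow> g j \<in> carrier (poly_algebra (V j))" "i \<in> I"
    "a \<in> carrier (poly_algebra (V i))" "b \<in> carrier (poly_algebra (V i))"
  shows "sgl (tupP (g(i := a + b))) 1 - sgl (tupP (g(i := a))) 1 - sgl (tupP (g(i := b))) 1 \<in> K"
proof -
  have "sgl ((tupP g)(i := cls i a \<oplus>\<^bsub>A i\<^esub> cls i b)) 1 - sgl ((tupP g)(i := cls i a)) 1
      - sgl ((tupP g)(i := cls i b)) 1 \<in> multilinear_rels I A"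
    unfolding multilinear_rels_def
    using tupP_carrier[of g] cls_carrier[OF assms(3)] cls_carrier[OF assms(4)] assms(1,2) by blast
  then have "sgl ((tupP g)(i := cls i a \<oplus>\<^bsub>A i\<^esub> cls i b)) 1 - sgl ((tupP g)(i := cls i a)) 1
      - sgl ((tupP g)(i := cls i b)) 1 \<in> K" by (rule rel_K)
  then show ?thesis by (simp add: cls_add tupP_upd assms(2-4))
qed

lemma rel_smult:
  assumes "\<And>j. j \<in> I \<Longrightarrow> g j \<in> carrier (poly_algebra (V j))" "i \<in> I"
    "a \<in> carrier (poly_algebra (V i))"
  shows "sgl (tupP (g(i := sgl 0 c * a))) 1 - sgl (tupP (g(i := a))) c \<in> K"
proof -
  have "sgl ((tupP g)(i := c \<odot>\<^bsub>A i\<^esub> cls i a)) 1 - sgl ((tupP g)(i := cls i a)) c \<in> multilinear_rels I A"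
    unfolding multilinear_rels_def
    using tupP_carrier[of g] cls_carrier[OF assms(3)] assms(1,2) by blast
  then have "sgl ((tupP g)(i := c \<odot>\<^bsub>A i\<^esub> cls i a)) 1 - sgl ((tupP g)(i := cls i a)) c \<in> K"
    by (rule rel_K)
  then show ?thesis by (simp add: cls_smult tupP_upd assms(2-3))
qed

text \<open>As the blocks are disjoint, a monomial in the variables \<open>V i\<close> has entry 1
  in every other slot of its tuple. Multilinearity in slot \<open>i\<close> extends this from
  monomials to polynomials.\<close>

lemma split_poly_slot:
  assumes i: "i \<in> I" and f: "f \<in> carrier (poly_algebra (V i))"
  shows "split_poly f - sgl (tupP ((\<lambda>_. 1)(i := f))) 1 \<in> K"
proof -
  have "kys f \<subseteq> {m. kys m \<subseteq> V i}" using f by (auto simp: carrier_poly_algebra)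
  then show ?thesis
  proof (induction f rule: poly_mapping_additive_induct)
    case zero
    \<comment> \<open>With the scalar 0, homogeneity in slot \<open>i\<close> shows that a tuple
      with an entry 0 lies in \<open>K\<close>.\<close>
    have "sgl (tupP ((\<lambda>_. 1)(i := sgl 0 0 * 1))) 1 - sgl (tupP ((\<lambda>_. 1)(i := 1))) 0 \<in> K"
      by (rule rel_smult) (simp_all add: i)
    then have "sgl (tupP ((\<lambda>_. 1)(i := 0))) 1 \<in> K" by simp
    from K_uminus[OF this] show ?case by (simp add: fun_upd_def)
  next
    case (single m c)
    have "tup m = tupP ((\<lambda>_. 1)(i := sgl m 1))"
      unfolding tup_tupP
    proof (rule tupP_cong)
      fix j assume j: "j \<in> I"
      show "cls j (sgl (mres (V j) m) 1) = cls j (((\<lambda>_. 1)(i := sgl m 1)) j)"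
      proof (cases "j = i")
        case False
        then have "kys m \<inter> V j = {}" using disj i j single unfolding disjoint_family_on_def by blast
        then show ?thesis using False by (simp add: mres_disjoint)
      qed (use single in \<open>simp add: mres_id\<close>)
    qed
    moreover have "sgl (tupP ((\<lambda>_. 1)(i := sgl 0 c * sgl m 1))) 1 - sgl (tupP ((\<lambda>_. 1)(i := sgl m 1))) c \<in> K"
      by (rule rel_smult) (use single in \<open>simp_all add: i poly_carrier_single\<close>)
    ultimately show ?case
      using K_uminus[of "sgl (tupP ((\<lambda>_. 1)(i := sgl m c))) 1 - sgl (tup m) c"]
      by (simp add: split_poly_single mult_single fun_upd_def)
  next
    case (add g h)
    have "sgl (tupP ((\<lambda>_. 1)(i := g + h))) 1 - sgl (tupP ((\<lambda>_. 1)(i := g))) 1 - sgl (tupP ((\<lambda>_. 1)(i := h))) 1 \<in> K"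
      by (rule rel_add) (use add(1,2) in \<open>auto simp: i carrier_poly_algebra\<close>)
    from K_diff[OF K_add[OF add(3,4)] this] show ?case
      by (simp add: split_poly_add algebra_simps fun_upd_def)
  qed
qed

text \<open>The tuple with entries \<open>f i\<close> is the product of tuples that have one entry
  \<open>f i\<close> and all others 1, so the one-slot case applies factor by factor.\<close>

lemma split_poly_prod:
  assumes f: "\<And>i. i \<in> I \<Longrightarrow> f i \<in> carrier (poly_algebra (V i))" and S: "S \<subseteq> I"
  shows "split_poly (\<Prod>i\<in>S. f i) - sgl (tupP (\<lambda>i. if i \<in> S then f i else 1)) 1 \<in> K"
  using finite_subset[OF S fin] S
proof (induction S rule: finite_induct)
  case empty
  have "split_poly 1 = sgl (tupP (\<lambda>i. 1)) 1"
    using split_poly_single[of 0 1] by (simp add: tup_tupP)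
  then show ?case by (simp add: K_0)
next
  case (insert i S)
  have i: "i \<in> I" "S \<subseteq> I" using insert by auto
  have "tensor_mult I A (split_poly (f i)) (split_poly (\<Prod>i\<in>S. f i)) -
      tensor_mult I A (sgl (tupP ((\<lambda>_. 1)(i := f i))) 1) (sgl (tupP (\<lambda>i. if i \<in> S then f i else 1)) 1) \<in> K"
    by (rule K_mult_cong[OF split_poly_slot[OF i(1) f[OF i(1)]] insert.IH[OF i(2)]])
      (use f i in \<open>auto intro!: free_tensor_single tupP_carrier split_poly_carrier\<close>)
  also have "tensor_mult I A (sgl (tupP ((\<lambda>_. 1)(i := f i))) 1) (sgl (tupP (\<lambda>i. if i \<in> S then f i else 1)) 1) =
      sgl (tupP (\<lambda>j. if j \<in> insert i S then f j else 1)) 1"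
  proof -
    have "(\<lambda>j. ((\<lambda>_. 1)(i := f i)) j * (if j \<in> S then f j else 1)) = (\<lambda>j. if j \<in> insert i S then f j else 1)"
      using insert(2) by (auto simp: fun_eq_iff)
    moreover have "tuple_mult I A (tupP ((\<lambda>_. 1)(i := f i))) (tupP (\<lambda>i. if i \<in> S then f i else 1)) =
        tupP (\<lambda>j. ((\<lambda>_. 1)(i := f i)) j * (if j \<in> S then f j else 1))"
      by (rule tupP_mult) (use f i in auto)
    ultimately show ?thesis unfolding tensor_mult_single by simp
  qed
  also have "tensor_mult I A (split_poly (f i)) (split_poly (\<Prod>i\<in>S. f i)) = split_poly (\<Prod>i\<in>insert i S. f i)"
    using insert by (simp add: split_poly_mult)
  finally show ?case .
qed

text \<open>A relation \<open>r\<close> of block \<open>i\<close> has the class of 0 in slot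
  \<open>i\<close>. Hence \<open>split_poly r\<close> and \<open>split_poly 0\<close> are congruent
  to the same tuple modulo \<open>K\<close>.\<close>

lemma split_poly_J:
  assumes "f \<in> J"
  shows "split_poly f \<in> K"
proof -
  have "ideal {f \<in> carrier (poly_algebra W). split_poly f \<in> K} (poly_algebra W)"
    by (rule poly_idealI)
      (auto simp: K_0 split_poly_add split_poly_mult poly_carrier_add poly_carrier_mult split_poly_carrier
        intro: K_add K_mult)
  moreover have "split_poly r \<in> K" if r: "i \<in> I" "r \<in> R i" for i r
  proof -
    have rc: "r \<in> carrier (poly_algebra (V i))" using R r by blast
    have rN: "r - 0 \<in> N i" using r poly_genideal(2)[OF R[OF r(1)]] by (auto simp: N_def)
    have "tupP ((\<lambda>_. 1)(i := r)) = tupP ((\<lambda>_. 1)(i := 0))"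
      by (rule tupP_cong) (use r rc rN cls_eq[of i r 0] in auto)
    then have "split_poly r - sgl (tupP ((\<lambda>_. 1)(i := 0))) 1 \<in> K"
      using split_poly_slot[OF r(1) rc] by simp
    moreover have "split_poly 0 - sgl (tupP ((\<lambda>_. 1)(i := 0))) 1 \<in> K"
      by (rule split_poly_slot[OF r(1)]) simp
    ultimately show ?thesis using K_diff by fastforce
  qed
  ultimately have "J \<subseteq> {f \<in> carrier (poly_algebra W). split_poly f \<in> K}"
    unfolding J_def using R_W by (intro poly_genideal_minimal) auto
  then show ?thesis using assms by blast
qed

subsection \<open>Multiplying tuples\<close>

lemma mult_poly_add: "mult_poly (f + g) = mult_poly f + mult_poly g"
  unfolding mult_poly_def by (rule lin_ext_add) (simp_all add: single_add distrib_right)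

lemma mult_poly_0 [simp]: "mult_poly 0 = 0"
  by (simp add: mult_poly_def)

lemma mult_poly_single: "mult_poly (sgl u c) = sgl 0 c * (\<Prod>i\<in>I. rep i (u i))"
  by (simp add: mult_poly_def lin_ext_single)

lemma mult_poly_diff: "mult_poly (f - g) = mult_poly f - mult_poly g"
  using mult_poly_add[of "f - g" g] by simp

lemma rep_prod_carrier: "u \<in> (\<Pi>\<^sub>E i\<in>I. carrier (A i)) \<Longrightarrow> (\<Prod>i\<in>I. rep i (u i)) \<in> carrier (poly_algebra W)"
  by (rule poly_carrier_prod) (auto intro: rep_W)

lemma mult_poly_carrier: "f \<in> carrier F \<Longrightarrow> mult_poly f \<in> carrier (poly_algebra W)"
  by (induction f rule: free_tensor_induct)
    (simp_all add: mult_poly_single rep_prod_carrier poly_carrier_mult mult_poly_add poly_carrier_add)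

lemma rep_prod_cong:
  assumes "u \<in> (\<Pi>\<^sub>E i\<in>I. carrier (A i))"
    and "\<And>i. i \<in> I \<Longrightarrow> g i \<in> carrier (poly_algebra (V i))" and "\<And>i. i \<in> I \<Longrightarrow> u i = cls i (g i)"
  shows "(\<Prod>i\<in>I. rep i (u i)) - (\<Prod>i\<in>I. g i) \<in> J"
  by (rule poly_ideal_prod_cong[OF J])
    (use assms in \<open>auto intro: N_J rep_cls rep_W cls_carrier poly_carrier_mono[OF V_W]\<close>)

text \<open>On single tuples, the representative chosen for a product of two cosets differs from the
  product of their representatives by an element of the ideal of that block.\<close>

lemma mult_poly_mult:
  assumes f: "f \<in> carrier F" and h: "h \<in> carrier F"
  shows "mult_poly (tensor_mult I A f h) - mult_poly f * mult_poly h \<in> J"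
  using f
proof (induction f rule: free_tensor_induct)
  case u: (single u c)
  show ?case using h
  proof (induction h rule: free_tensor_induct)
    case v: (single v d)
    have "(\<Prod>i\<in>I. rep i (tuple_mult I A u v i)) - (\<Prod>i\<in>I. rep i (u i) * rep i (v i)) \<in> J"
    proof (rule rep_prod_cong)
      show "tuple_mult I A u v \<in> (\<Pi>\<^sub>E i\<in>I. carrier (A i))"
        by (rule tuple_mult_closed[OF good_A u v])
      fix i assume i: "i \<in> I"
      have ui: "u i \<in> carrier (A i)" "v i \<in> carrier (A i)" using u v i by auto
      show "rep i (u i) * rep i (v i) \<in> carrier (poly_algebra (V i))"
        using ui by (intro poly_carrier_mult rep)
      show "tuple_mult I A u v i = cls i (rep i (u i) * rep i (v i))"
        using cls_mult[OF i rep(1)[OF ui(1)] rep(1)[OF ui(2)]] i ui rep(2) by (simp add: tuple_mult_def)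
    qed
    then have "sgl 0 (c * d) * ((\<Prod>i\<in>I. rep i (tuple_mult I A u v i)) - (\<Prod>i\<in>I. rep i (u i) * rep i (v i))) \<in> J"
      by (rule poly_ideal_mult[OF J]) simp
    moreover have "sgl 0 (c * d) = sgl 0 c * (sgl 0 d :: ('v \<Rightarrow>\<^sub>0 nat) \<Rightarrow>\<^sub>0 rat)" by (simp add: mult_single)
    ultimately show ?case
      by (simp add: tensor_mult_single mult_poly_single prod.distrib algebra_simps)
  next
    case (add g h)
    then show ?case using poly_ideal_add[OF J add(3,4)]
      by (simp add: tensor_mult_add_right mult_poly_add algebra_simps)
  qed (simp add: poly_ideal_0[OF J])
next
  case (add f g)
  then show ?case using poly_ideal_add[OF J add(3,4)]
    by (simp add: tensor_mult_add_left mult_poly_add algebra_simps)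
qed (simp add: poly_ideal_0[OF J])

lemma mult_poly_smult: "mult_poly (Poly_Mapping.map ((*) c) f) = sgl 0 c * mult_poly f"
proof (induction f rule: poly_mapping_additive_induct[OF subset_UNIV])
  case (2 u d)
  have "sgl 0 (c * d) = sgl 0 c * (sgl 0 d :: ('v \<Rightarrow>\<^sub>0 nat) \<Rightarrow>\<^sub>0 rat)" by (simp add: mult_single)
  then show ?case by (simp add: map_scale_single mult_poly_single mult.assoc)
qed (simp_all add: map_scale_zero map_scale_add mult_poly_add distrib_left)

lemma mult_poly_tupP:
  assumes "\<And>i. i \<in> I \<Longrightarrow> g i \<in> carrier (poly_algebra (V i))"
  shows "mult_poly (sgl (tupP g) c) - sgl 0 c * (\<Prod>i\<in>I. g i) \<in> J"
proof -
  have "(\<Prod>i\<in>I. rep i (tupP g i)) - (\<Prod>i\<in>I. g i) \<in> J"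
    by (rule rep_prod_cong[OF tupP_carrier]) (simp_all add: assms tupP_def)
  from poly_ideal_mult[OF J this, of "sgl 0 c"] show ?thesis
    by (simp add: mult_poly_single right_diff_distrib)
qed

lemma mult_poly_split_poly:
  assumes f: "f \<in> carrier (poly_algebra W)"
  shows "mult_poly (split_poly f) - f \<in> J"
proof -
  have "kys f \<subseteq> {m. kys m \<subseteq> W}" using f by (auto simp: carrier_poly_algebra)
  then show ?thesis
  proof (induction f rule: poly_mapping_additive_induct)
    case (single m c)
    have "(\<Prod>i\<in>S. sgl (mres (V i) m) (1::rat)) = sgl (\<Sum>i\<in>S. mres (V i) m) 1" for S
      by (induction S rule: infinite_finite_induct) (simp_all add: mult_single)
    then have "(\<Prod>i\<in>I. sgl (mres (V i) m) (1::rat)) = sgl m 1"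
      using sum_mres[OF fin disj, of m] single by (simp add: W_def)
    moreover have "mult_poly (sgl (tup m) c) - sgl 0 c * (\<Prod>i\<in>I. sgl (mres (V i) m) 1) \<in> J"
      unfolding tup_tupP by (rule mult_poly_tupP) (simp add: poly_carrier_single keys_mres)
    ultimately show ?case by (simp add: split_poly_single mult_single)
  next
    case (add g h)
    then show ?case using poly_ideal_add[OF J add(3,4)]
      by (simp add: split_poly_add mult_poly_add algebra_simps)
  qed (simp add: poly_ideal_0[OF J])
qed

lemma split_poly_mult_poly:
  assumes "f \<in> carrier F"
  shows "split_poly (mult_poly f) - f \<in> K"
  using assms
proof (induction f rule: free_tensor_induct)
  case (single u c)
  have ui: "u i \<in> carrier (A i)" if "i \<in> I" for i using single that by auto
  have "tupP (\<lambda>i. if i \<in> I then rep i (u i) else 1) = u"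
  proof -
    have "tupP (\<lambda>i. if i \<in> I then rep i (u i) else 1) = restrict u I"
      unfolding tupP_def by (rule restrict_ext) (simp add: rep(2) ui)
    then show ?thesis using single PiE_restrict by metis
  qed
  then have 1: "split_poly (\<Prod>i\<in>I. rep i (u i)) - sgl u 1 \<in> K"
    using split_poly_prod[of "\<lambda>i. rep i (u i)" I] rep(1) ui by simp
  \<comment> \<open>The coefficient is carried by the tuple of ones, which is
    \<open>tup 0\<close>.\<close>
  have "tensor_mult I A (sgl (tup 0) c) (split_poly (\<Prod>i\<in>I. rep i (u i)) - sgl u 1) \<in> K"
    by (rule K_mult[OF 1]) (simp_all add: free_tensor_single tup_carrier)
  moreover have "tensor_mult I A (sgl (tup 0) c) (sgl u 1) = sgl u c"
    unfolding tup_zero by (subst tensor_mult_one[OF good_A])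
      (use single in \<open>auto intro: free_tensor_single simp: map_scale_single\<close>)
  ultimately show ?case
    by (simp add: mult_poly_single split_poly_mult split_poly_single tensor_mult_diff_right)
next
  case (add g h)
  then show ?case using K_add[OF add(3,4)]
    by (simp add: split_poly_add mult_poly_add algebra_simps)
qed (simp add: K_0)

text \<open>Because \<open>mult_poly\<close> is multiplicative modulo \<open>J\<close>, the elements
  it sends into \<open>J\<close> form an ideal, and only the multilinear relations have to be
  tested.\<close>

lemma mult_poly_K:
  assumes "f \<in> K"
  shows "mult_poly f \<in> J"
proof -
  let ?P = "{f \<in> carrier F. mult_poly f \<in> J}"
  have neg: "mult_poly (- f) = - mult_poly f" for f using mult_poly_diff[of 0 f] by simp
  have id: "ideal ?P F"
  proof (rule free_tensor_idealI[OF good_A])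
    fix a r assume a: "a \<in> ?P" and r: "r \<in> carrier F"
    have "mult_poly (tensor_mult I A r a) - mult_poly r * mult_poly a \<in> J"
      using a r by (intro mult_poly_mult) auto
    moreover have "mult_poly r * mult_poly a \<in> J"
      using a r by (intro poly_ideal_mult[OF J]) (auto intro: mult_poly_carrier)
    ultimately have "mult_poly (tensor_mult I A r a) \<in> J" using poly_ideal_add[OF J] by fastforce
    then show "tensor_mult I A r a \<in> ?P" using a r F_mult_closed by simp
  qed (auto simp: free_tensor_zero free_tensor_add_closed free_tensor_uminus_closed poly_ideal_0[OF J]
      mult_poly_add neg intro: poly_ideal_add[OF J] poly_ideal_uminus[OF J])
  have "multilinear_rels I A \<subseteq> ?P"
  proof
    fix f assume f: "f \<in> multilinear_rels I A"
    have u: "u = tupP (\<lambda>i. rep i (u i))" if u: "u \<in> (\<Pi>\<^sub>E i\<in>I. carrier (A i))" for u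
    proof -
      have "tupP (\<lambda>i. rep i (u i)) = restrict u I"
        unfolding tupP_def by (rule restrict_ext, rule rep(2)) (use u in auto)
      then show ?thesis using u PiE_restrict by metis
    qed
    \<comment> \<open>In slot \<open>i\<close> any representative of the entry may be used while the
      other slots stay fixed; the multilinear relations then turn into distributivity and
      associativity of polynomials.\<close>
    have upd: "mult_poly (sgl ((tupP g)(i := cls i a)) c) - sgl 0 c * (a * (\<Prod>j\<in>I - {i}. g j)) \<in> J"
      if g: "\<And>j. j \<in> I \<Longrightarrow> g j \<in> carrier (poly_algebra (V j))" and i: "i \<in> I"
        and a: "a \<in> carrier (poly_algebra (V i))" for g i a c
    proof -
      have "(\<Prod>j\<in>I. (g(i := a)) j) = a * (\<Prod>j\<in>I - {i}. g j)"
        using i fin by (simp add: prod.remove)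
      then show ?thesis
        using mult_poly_tupP[of "g(i := a)" c] g a by (simp add: tupP_upd[OF i])
    qed
    from f consider (add) u i a b where
        "f = sgl (u(i := a \<oplus>\<^bsub>A i\<^esub> b)) 1 - sgl (u(i := a)) 1 - sgl (u(i := b)) 1"
        "u \<in> (\<Pi>\<^sub>E i\<in>I. carrier (A i))" "i \<in> I" "a \<in> carrier (A i)" "b \<in> carrier (A i)"
      | (smult) u i c a where "f = sgl (u(i := c \<odot>\<^bsub>A i\<^esub> a)) 1 - sgl (u(i := a)) c"
        "u \<in> (\<Pi>\<^sub>E i\<in>I. carrier (A i))" "i \<in> I" "a \<in> carrier (A i)"
      unfolding multilinear_rels_def by blast
    then have "mult_poly f \<in> J"
    proof cases
      case add
      define g where "g i = rep i (u i)" for i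
      have g: "g j \<in> carrier (poly_algebra (V j))" if "j \<in> I" for j
        unfolding g_def using add(2) that by (intro rep(1)) auto
      obtain p q where p: "p \<in> carrier (poly_algebra (V i))" "a = cls i p"
        and q: "q \<in> carrier (poly_algebra (V i))" "b = cls i q"
        using carrier_A[OF add(4)] carrier_A[OF add(5)] by blast
      have up: "u = tupP g" unfolding g_def by (rule u[OF add(2)])
      let ?m = "\<Prod>j\<in>I - {i}. g j"
      have "mult_poly f - (sgl 0 1 * ((p + q) * ?m) - sgl 0 1 * (p * ?m) - sgl 0 1 * (q * ?m)) =
         (mult_poly (sgl ((tupP g)(i := cls i (p + q))) 1) - sgl 0 1 * ((p + q) * ?m))
         - (mult_poly (sgl ((tupP g)(i := cls i p)) 1) - sgl 0 1 * (p * ?m))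
         - (mult_poly (sgl ((tupP g)(i := cls i q)) 1) - sgl 0 1 * (q * ?m))"
        unfolding add(1) p(2) q(2) cls_add[OF add(3) p(1) q(1)] up mult_poly_diff by simp
      also have "\<dots> \<in> J"
        by (intro poly_ideal_diff[OF J] upd g add(3) p q poly_carrier_add)
      finally show ?thesis by (simp add: algebra_simps)
    next
      case smult
      define g where "g i = rep i (u i)" for i
      have g: "g j \<in> carrier (poly_algebra (V j))" if "j \<in> I" for j
        unfolding g_def using smult(2) that by (intro rep(1)) auto
      obtain p where p: "p \<in> carrier (poly_algebra (V i))" "a = cls i p"
        using carrier_A[OF smult(4)] by blast
      have up: "u = tupP g" unfolding g_def by (rule u[OF smult(2)])
      let ?m = "\<Prod>j\<in>I - {i}. g j"
      have "mult_poly f = (mult_poly (sgl ((tupP g)(i := cls i (sgl 0 c * p))) 1) - sgl 0 1 * ((sgl 0 c * p) * ?m))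
         - (mult_poly (sgl ((tupP g)(i := cls i p)) c) - sgl 0 c * (p * ?m))"
        unfolding smult(1) p(2) cls_smult[OF smult(3) p(1)] up mult_poly_diff by (simp add: mult.assoc)
      also have "\<dots> \<in> J"
        by (intro poly_ideal_diff[OF J] upd g smult(3) p poly_carrier_mult poly_carrier_const)
      finally show ?thesis .
    qed
    then show "f \<in> ?P" using f rels_F by blast
  qed
  then have "K \<subseteq> ?P"
    by (rule ring.genideal_minimal[OF cring.axioms(1)[OF cring_F] id])
  then show ?thesis using assms by blast
qed

text \<open>The representatives chosen by \<open>rep\<close> need not be homogeneous. Every
  homogeneous coset contains a homogeneous polynomial, and exchanging representatives changes a
  product only by an element of \<open>J\<close>.\<close>

lemma mult_poly_grade:
  assumes f: "f \<in> grade F d"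
  shows "\<exists>g\<in>grade (poly_algebra W) d. mult_poly f - g \<in> J"
proof -
  have "\<exists>g\<in>grade (poly_algebra W) d. (\<Prod>i\<in>I. rep i (u i)) - g \<in> J" if u: "u \<in> kys f" for u
  proof -
    obtain \<delta> where \<delta>: "u \<in> (\<Pi>\<^sub>E i\<in>I. carrier (A i))" "\<forall>i\<in>I. u i \<in> grade (A i) (\<delta> i)" "(\<Sum>i\<in>I. \<delta> i) = d"
      using f u by (auto simp: free_tensor_def)
    have "\<forall>i\<in>I. \<exists>p. p \<in> grade (poly_algebra (V i)) (\<delta> i) \<and> u i = cls i p"
      using \<delta>(2) by (auto simp: A_def grade_quot_algebra cls_def)
    then obtain p where p: "\<forall>i\<in>I. p i \<in> grade (poly_algebra (V i)) (\<delta> i) \<and> u i = cls i (p i)"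
      by (rule bchoice[THEN exE])
    have pW: "p i \<in> grade (poly_algebra W) (\<delta> i)" if i: "i \<in> I" for i
    proof -
      have "p i \<in> grade (poly_algebra (V i)) (\<delta> i)" using p i by blast
      then show ?thesis unfolding grade_poly_algebra using V_W[OF i] by blast
    qed
    have "(\<Prod>i\<in>I. p i) \<in> grade (poly_algebra W) d"
      using grade_poly_prod[OF fin, of p W \<delta>] pW \<delta>(3) by simp
    moreover have "(\<Prod>i\<in>I. rep i (u i)) - (\<Prod>i\<in>I. p i) \<in> J"
      by (rule rep_prod_cong[OF \<delta>(1)]) (use p grade_poly_carrier in blast)+
    ultimately show ?thesis by blast
  qed
  then have "\<forall>u\<in>kys f. \<exists>g. g \<in> grade (poly_algebra W) d \<and> (\<Prod>i\<in>I. rep i (u i)) - g \<in> J" by blast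
  then obtain g where g: "\<forall>u\<in>kys f. g u \<in> grade (poly_algebra W) d \<and> (\<Prod>i\<in>I. rep i (u i)) - g u \<in> J"
    by (rule bchoice[THEN exE])
  show ?thesis
  proof (rule bexI)
    show "(\<Sum>u\<in>kys f. sgl 0 (lkp f u) * g u) \<in> grade (poly_algebra W) d"
      using g by (intro grade_poly_sum grade_poly_const) blast
    have "mult_poly f - (\<Sum>u\<in>kys f. sgl 0 (lkp f u) * g u) =
        (\<Sum>u\<in>kys f. sgl 0 (lkp f u) * ((\<Prod>i\<in>I. rep i (u i)) - g u))"
      by (simp add: mult_poly_def lin_ext_def right_diff_distrib sum_subtractf)
    also have "\<dots> \<in> J"
      using g by (intro poly_ideal_sum[OF J] poly_ideal_mult[OF J]) auto
    finally show "mult_poly f - (\<Sum>u\<in>kys f. sgl 0 (lkp f u) * g u) \<in> J" .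
  qed
qed

text \<open>The degrees of the blocks of a monomial add up to its degree; the factor 2 is the degree
  of a variable.\<close>

lemma split_poly_grade:
  assumes f: "f \<in> grade (poly_algebra W) d"
  shows "split_poly f \<in> grade F d"
proof -
  have "kys (split_poly f) \<subseteq> tup ` kys f"
    unfolding split_poly_def lin_ext_def using keys_sum[of "\<lambda>m. sgl (tup m) (lkp f m)" "kys f"] by fastforce
  moreover have "\<exists>\<delta>. (\<forall>i\<in>I. tup m i \<in> grade (A i) (\<delta> i)) \<and> (\<Sum>i\<in>I. \<delta> i) = d" if m: "m \<in> kys f" for m
  proof (intro exI conjI ballI)
    have mW: "kys m \<subseteq> W" "2 * mdeg m = d" using f m by (auto simp: grade_poly_algebra)
    show "(\<Sum>i\<in>I. 2 * mdeg (mres (V i) m)) = d"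
      using sum_mres[OF fin disj, of m] mW mdeg_sum[of "\<lambda>i. mres (V i) m" I]
      by (simp add: W_def sum_distrib_left[symmetric])
    fix i assume i: "i \<in> I"
    have "sgl (mres (V i) m) 1 \<in> grade (poly_algebra (V i)) (2 * mdeg (mres (V i) m))"
      by (rule grade_poly_single) (simp add: keys_mres)
    then show "tup m i \<in> grade (A i) (2 * mdeg (mres (V i) m))"
      using i by (auto simp: tup_def cls_def A_def grade_quot_algebra)
  qed
  ultimately have "\<forall>u\<in>kys (split_poly f). u \<in> (\<Pi>\<^sub>E i\<in>I. carrier (A i)) \<and>
      (\<exists>\<delta>. (\<forall>i\<in>I. u i \<in> grade (A i) (\<delta> i)) \<and> (\<Sum>i\<in>I. \<delta> i) = d)"
    using tup_carrier by blast
  then show ?thesis unfolding free_tensor_def by simp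
qed

lemma good_F: "good_algebra F"
  using good_A by (rule good_free_tensor)

lemma ideal_K: "ideal K F"
  using good_A by (rule tensor_ideal)

lemma good_tensor: "good_algebra (tensor_algebra I A)"
  unfolding tensor_algebra_def
  by (rule good_quot_algebra[OF good_F ideal_K])

theorem tensor_iso: "tensor_algebra I A \<cong>\<^sub>g\<^sub>r quot_algebra (poly_algebra W) J"
  unfolding tensor_algebra_def
proof (rule graded_iso_quot_algebra[OF good_F ideal_K good_poly_algebra J, where h = mult_poly])
  have coset: "J +>\<^bsub>poly_algebra W\<^esub> p = J +>\<^bsub>poly_algebra W\<^esub> q"
    if "p \<in> carrier (poly_algebra W)" "q \<in> carrier (poly_algebra W)" "p - q \<in> J" for p q
    using poly_coset_eq_iff[OF J that(1,2)] that(3) by simp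
  show "mult_poly a \<in> carrier (poly_algebra W)" if "a \<in> carrier F" for a
    using that by (rule mult_poly_carrier)
  show "J +>\<^bsub>poly_algebra W\<^esub> mult_poly (a \<oplus>\<^bsub>F\<^esub> b) = J +>\<^bsub>poly_algebra W\<^esub> (mult_poly a \<oplus>\<^bsub>poly_algebra W\<^esub> mult_poly b)"
    if "a \<in> carrier F" "b \<in> carrier F" for a b by (simp add: mult_poly_add)
  show "J +>\<^bsub>poly_algebra W\<^esub> mult_poly (a \<otimes>\<^bsub>F\<^esub> b) = J +>\<^bsub>poly_algebra W\<^esub> (mult_poly a \<otimes>\<^bsub>poly_algebra W\<^esub> mult_poly b)"
    if ab: "a \<in> carrier F" "b \<in> carrier F" for a b
    using mult_poly_mult[OF ab] ab
    by (simp add: coset mult_poly_carrier poly_carrier_mult F_mult_closed)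
  show "J +>\<^bsub>poly_algebra W\<^esub> mult_poly \<one>\<^bsub>F\<^esub> = J +>\<^bsub>poly_algebra W\<^esub> \<one>\<^bsub>poly_algebra W\<^esub>"
    using mult_poly_tupP[of "\<lambda>_. 1" 1] mult_poly_carrier[OF free_tensor_scalar[OF good_A]]
    by (intro coset) (simp_all add: tupP_def cls_one)
  show "J +>\<^bsub>poly_algebra W\<^esub> mult_poly (c \<odot>\<^bsub>F\<^esub> a) = J +>\<^bsub>poly_algebra W\<^esub> (c \<odot>\<^bsub>poly_algebra W\<^esub> mult_poly a)"
    if "a \<in> carrier F" for c a by (simp add: smult_free_tensor mult_poly_smult)
  show "mult_poly a \<in> J \<longleftrightarrow> a \<in> K" if a: "a \<in> carrier F" for a
  proof
    assume "mult_poly a \<in> J"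
    from K_diff[OF split_poly_J[OF this] split_poly_mult_poly[OF a]] show "a \<in> K" by simp
  qed (rule mult_poly_K)
  show "\<exists>a\<in>carrier F. J +>\<^bsub>poly_algebra W\<^esub> mult_poly a = J +>\<^bsub>poly_algebra W\<^esub> f"
    if f: "f \<in> carrier (poly_algebra W)" for f
    by (rule bexI[OF _ split_poly_carrier])
      (rule coset[OF mult_poly_carrier[OF split_poly_carrier] f mult_poly_split_poly[OF f]])
  show "\<exists>f\<in>grade (poly_algebra W) d. J +>\<^bsub>poly_algebra W\<^esub> mult_poly a = J +>\<^bsub>poly_algebra W\<^esub> f"
    if a: "a \<in> grade F d" for d a
  proof -
    obtain f where f: "f \<in> grade (poly_algebra W) d" "mult_poly a - f \<in> J"
      using mult_poly_grade[OF a] by blast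
    show ?thesis
      by (rule bexI[OF _ f(1)])
        (rule coset[OF mult_poly_carrier[OF good_algebra_grade[OF good_F a]] grade_poly_carrier[OF f(1)] f(2)])
  qed
  show "\<exists>a\<in>grade F d. J +>\<^bsub>poly_algebra W\<^esub> mult_poly a = J +>\<^bsub>poly_algebra W\<^esub> f"
    if f: "f \<in> grade (poly_algebra W) d" for d f
    by (rule bexI[OF _ split_poly_grade[OF f]])
      (rule coset[OF mult_poly_carrier[OF split_poly_carrier] grade_poly_carrier[OF f]
          mult_poly_split_poly[OF grade_poly_carrier[OF f]]])
qed

end

section \<open>Joins in geometric lattices with a building set\<close>

locale geom =
  fixes L :: "'a gorder" and G H :: "'a set"
  assumes geo: "geometric_lattice L" and pbs: "partial_building_set L G H"
begin

interpretation L: lattice L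
  using geo by (simp add: geometric_lattice_def)

abbreviation "C \<equiv> carrier L"
text \<open>Membership in the carrier is made part of the relation, so that chains of inequalities
  bring their own side conditions.\<close>

definition lq (infix \<open>\<preceq>\<close> 50) where "x \<preceq> y \<longleftrightarrow> x \<in> C \<and> y \<in> C \<and> x \<sqsubseteq>\<^bsub>L\<^esub> y"
definition "J X = \<Squnion>\<^bsub>L\<^esub>X"
abbreviation "ats \<equiv> atoms L"
abbreviation "Ho \<equiv> H - atoms L"
abbreviation "bt \<equiv> \<bottom>\<^bsub>L\<^esub>"
abbreviation "tp \<equiv> \<top>\<^bsub>L\<^esub>"
definition "At x = {a \<in> ats. a \<preceq> x}"

lemma finC: "finite C"
  using geo by (simp add: geometric_lattice_def)

lemma neC: "C \<noteq> {}"
  using geo by (simp add: geometric_lattice_def)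

lemma finS: "X \<subseteq> C \<Longrightarrow> finite X"
  using finC finite_subset by blast

lemma lq_refl: "x \<in> C \<Longrightarrow> x \<preceq> x"
  by (simp add: lq_def)

lemma lq_trans [trans]: "x \<preceq> y \<Longrightarrow> y \<preceq> z \<Longrightarrow> x \<preceq> z"
  unfolding lq_def by (meson L.le_trans)

lemma lq_antisym: "x \<preceq> y \<Longrightarrow> y \<preceq> x \<Longrightarrow> x = y"
  unfolding lq_def by (meson L.le_antisym)

lemma lqD: "x \<preceq> y \<Longrightarrow> x \<in> C" "x \<preceq> y \<Longrightarrow> y \<in> C"
  by (auto simp: lq_def)

lemma lq_iff: "x \<in> C \<Longrightarrow> y \<in> C \<Longrightarrow> x \<sqsubseteq>\<^bsub>L\<^esub> y \<longleftrightarrow> x \<preceq> y"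
  by (simp add: lq_def)

text \<open>The bottom is defined by a choice among least elements; a finite nonempty lattice has
  one, the infimum of all its elements.\<close>

lemma least_bot: "least L bt C"
proof -
  obtain m where m: "greatest L m (Lower L C)"
    using L.finite_inf_greatest[OF finC subset_refl neC] by blast
  have "least L m C"
    using m unfolding least_def greatest_def Lower_def by auto
  then show ?thesis unfolding bottom_def by (rule someI)
qed

lemma greatest_top: "greatest L tp C"
proof -
  obtain m where m: "least L m (Upper L C)"
    using L.finite_sup_least[OF finC subset_refl neC] by blast
  have "greatest L m C"
    using m unfolding least_def greatest_def Upper_def by auto
  then show ?thesis unfolding top_def by (rule someI)
qed

lemma bt [simp]: "bt \<in> C" and bt_lq: "x \<in> C \<Longrightarrow> bt \<preceq> x"
  using least_bot by (auto simp: least_def lq_def)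

lemma tp [simp]: "tp \<in> C" and lq_tp: "x \<in> C \<Longrightarrow> x \<preceq> tp"
  using greatest_top by (auto simp: greatest_def lq_def)

lemma lub_J: assumes "X \<subseteq> C" shows "is_lub L (J X) X"
proof (cases "X = {}")
  case True
  have "is_lub L bt {}" using least_bot by simp
  then show ?thesis unfolding J_def sup_def True by (rule someI)
next
  case False
  then show ?thesis unfolding J_def using L.finite_sup_least[OF finS[OF assms] assms] by blast
qed

lemma J_closed:
  assumes "X \<subseteq> C"
  shows "J X \<in> C"
  using lub_J[OF assms] unfolding least_def by blast

lemma J_upper:
  assumes "X \<subseteq> C" "x \<in> X"
  shows "x \<preceq> J X"
proof -
  have "J X \<in> Upper L X" using lub_J[OF assms(1)] by (simp add: least_def)
  then show ?thesis using assms by (auto simp: Upper_def lq_def)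
qed

lemma J_leqI:
  assumes "z \<in> C" "\<And>x. x \<in> X \<Longrightarrow> x \<preceq> z"
  shows "J X \<preceq> z"
proof -
  have X: "X \<subseteq> C" using assms(2) lqD(1) by blast
  have "z \<in> Upper L X" using assms by (auto simp: Upper_def lq_def)
  then have "J X \<sqsubseteq>\<^bsub>L\<^esub> z" using lub_J[OF X] by (simp add: least_def)
  then show ?thesis using J_closed[OF X] assms(1) by (simp add: lq_def)
qed

lemma J_eqI:
  assumes "\<And>x. x \<in> X \<Longrightarrow> x \<preceq> z" "z \<preceq> J X"
  shows "J X = z"
  using lq_antisym[OF J_leqI[OF lqD(1)[OF assms(2)] assms(1)] assms(2)] .

lemma J_mono: "Y \<subseteq> C \<Longrightarrow> X \<subseteq> Y \<Longrightarrow> J X \<preceq> J Y"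
  by (rule J_leqI[OF J_closed]) (auto intro: J_upper)

lemma J_empty [simp]: "J {} = bt"
  by (rule J_eqI) (auto intro: bt_lq J_closed)

lemma J_singleton: "x \<in> C \<Longrightarrow> J {x} = x"
  by (rule J_eqI) (auto intro: J_upper lq_refl)

lemma join_J: "x \<squnion>\<^bsub>L\<^esub> y = J {x, y}"
  by (simp add: join_def J_def)

lemma lub_unique:
  assumes "is_lub L u X" "X \<subseteq> C"
  shows "u = J X"
proof (rule lq_antisym)
  show "u \<preceq> J X" using assms lub_J[OF assms(2)] unfolding least_def Upper_def lq_def by blast
  show "J X \<preceq> u" using assms lub_J[OF assms(2)] unfolding least_def Upper_def lq_def by blast
qed

text \<open>A strictly larger element has strictly more elements below it, so an element of
  \<open>U\<close> above \<open>u\<close> with the largest such number is maximal.\<close>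

lemma ex_maximal:
  assumes "U \<subseteq> C" "u \<in> U"
  shows "\<exists>m\<in>U. u \<preceq> m \<and> (\<forall>v\<in>U. m \<preceq> v \<longrightarrow> v = m)"
proof -
  define V where "V = {v \<in> U. u \<preceq> v}"
  define f where "f v = card {w \<in> C. w \<preceq> v}" for v
  have fin: "finite V" "V \<noteq> {}" using assms finS[OF assms(1)] lq_refl by (auto simp: V_def)
  have "Max (f ` V) \<in> f ` V" using fin by (intro Max_in) auto
  then obtain m where m: "m \<in> V" "f m = Max (f ` V)" by auto
  have "\<not> (m \<preceq> v \<and> v \<noteq> m)" if v: "v \<in> U" for v
  proof
    assume mv: "m \<preceq> v \<and> v \<noteq> m"
    then have vm: "\<not> v \<preceq> m" using lq_antisym by metis
    have vC: "v \<in> C" using v assms(1) by blast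
    have "{w \<in> C. w \<preceq> m} \<subseteq> {w \<in> C. w \<preceq> v}" using mv lq_trans by blast
    moreover have "v \<in> {w \<in> C. w \<preceq> v}" "v \<notin> {w \<in> C. w \<preceq> m}" using vC vm lq_refl by simp_all
    ultimately have "{w \<in> C. w \<preceq> m} \<subset> {w \<in> C. w \<preceq> v}" by blast
    then have "f m < f v" unfolding f_def by (rule psubset_card_mono[rotated]) (simp add: finC)
    moreover have "v \<in> V" using v m(1) mv lq_trans[of u m v] by (simp add: V_def)
    then have "f v \<le> Max (f ` V)" using fin by simp
    ultimately show False using m(2) by simp
  qed
  then have "\<forall>v\<in>U. m \<preceq> v \<longrightarrow> v = m" by metis
  moreover have "m \<in> U" "u \<preceq> m" using m(1) by (simp_all add: V_def)
  ultimately show ?thesis by (intro bexI[of _ m] conjI)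
qed

lemma atomD: "a \<in> ats \<Longrightarrow> a \<in> C" "a \<in> ats \<Longrightarrow> a \<noteq> bt" "a \<in> ats \<Longrightarrow> x \<preceq> a \<Longrightarrow> x = bt \<or> x = a"
  unfolding atoms_def lq_def by blast+

lemma At_C: "At x \<subseteq> C"
  unfolding At_def lq_def by blast

lemma J_At: assumes x: "x \<in> C" shows "J (At x) = x"
proof -
  obtain A where A: "A \<subseteq> ats" "is_lub L x A" using geo x unfolding geometric_lattice_def by blast
  have AC: "A \<subseteq> C" using A(1) atomD(1) by blast
  have xA: "x = J A" by (rule lub_unique[OF A(2) AC])
  have "A \<subseteq> At x" using A(1) J_upper[OF AC] unfolding At_def xA by blast
  then have "J A \<preceq> J (At x)" by (rule J_mono[OF At_C])
  then have "x \<preceq> J (At x)" using xA by simp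
  then show ?thesis by (rule J_eqI[rotated]) (simp add: At_def)
qed

lemma ex_atom_not_lq:
  assumes "x \<in> C" "z \<in> C" "\<not> x \<preceq> z"
  shows "\<exists>a\<in>ats. a \<preceq> x \<and> \<not> a \<preceq> z"
proof (rule ccontr)
  assume "\<not> ?thesis"
  then have "J (At x) \<preceq> z" by (intro J_leqI assms) (auto simp: At_def)
  then show False using assms J_At by simp
qed

lemma atom_lq_atom: "a \<in> ats \<Longrightarrow> b \<in> ats \<Longrightarrow> a \<preceq> b \<Longrightarrow> a = b"
  using atomD by metis

text \<open>Semimodularity: an atom not below \<open>z\<close> meets \<open>z\<close> in the bottom,
  which it covers, so the join of the two covers \<open>z\<close>.\<close>

lemma atom_cover:
  assumes a: "a \<in> ats" and z: "z \<in> C" and az: "\<not> a \<preceq> z" and w: "z \<preceq> w" "w \<preceq> J {a, z}"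
  shows "w = z \<or> w = J {a, z}"
proof -
  have aC: "a \<in> C" using a atomD by blast
  have "greatest L (a \<sqinter>\<^bsub>L\<^esub> z) (Lower L {a, z})"
    unfolding meet_def using L.finite_inf_greatest[of "{a, z}"] aC z by blast
  then have m: "a \<sqinter>\<^bsub>L\<^esub> z \<preceq> a" "a \<sqinter>\<^bsub>L\<^esub> z \<preceq> z"
    using aC z unfolding greatest_def Lower_def lq_def by auto
  then have "a \<sqinter>\<^bsub>L\<^esub> z = bt" using az a atomD by metis
  moreover have "covers L a bt" unfolding covers_def
    using a aC atomD[OF a] bt_lq[OF aC] by (auto simp: lq_def)
  ultimately have "covers L (a \<squnion>\<^bsub>L\<^esub> z) z" using geo aC z unfolding geometric_lattice_def by metis
  then show ?thesis using w unfolding covers_def join_J lq_def by metis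
qed

subsection \<open>Building sets\<close>

lemma bs: "building_set L G" and HG: "H \<subseteq> G" and atH: "ats \<subseteq> H"
  using pbs by (auto simp: partial_building_set_def)

lemma up: "p \<in> Ho \<Longrightarrow> g \<in> G \<Longrightarrow> p \<preceq> g \<Longrightarrow> g \<in> Ho"
  using pbs unfolding partial_building_set_def lq_def by blast

lemma GC: "G \<subseteq> C" and botG: "bt \<notin> G" and topG: "tp \<in> G"
  using bs unfolding building_set_def by auto

lemma HC: "H \<subseteq> C"
  using HG GC by blast

lemma ex_factor:
  assumes "q \<in> G" "q \<preceq> x"
  shows "\<exists>r\<in>maximal_below L G x. q \<preceq> r"
proof -
  have "\<exists>m\<in>{g \<in> G. g \<preceq> x}. q \<preceq> m \<and> (\<forall>v\<in>{g \<in> G. g \<preceq> x}. m \<preceq> v \<longrightarrow> v = m)"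
    by (rule ex_maximal) (use assms GC in auto)
  then show ?thesis using GC lqD(2)[OF assms(2)] unfolding maximal_below_def lq_def by blast
qed

text \<open>The isomorphism in a building set need not be the identity on the factor \<open>[0, g]\<close>: it
  only maps this factor onto \<open>[0, g]\<close>.\<close>

lemma factor_iso:
  assumes x: "x \<in> C" "x \<noteq> bt"
  obtains \<psi> where
    "\<And>v g. v \<preceq> x \<Longrightarrow> g \<in> maximal_below L G x \<Longrightarrow> \<psi> v g \<preceq> g"
    "\<And>v w. v \<preceq> x \<Longrightarrow> w \<preceq> x \<Longrightarrow> v \<preceq> w \<longleftrightarrow> (\<forall>g\<in>maximal_below L G x. \<psi> v g \<preceq> \<psi> w g)"
    "\<And>g h. g \<in> maximal_below L G x \<Longrightarrow> h \<in> maximal_below L G x \<Longrightarrow> \<psi> g h = (if h = g then g else bt)"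
    "\<And>t. (\<And>g. g \<in> maximal_below L G x \<Longrightarrow> t g \<preceq> g) \<Longrightarrow> \<exists>v. v \<preceq> x \<and> (\<forall>g\<in>maximal_below L G x. \<psi> v g = t g)"
proof -
  define X where "X = maximal_below L G x"
  define Pr where "Pr = (\<Pi>\<^sub>E g\<in>X. \<lbrace>bt..g\<rbrace>\<^bsub>L\<^esub>)"
  have XC: "g \<in> C" "g \<preceq> x" "g \<in> G" if "g \<in> X" for g
    using that GC x(1) unfolding X_def maximal_below_def lq_def by auto
  obtain \<phi> where \<phi>: "bij_betw \<phi> Pr \<lbrace>bt..x\<rbrace>\<^bsub>L\<^esub>"
      "\<forall>u\<in>Pr. \<forall>v\<in>Pr. (\<forall>g\<in>X. u g \<sqsubseteq>\<^bsub>L\<^esub> v g) \<longleftrightarrow> \<phi> u \<sqsubseteq>\<^bsub>L\<^esub> \<phi> v"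
      "\<forall>g\<in>X. \<phi> (\<lambda>h\<in>X. if h = g then g else bt) = g"
    using bs x unfolding building_set_def Let_def X_def Pr_def by blast
  have int: "v \<in> \<lbrace>bt..w\<rbrace>\<^bsub>L\<^esub> \<longleftrightarrow> v \<preceq> w" if "w \<in> C" for v w
    using that bt_lq unfolding at_least_at_most_def lq_def by blast
  define \<psi> where "\<psi> = inv_into Pr \<phi>"
  have \<psi>Pr: "\<psi> v \<in> Pr" "\<phi> (\<psi> v) = v" if "v \<preceq> x" for v
    using \<phi>(1) that int[OF x(1)] unfolding \<psi>_def bij_betw_def
    by (metis inv_into_into, metis f_inv_into_f)
  have \<psi>\<phi>: "\<psi> (\<phi> t) = t" "\<phi> t \<preceq> x" if "t \<in> Pr" for t
    using \<phi>(1) that int[OF x(1)] unfolding \<psi>_def bij_betw_def by auto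
  show thesis
  proof (rule that[of \<psi>], unfold X_def[symmetric])
    show 1: "\<psi> v g \<preceq> g" if "v \<preceq> x" "g \<in> X" for v g
      using \<psi>Pr(1)[OF that(1)] that(2) int[OF XC(1)] by (auto simp: Pr_def)
    show "v \<preceq> w \<longleftrightarrow> (\<forall>g\<in>X. \<psi> v g \<preceq> \<psi> w g)" if vw: "v \<preceq> x" "w \<preceq> x" for v w
    proof -
      have "(\<forall>g\<in>X. \<psi> v g \<sqsubseteq>\<^bsub>L\<^esub> \<psi> w g) \<longleftrightarrow> v \<sqsubseteq>\<^bsub>L\<^esub> w"
        using \<phi>(2) \<psi>Pr[OF vw(1)] \<psi>Pr[OF vw(2)] by metis
      then show ?thesis using lqD(1)[OF 1[OF vw(1)]] lqD(1)[OF 1[OF vw(2)]] vw unfolding lq_def by blast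
    qed
    show "\<psi> g h = (if h = g then g else bt)" if "g \<in> X" "h \<in> X" for g h
    proof -
      have "(\<lambda>h\<in>X. if h = g then g else bt) \<in> Pr"
        using that int XC lq_refl bt_lq by (auto simp: Pr_def)
      from \<psi>\<phi>(1)[OF this] have "\<psi> g = (\<lambda>h\<in>X. if h = g then g else bt)" using \<phi>(3) that by simp
      then show ?thesis using that by simp
    qed
    show "\<exists>v. v \<preceq> x \<and> (\<forall>g\<in>X. \<psi> v g = t g)" if t: "\<And>g. g \<in> X \<Longrightarrow> t g \<preceq> g" for t
    proof -
      have "restrict t X \<in> Pr" using t int XC by (auto simp: Pr_def)
      from \<psi>\<phi>[OF this] show ?thesis by (intro exI[of _ "\<phi> (restrict t X)"]) simp
    qed
  qed
qed

text \<open>In a product of intervals, an element below two different factors has only bottom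
  coordinates. A common nonzero lower bound therefore puts \<open>p\<close> and \<open>q\<close>
  below the same factor of their join, and this factor is the join itself.\<close>

lemma join_connected:
  assumes p: "p \<in> G" and q: "q \<in> G" and a: "a \<noteq> bt" "a \<preceq> p" "a \<preceq> q"
  shows "J {p, q} \<in> G"
proof -
  let ?x = "J {p, q}"
  have pq: "p \<preceq> ?x" "q \<preceq> ?x" using J_upper[of "{p, q}"] p q GC by blast+
  have x: "?x \<in> C" using pq lqD by blast
  have xb: "?x \<noteq> bt" using pq p botG bt_lq lq_antisym lqD by metis
  obtain \<psi> where
    \<psi>: "\<And>v g. v \<preceq> ?x \<Longrightarrow> g \<in> maximal_below L G ?x \<Longrightarrow> \<psi> v g \<preceq> g"
    "\<And>v w. v \<preceq> ?x \<Longrightarrow> w \<preceq> ?x \<Longrightarrow> v \<preceq> w \<longleftrightarrow> (\<forall>g\<in>maximal_below L G ?x. \<psi> v g \<preceq> \<psi> w g)"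
    "\<And>g h. g \<in> maximal_below L G ?x \<Longrightarrow> h \<in> maximal_below L G ?x \<Longrightarrow> \<psi> g h = (if h = g then g else bt)"
    "\<And>t. (\<And>g. g \<in> maximal_below L G ?x \<Longrightarrow> t g \<preceq> g) \<Longrightarrow> \<exists>v. v \<preceq> ?x \<and> (\<forall>g\<in>maximal_below L G ?x. \<psi> v g = t g)"
    by (rule factor_iso[OF x xb]) blast
  obtain r s where r: "r \<in> maximal_below L G ?x" "p \<preceq> r" and s: "s \<in> maximal_below L G ?x" "q \<preceq> s"
    using ex_factor[OF p pq(1)] ex_factor[OF q pq(2)] by blast
  have rG: "r \<in> G" "r \<preceq> ?x" "s \<preceq> ?x" using r s GC x unfolding maximal_below_def lq_def by auto
  have ar: "a \<preceq> r" "a \<preceq> s" "a \<preceq> ?x" using a r s pq lq_trans by blast+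
  have "r = s"
  proof (rule ccontr)
    assume "r \<noteq> s"
    have "\<psi> a g \<preceq> \<psi> bt g" if g: "g \<in> maximal_below L G ?x" for g
    proof -
      have "\<psi> a g \<preceq> \<psi> r g" "\<psi> a g \<preceq> \<psi> s g" using \<psi>(2) ar rG g by blast+
      moreover have "\<psi> r g = bt \<or> \<psi> s g = bt" using \<psi>(3)[OF r(1) g] \<psi>(3)[OF s(1) g] \<open>r \<noteq> s\<close> by auto
      ultimately have "\<psi> a g \<preceq> bt" by auto
      then show ?thesis using \<psi>(1)[OF bt_lq[OF x] g] bt_lq lq_trans lqD by metis
    qed
    then have "a \<preceq> bt" using \<psi>(2) ar(3) bt_lq[OF x] by blast
    then show False using a(1) bt_lq lq_antisym lqD by metis
  qed
  then have "?x \<preceq> r" using r s by (intro J_leqI) (auto dest: lqD)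
  then show ?thesis using rG lq_antisym by metis
qed

text \<open>Some factor \<open>r\<close> of \<open>J U\<close> lies above \<open>q\<close>. The
  elements of \<open>U\<close> below \<open>r\<close> already have the join \<open>r\<close>, since
  every other element of \<open>U\<close> lies below another factor and has bottom coordinate at
  \<open>r\<close>.\<close>

lemma building_cover:
  assumes U: "U \<subseteq> G" and q: "q \<in> G" "q \<preceq> J U"
  shows "\<exists>V\<subseteq>U. J V \<in> G \<and> q \<preceq> J V"
proof -
  let ?x = "J U"
  have UC: "U \<subseteq> C" using U GC by blast
  have x: "?x \<in> C" using q lqD by blast
  have xb: "?x \<noteq> bt" using q botG bt_lq lq_antisym lqD by metis
  obtain \<psi> where
    \<psi>: "\<And>v g. v \<preceq> ?x \<Longrightarrow> g \<in> maximal_below L G ?x \<Longrightarrow> \<psi> v g \<preceq> g"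
    "\<And>v w. v \<preceq> ?x \<Longrightarrow> w \<preceq> ?x \<Longrightarrow> v \<preceq> w \<longleftrightarrow> (\<forall>g\<in>maximal_below L G ?x. \<psi> v g \<preceq> \<psi> w g)"
    "\<And>g h. g \<in> maximal_below L G ?x \<Longrightarrow> h \<in> maximal_below L G ?x \<Longrightarrow> \<psi> g h = (if h = g then g else bt)"
    "\<And>t. (\<And>g. g \<in> maximal_below L G ?x \<Longrightarrow> t g \<preceq> g) \<Longrightarrow> \<exists>v. v \<preceq> ?x \<and> (\<forall>g\<in>maximal_below L G ?x. \<psi> v g = t g)"
    by (rule factor_iso[OF x xb]) blast
  obtain r where r: "r \<in> maximal_below L G ?x" "q \<preceq> r" using ex_factor[OF q] by blast
  have rG: "r \<in> G" "r \<preceq> ?x" using r GC x unfolding maximal_below_def lq_def by auto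
  define V where "V = {u \<in> U. u \<preceq> r}"
  have VC: "V \<subseteq> C" using UC by (auto simp: V_def)
  define j where "j = J V"
  have jr: "j \<preceq> r" unfolding j_def by (rule J_leqI) (use rG lqD in \<open>auto simp: V_def\<close>)
  have jx: "j \<preceq> ?x" using jr rG lq_trans by blast
  \<comment> \<open>The coordinates of an element that is full at every factor except
    \<open>r\<close>, where it only reaches \<open>j\<close>. It turns out to lie above all of
    \<open>U\<close>, so it equals \<open>J U\<close> and \<open>j\<close> must fill
    \<open>r\<close>.\<close>
  define t where "t g = (if g = r then \<psi> j r else g)" for g
  have "t g \<preceq> g" if g: "g \<in> maximal_below L G ?x" for g
    using \<psi>(1)[OF jx g] lq_refl g GC unfolding t_def maximal_below_def by auto
  then obtain v where v: "v \<preceq> ?x" "\<And>g. g \<in> maximal_below L G ?x \<Longrightarrow> \<psi> v g = t g" using \<psi>(4) by metis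
  have "u \<preceq> v" if u: "u \<in> U" for u
  proof -
    have ux: "u \<preceq> ?x" using J_upper[OF UC u] .
    obtain s where s: "s \<in> maximal_below L G ?x" "u \<preceq> s" using ex_factor[of u] u U ux by blast
    have sx: "s \<preceq> ?x" using s GC x unfolding maximal_below_def lq_def by auto
    have "\<psi> u g \<preceq> \<psi> v g" if g: "g \<in> maximal_below L G ?x" for g
    proof (cases "g = r")
      case True
      have *: "\<psi> u r \<preceq> \<psi> j r"
      proof (cases "s = r")
        case True
        then have "u \<in> V" using u s by (simp add: V_def)
        then have "u \<preceq> j" unfolding j_def by (rule J_upper[OF VC])
        then show ?thesis using \<psi>(2)[OF ux jx] r by blast
      next
        case False
        have "\<psi> u r \<preceq> \<psi> s r" using \<psi>(2)[OF ux sx] s r by blast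
        then have "\<psi> u r \<preceq> bt" using \<psi>(3)[OF s(1) r(1)] False by auto
        then show ?thesis using \<psi>(1)[OF jx r(1)] bt_lq lq_trans lqD by metis
      qed
      then show ?thesis using True v(2)[OF g] by (simp add: t_def)
    next
      case False
      then show ?thesis using \<psi>(1)[OF ux g] v(2)[OF g] by (simp add: t_def)
    qed
    then show ?thesis using \<psi>(2)[OF ux v(1)] by blast
  qed
  then have xv: "?x \<preceq> v" by (intro J_leqI) (use v lqD in auto)
  then have "v = ?x" using v lq_antisym by blast
  have "r \<preceq> j"
  proof -
    have "\<psi> r g \<preceq> \<psi> j g" if g: "g \<in> maximal_below L G ?x" for g
    proof (cases "g = r")
      case True
      have "\<psi> r r \<preceq> \<psi> v r" using \<psi>(2) rG(2) r \<open>v = ?x\<close> lq_refl[OF x] by metis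
      then show ?thesis using v(2)[OF r(1)] True by (simp add: t_def)
    next
      case False
      then have "\<psi> r g = bt" using \<psi>(3)[OF r(1) g] by auto
      then show ?thesis using \<psi>(1)[OF jx g] bt_lq lqD by metis
    qed
    then show ?thesis using \<psi>(2)[OF rG(2) jx] by blast
  qed
  then have "j = r" using jr lq_antisym by blast
  then show ?thesis using rG r by (intro exI[of _ V]) (auto simp: V_def j_def)
qed

text \<open>Whatever \<open>y\<close> shares with \<open>h\<close> it also shares with every larger
  join, so the elements of \<open>Y\<close> can be joined to \<open>h\<close> one after the
  other.\<close>

lemma J_connected:
  assumes "finite Y" "Y \<subseteq> G" "h \<in> G" "\<And>y. y \<in> Y \<Longrightarrow> \<exists>a. a \<noteq> bt \<and> a \<preceq> y \<and> a \<preceq> h"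
  shows "J (insert h Y) \<in> G"
  using assms
proof (induction Y rule: finite_induct)
  case empty
  then show ?case using J_singleton GC by auto
next
  case (insert y Y)
  have IH: "J (insert h Y) \<in> G" using insert by auto
  have C: "insert h Y \<subseteq> C" "y \<in> C" "insert h (insert y Y) \<subseteq> C" using insert GC by auto
  obtain a where a: "a \<noteq> bt" "a \<preceq> y" "a \<preceq> h" using insert by blast
  have hJ: "h \<preceq> J (insert h Y)" using J_upper[OF C(1)] by blast
  have "J {J (insert h Y), y} \<in> G"
    by (rule join_connected[OF IH _ a(1)]) (use insert a lq_trans[OF a(3) hJ] in auto)
  also have "J {J (insert h Y), y} = J (insert h (insert y Y))"
  proof (rule J_eqI)
    fix u assume "u \<in> {J (insert h Y), y}"
    then show "u \<preceq> J (insert h (insert y Y))"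
      using J_mono[OF C(3), of "insert h Y"] J_upper[OF C(3), of y] by auto
  next
    have D: "{J (insert h Y), y} \<subseteq> C" using C J_closed by auto
    show "J (insert h (insert y Y)) \<preceq> J {J (insert h Y), y}"
    proof (rule J_leqI[OF J_closed[OF D]])
      fix u assume "u \<in> insert h (insert y Y)"
      then show "u \<preceq> J {J (insert h Y), y}"
        using J_upper[OF D] J_upper[OF C(1)] lq_trans by blast
    qed
  qed
  finally show ?case .
qed

end

section \<open>The combinatorics of iterated blowups\<close>

text \<open>The nested pairs created by successive blowups, with the outermost label, that of the
  latest blowup, in front.\<close>

fun enc :: "'a list \<Rightarrow> 'a \<Rightarrow> 'a blow" where
  "enc [] x = Orig x"
| "enc (p # l) x = Exc (Orig p) (enc l x)"

lemma enc_inj: "enc l x = enc l' x' \<longleftrightarrow> l = l' \<and> x = x'"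
proof (induction l arbitrary: l')
  case Nil
  then show ?case by (cases l') auto
next
  case (Cons p l)
  then show ?case by (cases l') auto
qed

text \<open>The list holds the blown-up elements, the last one first; the set selects those that
  occur as exceptional labels.\<close>

definition exc :: "'a list \<Rightarrow> 'a set \<Rightarrow> 'a \<Rightarrow> 'a blow" where
  "exc qs S x = enc (filter (\<lambda>p. p \<in> S) qs) x"

lemma exc_inj: "S \<subseteq> set qs \<Longrightarrow> S' \<subseteq> set qs \<Longrightarrow> exc qs S x = exc qs S' x' \<longleftrightarrow> S = S' \<and> x = x'"
proof
  assume S: "S \<subseteq> set qs" "S' \<subseteq> set qs" and "exc qs S x = exc qs S' x'"
  then have f: "filter (\<lambda>p. p \<in> S) qs = filter (\<lambda>p. p \<in> S') qs" "x = x'"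
    by (simp_all add: exc_def enc_inj)
  have "set (filter (\<lambda>p. p \<in> S) qs) = S" "set (filter (\<lambda>p. p \<in> S') qs) = S'" using S by auto
  then show "S = S' \<and> x = x'" using f by simp
qed simp

lemma exc_empty: "exc qs {} x = Orig x"
  by (simp add: exc_def)

lemma exc_Cons_notin: "p \<notin> S \<Longrightarrow> exc (p # qs) S x = exc qs S x"
  by (simp add: exc_def)

lemma exc_Cons_in:
  assumes "p \<notin> set qs"
  shows "exc (p # qs) (insert p S) x = Exc (Orig p) (exc qs S x)"
proof -
  have "filter (\<lambda>q. q \<in> insert p S) qs = filter (\<lambda>q. q \<in> S) qs"
    by (rule filter_cong) (use assms in auto)
  then show ?thesis by (simp add: exc_def)
qed

lemma exc_singleton:
  assumes "distinct qs" "g \<in> set qs"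
  shows "exc qs {g} x = Exc (Orig g) (Orig x)"
proof -
  have "filter (\<lambda>p. p \<in> {g}) qs = [g]" using assms
  proof (induction qs)
    case (Cons q qs)
    then show ?case by (cases "q = g") (auto simp: filter_empty_conv)
  qed simp
  then show ?thesis by (simp add: exc_def)
qed

text \<open>Keeps the old elements and the new pairs of the blowup at \<open>p\<close> apart, as all
  labels present so far come from \<open>qs\<close>.\<close>

lemma exc_neq_Exc:
  assumes "p \<notin> set qs"
  shows "exc qs S x \<noteq> Exc (Orig p) w"
proof
  assume eq: "exc qs S x = Exc (Orig p) w"
  show False
  proof (cases "filter (\<lambda>p. p \<in> S) qs")
    case (Cons q l)
    then have "q \<in> set (filter (\<lambda>p. p \<in> S) qs)" by simp
    then have "q \<in> set qs" by simp
    then show False using eq Cons assms by (simp add: exc_def)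
  qed (use eq in \<open>simp add: exc_def\<close>)
qed

context geom
begin

text \<open>Passing to the maximal elements of a set keeps its join, and an antichain of at least
  two elements never contains its join. So the condition on antichains amounts to one on all
  nonempty subsets. The poset \<open>M\<close> is kept general because the criterion serves for
  \<open>L\<close> and for the local intervals.\<close>

lemma nested_crit:
  assumes le: "\<And>x y. x \<in> S \<Longrightarrow> y \<in> S \<Longrightarrow> x \<sqsubseteq>\<^bsub>M\<^esub> y \<longleftrightarrow> x \<preceq> y" and S: "S \<subseteq> C"
    and sup: "\<And>U. U \<subseteq> S \<Longrightarrow> U \<noteq> {} \<Longrightarrow> \<Squnion>\<^bsub>M\<^esub>U = J U"
  shows "S \<in> nested_sets M K \<longleftrightarrow> S \<subseteq> K \<and> (\<forall>U\<subseteq>S. U \<noteq> {} \<longrightarrow> J U \<in> K \<longrightarrow> J U \<in> U)"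
proof
  assume n: "S \<in> nested_sets M K"
  have "J U \<in> U" if U: "U \<subseteq> S" "U \<noteq> {}" "J U \<in> K" for U
  proof -
    have UC: "U \<subseteq> C" using U S by blast
    define T where "T = {u \<in> U. \<forall>v\<in>U. u \<preceq> v \<longrightarrow> v = u}"
    have TU: "T \<subseteq> U" by (auto simp: T_def)
    have above: "\<exists>t\<in>T. u \<preceq> t" if "u \<in> U" for u
      using ex_maximal[OF UC that] unfolding T_def by blast
    have "J T = J U"
    proof (rule J_eqI)
      show "t \<preceq> J U" if "t \<in> T" for t using J_upper[OF UC] that TU by blast
      have TC: "T \<subseteq> C" using TU UC by blast
      show "J U \<preceq> J T"
      proof (rule J_leqI[OF J_closed[OF TC]])
        fix u assume "u \<in> U"
        then obtain t where "t \<in> T" "u \<preceq> t" using above by blast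
        then show "u \<preceq> J T" using J_upper[OF TC] lq_trans by blast
      qed
    qed
    have ne: "T \<noteq> {}" using above U(2) by blast
    have anti: "\<not> a \<sqsubseteq>\<^bsub>M\<^esub> b" if "a \<in> T" "b \<in> T" "a \<noteq> b" for a b
      using that le[of a b] TU U(1) unfolding T_def by blast
    have fin: "finite T" using finS TU UC by blast
    have "\<not> 2 \<le> card T"
    proof
      assume "2 \<le> card T"
      then have "\<Squnion>\<^bsub>M\<^esub>T \<notin> K" using n anti TU U(1) unfolding nested_sets_def by blast
      then show False using sup[of T] TU U ne \<open>J T = J U\<close> by auto
    qed
    then have "card T = 1" using fin ne by (metis One_nat_def Suc_leI card_gt_0_iff le_antisym not_less_eq_eq numeral_2_eq_2)
    then obtain t where t: "T = {t}" by (auto simp: card_1_singleton_iff)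
    then have "J T = t" using J_singleton TU UC by blast
    then show ?thesis using t TU \<open>J T = J U\<close> by auto
  qed
  then show "S \<subseteq> K \<and> (\<forall>U\<subseteq>S. U \<noteq> {} \<longrightarrow> J U \<in> K \<longrightarrow> J U \<in> U)"
    using n by (auto simp: nested_sets_def)
next
  assume n: "S \<subseteq> K \<and> (\<forall>U\<subseteq>S. U \<noteq> {} \<longrightarrow> J U \<in> K \<longrightarrow> J U \<in> U)"
  have "\<Squnion>\<^bsub>M\<^esub>T \<notin> K" if T: "T \<subseteq> S" "2 \<le> card T" "\<forall>a\<in>T. \<forall>b\<in>T. a \<noteq> b \<longrightarrow> \<not> a \<sqsubseteq>\<^bsub>M\<^esub> b" for T
  proof
    assume K: "\<Squnion>\<^bsub>M\<^esub>T \<in> K"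
    have TC: "T \<subseteq> C" using T S by blast
    have ne: "T \<noteq> {}" using T(2) by auto
    have j: "J T \<in> T" using n T(1) ne K sup[OF T(1) ne] by auto
    have "T \<noteq> {J T}" using T(2) by (metis card.empty card.insert empty_iff finite.emptyI numeral_2_eq_2 not_less_eq_eq order_refl)
    then obtain t where "t \<in> T" "t \<noteq> J T" using j by blast
    moreover from this have "t \<preceq> J T" using J_upper[OF TC] by blast
    ultimately show False using T(1,3) j le by blast
  qed
  then show "S \<in> nested_sets M K" using n by (auto simp: nested_sets_def)
qed

lemma bt_notin_H: "bt \<notin> H"
  using HG botG by blast

text \<open>A join that is an atom equals each of the nonzero elements joined, so only joins outside
  the atoms impose a condition. The empty join is the bottom, which is not in
  \<open>H\<close>.\<close>

lemma nested_H: "S \<in> nested_sets L H \<longleftrightarrow> S \<subseteq> H \<and> (\<forall>U\<subseteq>S. J U \<in> Ho \<longrightarrow> J U \<in> U)"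
proof -
  have "(\<forall>U\<subseteq>S. U \<noteq> {} \<longrightarrow> J U \<in> H \<longrightarrow> J U \<in> U) \<longleftrightarrow> (\<forall>U\<subseteq>S. J U \<in> Ho \<longrightarrow> J U \<in> U)"
    if S: "S \<subseteq> H"
  proof (intro iffI allI impI)
    fix U assume *: "\<forall>U\<subseteq>S. U \<noteq> {} \<longrightarrow> J U \<in> H \<longrightarrow> J U \<in> U" and U: "U \<subseteq> S" "J U \<in> Ho"
    have "U \<noteq> {}" using U(2) bt_notin_H by auto
    then show "J U \<in> U" using * U by blast
  next
    fix U assume *: "\<forall>U\<subseteq>S. J U \<in> Ho \<longrightarrow> J U \<in> U" and U: "U \<subseteq> S" "U \<noteq> {}" "J U \<in> H"
    show "J U \<in> U"
    proof (cases "J U \<in> ats")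
      case True
      obtain u where u: "u \<in> U" using U by blast
      have "U \<subseteq> C" using U S HC by blast
      then have "u \<preceq> J U" using J_upper u by blast
      moreover have "u \<noteq> bt" using u U S bt_notin_H by blast
      ultimately have "u = J U" using True atomD(3) by blast
      then show ?thesis using u by simp
    qed (use * U in blast)
  qed
  moreover have "S \<in> nested_sets L H \<longleftrightarrow> S \<subseteq> H \<and> (\<forall>U\<subseteq>S. U \<noteq> {} \<longrightarrow> J U \<in> H \<longrightarrow> J U \<in> U)"
    if S: "S \<subseteq> H"
  proof (rule nested_crit)
    show "S \<subseteq> C" using S HC by blast
    then show "x \<sqsubseteq>\<^bsub>L\<^esub> y \<longleftrightarrow> x \<preceq> y" if "x \<in> S" "y \<in> S" for x y using lq_iff that by blast
  qed (simp add: J_def)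
  moreover have "S \<subseteq> H" if "S \<in> nested_sets L H" using that by (simp add: nested_sets_def)
  ultimately show ?thesis by blast
qed

section \<open>Normal form of the elements of an iterated blowup\<close>

definition nest where "nest K S x \<longleftrightarrow> (\<forall>U \<subseteq> S \<union> At x. J U \<in> K \<longrightarrow> J U \<in> U)"
text \<open>A pair of exceptional labels \<open>S\<close> and an element \<open>x\<close> of
  \<open>L\<close> names an element of the blowup if \<open>S\<close> and the atoms below
  \<open>x\<close> are nested with respect to the elements blown up so far. In particular
  \<open>x\<close> is above none of these: as a non-atom, it would be a join of atoms of
  \<open>x\<close> without being one of them.\<close>

definition valid where "valid qs S x \<longleftrightarrow> S \<subseteq> set qs \<and> x \<in> C \<and> nest (set qs) S x"

text \<open>The invariant that every blowup preserves: nested pairs flatten into a set of labels and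
  one element of \<open>L\<close>, and the order becomes componentwise.\<close>

definition blown where
  "blown P qs \<longleftrightarrow> carrier P = {exc qs S x | S x. valid qs S x} \<and>
     (\<forall>S x S' x'. valid qs S x \<longrightarrow> valid qs S' x' \<longrightarrow>
        (exc qs S x \<sqsubseteq>\<^bsub>P\<^esub> exc qs S' x' \<longleftrightarrow> S \<subseteq> S' \<and> x \<preceq> x'))"

lemma At_mono: "x \<preceq> y \<Longrightarrow> At x \<subseteq> At y"
  unfolding At_def using lq_trans by blast

lemma nest_mono: "nest K S' x' \<Longrightarrow> S \<subseteq> S' \<Longrightarrow> x \<preceq> x' \<Longrightarrow> nest K S x"
  unfolding nest_def using At_mono[of x x'] by blast

lemma valid_mono: "valid qs S' x' \<Longrightarrow> S \<subseteq> S' \<Longrightarrow> x \<preceq> x' \<Longrightarrow> valid qs S x"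
  unfolding valid_def using nest_mono lqD by blast

text \<open>Blowing up \<open>p\<close> after the elements of \<open>K\<close>.\<close>

context
  fixes K p
  assumes K: "K \<subseteq> Ho" and p: "p \<in> Ho" "p \<notin> K" and Kp': "\<forall>k\<in>K. \<not> k \<preceq> p"
    and upK': "\<forall>k\<in>K. \<forall>g\<in>G. k \<preceq> g \<longrightarrow> g \<in> K"
    and upp': "\<forall>g\<in>G. p \<preceq> g \<longrightarrow> g = p \<or> g \<in> K"
begin

lemmas Kp = Kp'[rule_format] and upK = upK'[rule_format] and upp = upp'[rule_format]

lemma blow_C: "p \<in> C" "p \<in> G" "K \<subseteq> C" "K \<subseteq> G" "p \<notin> ats"
  using K p HG HC by blast+

text \<open>As \<open>p\<close> is the join of the atoms below it, \<open>p\<close> below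
  \<open>x\<close> violates nestedness. Conversely no label lies below \<open>p\<close>, so a set
  with join \<open>p\<close> would consist of atoms of \<open>x\<close>.\<close>

lemma nest_insert_iff:
  assumes S: "S \<subseteq> K" and x: "x \<in> C" and n: "nest K S x"
  shows "nest (insert p K) S x \<longleftrightarrow> \<not> p \<preceq> x"
proof
  assume n': "nest (insert p K) S x"
  show "\<not> p \<preceq> x"
  proof
    assume "p \<preceq> x"
    then have "At p \<subseteq> S \<union> At x" using At_mono by blast
    moreover have "J (At p) = p" using J_At blow_C by blast
    ultimately have "p \<in> At p" using n' unfolding nest_def by (metis insertI1)
    then show False using blow_C by (auto simp: At_def)
  qed
next
  assume px: "\<not> p \<preceq> x"
  have "J U \<noteq> p" if U: "U \<subseteq> S \<union> At x" for U
  proof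
    assume JU: "J U = p"
    have UC: "U \<subseteq> C" using U S blow_C At_C by blast
    have "U \<subseteq> At x"
    proof
      fix u assume u: "u \<in> U"
      then have "u \<preceq> p" using J_upper[OF UC] JU by metis
      then have "u \<notin> K" using Kp by blast
      then show "u \<in> At x" using u U S by blast
    qed
    then have "J U \<preceq> x" by (intro J_leqI x) (auto simp: At_def)
    then show False using JU px by simp
  qed
  then show "nest (insert p K) S x" using n unfolding nest_def by blast
qed

text \<open>The left side will mean that \<open>p\<close> has a join with the element given by
  \<open>S\<close> and \<open>x\<close>, the right side that the pair over this element is a valid
  new one. From left to right, \<open>p\<close> is replaced by its atoms. From right to left, every
  atom below the join of \<open>x\<close> and \<open>p\<close> is below one of the two, so nothing
  unexpected enters.\<close>

lemma nest_link_iff: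
  assumes S: "S \<subseteq> K" and x: "x \<in> C" and n: "nest K S x" and px: "\<not> p \<preceq> x"
  shows "nest K S (J {x, p}) \<longleftrightarrow> nest (insert p K) (insert p S) x"
proof
  have D: "{x, p} \<subseteq> C" using x blow_C by blast
  have xD: "x \<preceq> J {x, p}" "p \<preceq> J {x, p}" using J_upper[OF D] by blast+
  have SC: "S \<subseteq> C" "S \<subseteq> G" using S blow_C by blast+
  {
    assume n': "nest (insert p K) (insert p S) x"
    \<comment> \<open>Cover \<open>a\<close> by a join in \<open>G\<close> of some atoms of
      \<open>x\<close> and possibly \<open>p\<close>. If \<open>p\<close> takes part, the join lies
      in \<open>insert p K\<close> by upward closedness, and nestedness makes it \<open>p\<close> or
      an atom of \<open>x\<close>.\<close>
    have at: "a \<preceq> p \<or> a \<preceq> x" if a: "a \<in> At (J {x, p})" for a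
    proof -
      have aG: "a \<in> G" "a \<preceq> J {x, p}" using a atH HG by (auto simp: At_def)
      let ?U = "insert p (At x)"
      have UG: "?U \<subseteq> G" using blow_C atH HG by (auto simp: At_def)
      have UC: "?U \<subseteq> C" using UG GC by blast
      have "x \<preceq> J ?U" using J_mono[OF UC, of "At x"] J_At[OF x] by auto
      moreover have "p \<preceq> J ?U" using J_upper[OF UC] by blast
      ultimately have "J {x, p} \<preceq> J ?U" by (intro J_leqI J_closed[OF UC]) auto
      then have "a \<preceq> J ?U" using aG lq_trans by blast
      then obtain V where V: "V \<subseteq> ?U" "J V \<in> G" "a \<preceq> J V" using building_cover[OF UG aG(1)] by blast
      show ?thesis
      proof (cases "p \<in> V")
        case True
        have "V \<subseteq> C" using V UC by blast
        then have "p \<preceq> J V" using J_upper True by blast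
        then have "J V \<in> insert p K" using upp V by blast
        then have "J V \<in> V" using n' V(1) unfolding nest_def by blast
        then have "J V = p \<or> J V \<preceq> x" using V(1) by (auto simp: At_def)
        then show ?thesis using V(3) lq_trans by metis
      next
        case False
        then have "J V \<preceq> x" using V(1) by (intro J_leqI x) (auto simp: At_def)
        then show ?thesis using V(3) lq_trans by blast
      qed
    qed
    show "nest K S (J {x, p})"
      unfolding nest_def
    proof (intro allI impI, rule ccontr)
      fix U assume U: "U \<subseteq> S \<union> At (J {x, p})" and h: "J U \<in> K" "J U \<notin> U"
      have UC: "U \<subseteq> C" using U SC At_C by blast
      have "\<not> U \<subseteq> S \<union> At x" using n h unfolding nest_def by blast
      then obtain a where a: "a \<in> U" "a \<notin> S" "a \<notin> At x" by blast
      have aat: "a \<in> ats" "a \<in> At (J {x, p})" using a U by (auto simp: At_def)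
      then have ap: "a \<preceq> p" using at a by (auto simp: At_def)
      have ah: "a \<preceq> J U" using J_upper[OF UC] a by blast
      \<comment> \<open>Enlarging the offending join by \<open>p\<close> keeps it in
        \<open>G\<close>, because the atom \<open>a\<close> lies below both; upward closedness then
        keeps it in \<open>K\<close>.\<close>
      let ?h = "J {J U, p}"
      have hG: "J U \<in> G" using h blow_C by blast
      have hp: "{J U, p} \<subseteq> C" using hG blow_C GC by blast
      have le: "J U \<preceq> ?h" "p \<preceq> ?h" using J_upper[OF hp] by blast+
      have "?h \<in> G" by (rule join_connected[OF hG blow_C(2) atomD(2)[OF aat(1)] ah ap])
      then have hK: "?h \<in> K" using upK[OF h(1)] le by blast
      let ?U = "insert p (U \<inter> (S \<union> At x))"
      have U'C: "?U \<subseteq> C" using UC blow_C by blast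
      have "J ?U = ?h"
      proof (rule J_eqI)
        fix u assume "u \<in> ?U"
        then show "u \<preceq> ?h" using le J_upper[OF UC] lq_trans by blast
      next
        have pU: "p \<preceq> J ?U" using J_upper[OF U'C] by blast
        have "J U \<preceq> J ?U"
        proof (rule J_leqI[OF J_closed[OF U'C]])
          fix u assume u: "u \<in> U"
          show "u \<preceq> J ?U"
          proof (cases "u \<in> S \<union> At x")
            case True
            then show ?thesis using u J_upper[OF U'C] by blast
          next
            case False
            then have "u \<in> At (J {x, p})" using u U by blast
            then have "u \<preceq> p" using at[of u] False by (auto simp: At_def)
            then show ?thesis using pU lq_trans by blast
          qed
        qed
        then show "?h \<preceq> J ?U" using pU by (intro J_leqI J_closed[OF U'C]) auto
      qed
      moreover have "?U \<subseteq> insert p S \<union> At x" by blast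
      ultimately have "?h \<in> ?U" using n' hK unfolding nest_def by (metis insertI2)
      then consider "?h = p" | "?h \<in> U" by blast
      then show False
      proof cases
        case 1
        then show False using le(1) Kp[OF h(1)] by simp
      next
        case 2
        then have "?h \<preceq> J U" using J_upper[OF UC] by blast
        then have "?h = J U" using le lq_antisym by blast
        then show False using 2 h by simp
      qed
    qed
  next
    assume n': "nest K S (J {x, p})"
    show "nest (insert p K) (insert p S) x"
      unfolding nest_def
    proof (intro allI impI)
      fix U assume U: "U \<subseteq> insert p S \<union> At x" and h: "J U \<in> insert p K"
      show "J U \<in> U"
      proof (cases "p \<in> U")
        case False
        then have "U \<subseteq> S \<union> At x" using U by blast
        then show ?thesis using h nest_insert_iff[OF S x n] px unfolding nest_def by blast
      next
        case True
        show ?thesis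
        proof (cases "J U = p")
          case False
          then have hK: "J U \<in> K" using h by blast
          have UC: "U \<subseteq> C" using U SC At_C blow_C by blast
          let ?U = "(U - {p}) \<union> At p"
          have U': "?U \<subseteq> S \<union> At (J {x, p})" using U At_mono[OF xD(1)] At_mono[OF xD(2)] by blast
          have U'C: "?U \<subseteq> C" using UC At_C by blast
          have "J ?U = J U"
          proof (rule J_eqI)
            fix u assume "u \<in> ?U"
            then consider "u \<in> U" | "u \<preceq> p" by (auto simp: At_def)
            then show "u \<preceq> J U"
              using J_upper[OF UC] True lq_trans by cases blast+
          next
            have "J (At p) \<preceq> J ?U" by (rule J_mono[OF U'C]) blast
            then have "p \<preceq> J ?U" using J_At blow_C by simp
            then show "J U \<preceq> J ?U" using J_upper[OF U'C] by (intro J_leqI J_closed[OF U'C]) auto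
          qed
          then have "J U \<in> ?U" using n' U' hK unfolding nest_def by metis
          moreover have "J U \<notin> At p" using hK K by (auto simp: At_def)
          ultimately show ?thesis by blast
        qed (use True in simp)
      qed
    qed
  }
qed

end

text \<open>The label sets of the blowup split by whether they contain \<open>p\<close>: those
  without it are the old elements not above \<open>p\<close>, those with it are the pairs over the
  link of \<open>p\<close>. \<open>V1\<close> and \<open>V2\<close> translate both cases into
  validity.\<close>

lemma blown_step:
  assumes bl: "blown P qs" and K: "set qs \<subseteq> Ho" and p: "p \<in> Ho" "p \<notin> set qs"
    and Kp: "\<forall>k\<in>set qs. \<not> k \<preceq> p"
    and upK: "\<forall>k\<in>set qs. \<forall>g\<in>G. k \<preceq> g \<longrightarrow> g \<in> set qs"
    and upp: "\<forall>g\<in>G. p \<preceq> g \<longrightarrow> g = p \<or> g \<in> set qs"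
  shows "blown (blowup P (Orig p)) (p # qs)"
proof -
  let ?p = "Orig p" and ?B = "blowup P (Orig p)"
  note ctx = K p Kp upK upp
  have pC: "p \<in> C" "p \<in> G" using p HG HC by blast+
  have car: "carrier P = {exc qs S x | S x. valid qs S x}" using bl by (simp add: blown_def)
  have le: "exc qs S x \<sqsubseteq>\<^bsub>P\<^esub> exc qs S' x' \<longleftrightarrow> S \<subseteq> S' \<and> x \<preceq> x'"
    if "valid qs S x" "valid qs S' x'" for S x S' x' using bl that unfolding blown_def by blast
  have inj: "exc qs S x = exc qs S' x' \<longleftrightarrow> S = S' \<and> x = x'"
    if "valid qs S x" "valid qs S' x'" for S x S' x'
    using that exc_inj unfolding valid_def by metis
  \<comment> \<open>The element \<open>p\<close> is still present, with no labels, since nothing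
    blown up before lies below it.\<close>
  have vp: "valid qs {} p"
  proof -
    have "J U \<notin> set qs" if "U \<subseteq> {} \<union> At p" for U
    proof -
      have "J U \<preceq> p" using that by (intro J_leqI pC) (auto simp: At_def)
      then show ?thesis using Kp by blast
    qed
    then show ?thesis using pC by (auto simp: valid_def nest_def)
  qed
  have pexc: "?p = exc qs {} p" by (simp add: exc_empty)
  have ple: "?p \<sqsubseteq>\<^bsub>P\<^esub> exc qs S x \<longleftrightarrow> p \<preceq> x" if "valid qs S x" for S x
    unfolding pexc le[OF vp that] by simp
  have old: "u \<in> blow_old P ?p \<longleftrightarrow> (\<exists>S x. u = exc qs S x \<and> valid qs S x \<and> \<not> p \<preceq> x)" for u
    unfolding blow_old_def car using ple by blast
  have lub: "(\<exists>u. is_lub P u {?p, exc qs S x}) \<longleftrightarrow> valid qs S (J {x, p})" if v: "valid qs S x" for S x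
  proof
    have xC: "x \<in> C" using v by (simp add: valid_def)
    have D: "{x, p} \<subseteq> C" using xC pC by blast
    have cC: "exc qs S x \<in> carrier P" "?p \<in> carrier P" using v vp pexc unfolding car by blast+
    have ub: "exc qs S' x' \<in> Upper P {?p, exc qs S x} \<longleftrightarrow> S \<subseteq> S' \<and> x \<preceq> x' \<and> p \<preceq> x'"
      if v': "valid qs S' x'" for S' x'
    proof -
      have "exc qs S' x' \<in> carrier P" using v' unfolding car by blast
      then show ?thesis unfolding Upper_def using cC ple[OF v'] le[OF v v'] by auto
    qed
    {
      assume "\<exists>u. is_lub P u {?p, exc qs S x}"
      then obtain u where u: "u \<in> Upper P {?p, exc qs S x}" unfolding least_def by blast
      then have "u \<in> carrier P" by (auto simp: Upper_def)
      then obtain S' x' where u': "u = exc qs S' x'" "valid qs S' x'" unfolding car by blast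
      have "S \<subseteq> S'" "x \<preceq> x'" "p \<preceq> x'" using u ub[OF u'(2)] u'(1) by auto
      then have "J {x, p} \<preceq> x'" by (intro J_leqI) (auto dest: lqD)
      then show "valid qs S (J {x, p})" using valid_mono[OF u'(2) \<open>S \<subseteq> S'\<close>] by blast
    next
      assume v': "valid qs S (J {x, p})"
      have "is_lub P (exc qs S (J {x, p})) {?p, exc qs S x}"
        unfolding least_def
      proof (intro conjI ballI)
        show "Upper P {?p, exc qs S x} \<subseteq> carrier P" by (auto simp: Upper_def)
        show "exc qs S (J {x, p}) \<in> Upper P {?p, exc qs S x}"
          unfolding ub[OF v'] using J_upper[OF D] by blast
        fix u assume u: "u \<in> Upper P {?p, exc qs S x}"
        then have "u \<in> carrier P" by (auto simp: Upper_def)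
        then obtain S' x' where u': "u = exc qs S' x'" "valid qs S' x'" unfolding car by blast
        have *: "S \<subseteq> S'" "x \<preceq> x'" "p \<preceq> x'" using u ub[OF u'(2)] u'(1) by auto
        then have "J {x, p} \<preceq> x'" by (intro J_leqI) (auto dest: lqD)
        then show "exc qs S (J {x, p}) \<sqsubseteq>\<^bsub>P\<^esub> u" unfolding u'(1) le[OF v' u'(2)] using * by blast
      qed
      then show "\<exists>u. is_lub P u {?p, exc qs S x}" by blast
    }
  qed
  have link: "u \<in> blow_link P ?p \<longleftrightarrow>
      (\<exists>S x. u = exc qs S x \<and> valid qs S x \<and> \<not> p \<preceq> x \<and> valid qs S (J {x, p}))" for u
    unfolding blow_link_def car using ple lub by blast
  have V1: "valid (p # qs) S x \<longleftrightarrow> valid qs S x \<and> \<not> p \<preceq> x" if S: "S \<subseteq> set qs" for S x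
  proof -
    have "nest (set qs) S x" if "nest (insert p (set qs)) S x" using that unfolding nest_def by blast
    then show ?thesis
      using nest_insert_iff[OF ctx S, of x] S unfolding valid_def list.set by blast
  qed
  have V2: "valid (p # qs) (insert p S) x \<longleftrightarrow> valid qs S x \<and> \<not> p \<preceq> x \<and> valid qs S (J {x, p})"
    if S: "S \<subseteq> set qs" for S x
  proof -
    have "valid (p # qs) S x" if "valid (p # qs) (insert p S) x"
    proof -
      have "x \<in> C" using that by (simp add: valid_def)
      then show ?thesis using valid_mono[OF that _ lq_refl] by blast
    qed
    then have 1: "valid (p # qs) (insert p S) x \<Longrightarrow> valid qs S x \<and> \<not> p \<preceq> x" using V1[OF S] by blast
    have 2: "valid (p # qs) (insert p S) x \<longleftrightarrow> valid qs S (J {x, p})" if v: "valid qs S x" "\<not> p \<preceq> x"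
    proof -
      have "x \<in> C" "nest (set qs) S x" using v by (auto simp: valid_def)
      then have "nest (set qs) S (J {x, p}) \<longleftrightarrow> nest (insert p (set qs)) (insert p S) x"
        using nest_link_iff[OF ctx S _ _ v(2)] by blast
      moreover have "J {x, p} \<in> C" using J_closed[of "{x, p}"] \<open>x \<in> C\<close> pC by blast
      ultimately show ?thesis using \<open>x \<in> C\<close> S unfolding valid_def by auto
    qed
    show ?thesis using 1 2 by blast
  qed
  have split: "(\<exists>T\<subseteq>set qs. S = T) \<or> (\<exists>T\<subseteq>set qs. S = insert p T)" if "S \<subseteq> set (p # qs)" for S
  proof (cases "p \<in> S")
    case True
    then have "S = insert p (S - {p})" "S - {p} \<subseteq> set qs" using that by auto
    then show ?thesis by blast
  qed (use that in auto)
  have e1: "exc (p # qs) S x = exc qs S x" if "S \<subseteq> set qs" for S x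
    by (rule exc_Cons_notin) (use that p in blast)
  have e2: "exc (p # qs) (insert p S) x = Exc ?p (exc qs S x)" for S x
    by (rule exc_Cons_in[OF p(2)])
  have sub: "S \<subseteq> set qs" if "valid qs S x" for S x using that by (simp add: valid_def)
  have ne: "exc qs S x \<noteq> Exc ?p w" for S x w by (rule exc_neq_Exc[OF p(2)])
  have linkE: "exc qs S x \<in> blow_link P ?p \<longleftrightarrow> valid (p # qs) (insert p S) x" if "S \<subseteq> set qs" "valid qs S x" for S x
    unfolding link V2[OF that(1)] using inj that by metis
  have carB: "carrier ?B = {exc (p # qs) S x | S x. valid (p # qs) S x}"
  proof (intro equalityI subsetI)
    fix u assume "u \<in> carrier ?B"
    then consider "u \<in> blow_old P ?p" | w where "w \<in> blow_link P ?p" "u = Exc ?p w"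
      by (auto simp: blowup_def)
    then show "u \<in> {exc (p # qs) S x | S x. valid (p # qs) S x}"
    proof cases
      case 1
      then obtain S x where "u = exc qs S x" "valid qs S x" "\<not> p \<preceq> x" unfolding old by blast
      then show ?thesis using V1[OF sub] e1[OF sub] by (metis (mono_tags, lifting) mem_Collect_eq)
    next
      case 2
      then obtain S x where "w = exc qs S x" "valid qs S x" "\<not> p \<preceq> x" "valid qs S (J {x, p})"
        unfolding link by blast
      then show ?thesis using V2[OF sub] e2 2(2) by (metis (mono_tags, lifting) mem_Collect_eq)
    qed
  next
    fix u assume "u \<in> {exc (p # qs) S x | S x. valid (p # qs) S x}"
    then obtain S x where u: "u = exc (p # qs) S x" and v: "valid (p # qs) S x" by blast
    then have "S \<subseteq> set (p # qs)" by (simp add: valid_def)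
    from split[OF this] consider T where "T \<subseteq> set qs" "S = T" | T where "T \<subseteq> set qs" "S = insert p T" by blast
    then show "u \<in> carrier ?B"
    proof cases
      case 1
      then have "u \<in> blow_old P ?p" unfolding old using u v V1 e1 by metis
      then show ?thesis by (simp add: blowup_def)
    next
      case 2
      then have "exc qs T x \<in> blow_link P ?p" unfolding link using u v V2 by metis
      then show ?thesis unfolding u 2(2) e2 by (simp add: blowup_def)
    qed
  qed
  have leB: "u \<sqsubseteq>\<^bsub>?B\<^esub> v \<longleftrightarrow>
        (u \<in> blow_old P ?p \<and> v \<in> blow_old P ?p \<and> u \<sqsubseteq>\<^bsub>P\<^esub> v) \<or>
        (\<exists>x\<in>blow_link P ?p. \<exists>y\<in>blow_link P ?p. u = Exc ?p x \<and> v = Exc ?p y \<and> x \<sqsubseteq>\<^bsub>P\<^esub> y) \<or>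
        (u \<in> blow_old P ?p \<and> (\<exists>y\<in>blow_link P ?p. v = Exc ?p y \<and> u \<sqsubseteq>\<^bsub>P\<^esub> y))" for u v
    by (simp add: blowup_def)
  have "exc (p # qs) S x \<sqsubseteq>\<^bsub>?B\<^esub> exc (p # qs) S' x' \<longleftrightarrow> S \<subseteq> S' \<and> x \<preceq> x'"
    if v: "valid (p # qs) S x" and v': "valid (p # qs) S' x'" for S x S' x'
  proof -
    have noold: "Exc ?p w \<notin> blow_old P ?p" for w unfolding old using ne by metis
    define T T' where "T = S - {p}" and "T' = S' - {p}"
    have ts: "T \<subseteq> set qs" "T' \<subseteq> set qs" using v v' by (auto simp: valid_def T_def T'_def)
    have "S = T \<or> S = insert p T" "S' = T' \<or> S' = insert p T'" unfolding T_def T'_def by blast+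
    then consider (a) "S = T" "S' = T'" | (b) "S = T" "S' = insert p T'"
      | (c) "S = insert p T" "S' = T'" | (d) "S = insert p T" "S' = insert p T'" by blast
    then show ?thesis
    proof cases
      case a
      have w: "valid qs T x" "\<not> p \<preceq> x" "valid qs T' x'" "\<not> p \<preceq> x'"
        using v v' V1[OF ts(1)] V1[OF ts(2)] unfolding a by blast+
      have "exc qs T x \<in> blow_old P ?p" "exc qs T' x' \<in> blow_old P ?p" unfolding old using w by blast+
      then show ?thesis unfolding leB a e1[OF ts(1)] e1[OF ts(2)] using le[OF w(1,3)] by (simp add: ne)
    next
      case b
      have w: "valid qs T x" "\<not> p \<preceq> x" "valid qs T' x'"
        using v v' V1[OF ts(1)] V2[OF ts(2)] unfolding b by blast+
      have "exc qs T x \<in> blow_old P ?p" unfolding old using w by blast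
      moreover have "exc qs T' x' \<in> blow_link P ?p" using linkE[OF ts(2) w(3)] v' b by simp
      ultimately have "exc qs T x \<sqsubseteq>\<^bsub>?B\<^esub> Exc ?p (exc qs T' x') \<longleftrightarrow> T \<subseteq> T' \<and> x \<preceq> x'"
        unfolding leB using le[OF w(1,3)] by (auto simp: ne noold)
      then show ?thesis unfolding b e1[OF ts(1)] e2 using ts p(2) by blast
    next
      case c
      have "\<not> Exc ?p (exc qs T x) \<sqsubseteq>\<^bsub>?B\<^esub> exc qs T' x'" unfolding leB by (simp add: ne noold)
      then show ?thesis unfolding c e1[OF ts(2)] e2 using ts p(2) by blast
    next
      case d
      have w: "valid qs T x" "valid qs T' x'" using v v' V2[OF ts(1)] V2[OF ts(2)] unfolding d by blast+
      have "exc qs T x \<in> blow_link P ?p" "exc qs T' x' \<in> blow_link P ?p"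
        using linkE[OF ts(1) w(1)] linkE[OF ts(2) w(2)] v v' d by simp_all
      then have "Exc ?p (exc qs T x) \<sqsubseteq>\<^bsub>?B\<^esub> Exc ?p (exc qs T' x') \<longleftrightarrow> T \<subseteq> T' \<and> x \<preceq> x'"
        unfolding leB using le[OF w] by (auto simp: noold)
      moreover have "insert p T \<subseteq> insert p T' \<longleftrightarrow> T \<subseteq> T'" unfolding T_def T'_def by blast
      ultimately show ?thesis unfolding d e2 by simp
    qed
  qed
  then show ?thesis unfolding blown_def using carB by blast
qed

text \<open>Larger elements come first, so the elements already blown up are upward closed in
  \<open>G\<close> and none of them lies below the next one, as \<open>blown_step\<close> requires.
  The processed part appears reversed because new labels are put in front.\<close>

lemma blown_iter:
  assumes "blown P qs" "blowup_order L H (rev qs @ ps)"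
  shows "blown (iter_blowup P (map Orig ps)) (rev ps @ qs)"
  using assms
proof (induction ps arbitrary: P qs)
  case (Cons p ps)
  let ?l = "rev qs @ p # ps"
  have d: "distinct ?l" and s: "set ?l = Ho"
    and ord: "\<And>i j. i < length ?l \<Longrightarrow> j < length ?l \<Longrightarrow> ?l ! j \<sqsubseteq>\<^bsub>L\<^esub> ?l ! i \<Longrightarrow> i \<le> j"
    using Cons.prems(2) unfolding blowup_order_def by blast+
  have pi: "?l ! length qs = p" by (simp add: nth_append)
  have ki: "\<exists>i<length qs. ?l ! i = k" if "k \<in> set qs" for k
    using that in_set_conv_nth[of k "rev qs"] by (auto simp: nth_append)
  have ik: "?l ! i \<in> set qs" if "i < length qs" for i
    using that nth_mem[of i "rev qs"] by (simp add: nth_append)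
  have gi: "\<exists>j<length ?l. ?l ! j = g" if "g \<in> Ho" for g
    using that s in_set_conv_nth[of g ?l] by metis
  have pHo: "p \<in> Ho" "set qs \<subseteq> Ho" "p \<notin> set qs" using s d by auto
  have "blown (blowup P (Orig p)) (p # qs)"
  proof (rule blown_step[OF Cons.prems(1) pHo(2,1,3)]; intro ballI impI)
    fix k assume k: "k \<in> set qs"
    obtain i where i: "i < length qs" "?l ! i = k" using ki[OF k] by blast
    show "\<not> k \<preceq> p"
    proof
      assume "k \<preceq> p"
      then have "length qs \<le> i" using ord[of "length qs" i] pi i by (simp add: lq_def)
      then show False using i by simp
    qed
  next
    fix k g assume k: "k \<in> set qs" and g: "g \<in> G" "k \<preceq> g"
    obtain i where i: "i < length qs" "?l ! i = k" using ki[OF k] by blast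
    have "k \<in> Ho" using k pHo by blast
    then have "g \<in> Ho" using up g by blast
    then obtain j where j: "j < length ?l" "?l ! j = g" using gi by blast
    have "j \<le> i" using ord[of j i] i j g(2) by (simp add: lq_def)
    then show "g \<in> set qs" using ik[of j] i j by simp
  next
    fix g assume g: "g \<in> G" "p \<preceq> g"
    then have "g \<in> Ho" using up pHo by blast
    then obtain j where j: "j < length ?l" "?l ! j = g" using gi by blast
    have "j \<le> length qs" using ord[of j "length qs"] pi j g(2) by (simp add: lq_def)
    then show "g = p \<or> g \<in> set qs" using ik[of j] pi j by (cases "j = length qs") auto
  qed
  from Cons.IH[OF this] Cons.prems(2) show ?case by simp
qed simp

lemma blown_lattice_blown:
  assumes "blowup_order L H ps"
  shows "blown (blown_lattice L ps) (rev ps)"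
proof -
  have "valid [] S x \<longleftrightarrow> S = {} \<and> x \<in> C" for S x by (auto simp: valid_def nest_def)
  then have "blown (orig_poset L) []"
    by (auto simp: blown_def orig_poset_def exc_def lq_def)
  from blown_iter[OF this, of ps] assms show ?thesis by (simp add: blown_lattice_def)
qed

end

section \<open>The factors of an element of the blown-up lattice\<close>

context geom
begin

lemma maximal_belowD:
  assumes "r \<in> maximal_below L G x" "x \<in> C"
  shows "r \<in> G" "r \<preceq> x" "g \<in> G \<Longrightarrow> g \<preceq> x \<Longrightarrow> r \<preceq> g \<Longrightarrow> g = r"
  using assms GC unfolding maximal_below_def lq_def by blast+

text \<open>An element of the blown-up lattice is a pair of exceptional labels \<open>S\<close> and an element
  \<open>x\<close> of \<open>L\<close> lying above no blown-up element.\<close>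

context
  fixes S x
  assumes S: "S \<subseteq> Ho" and x: "x \<in> C" and n: "nest Ho S x"
begin

lemma S_C: "S \<subseteq> C" "S \<subseteq> G" "S \<subseteq> H"
  using S HG HC by blast+

text \<open>Such an element would be a join of atoms of \<open>x\<close> that lies in
  \<open>Ho\<close> without being one of these atoms.\<close>

lemma not_Ho_below:
  assumes "g \<in> G" "g \<preceq> x"
  shows "g \<notin> Ho"
proof
  assume g: "g \<in> Ho"
  have "At g \<subseteq> S \<union> At x" using At_mono[OF assms(2)] by blast
  moreover have "J (At g) = g" using J_At assms(1) GC by blast
  ultimately have "g \<in> At g" using n g unfolding nest_def by metis
  then show False using g by (auto simp: At_def)
qed

text \<open>This will be the set of factors of the element given by \<open>S\<close> and
  \<open>x\<close>. Exceptional atoms are incomparable to the surviving elements of \<open>G\<close>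
  below \<open>x\<close>, so the two kinds are simply united.\<close>

definition "FF = S \<union> maximal_below L G x"

lemma FF_G: "FF \<subseteq> G"
  using S_C maximal_belowD(1)[OF _ x] by (auto simp: FF_def)

lemma J_expand:
  assumes U: "U \<subseteq> C" and V: "V \<subseteq> C" and 1: "\<And>u. u \<in> U \<Longrightarrow> u \<preceq> J V" and 2: "\<And>v. v \<in> V \<Longrightarrow> v \<preceq> J U"
  shows "J V = J U"
  by (rule lq_antisym[OF J_leqI[OF J_closed[OF U] 2] J_leqI[OF J_closed[OF V] 1]])

text \<open>If the join is in \<open>Ho\<close>, the factors of \<open>x\<close> are replaced by
  their atoms and nestedness of \<open>S\<close> and \<open>x\<close> applies. Otherwise no label
  takes part, by upward closedness of \<open>Ho\<close>, and a join in \<open>G\<close> of factors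
  of \<open>x\<close> is a single factor by maximality.\<close>

lemma FF_nested:
  assumes U: "U \<subseteq> FF" and h: "J U \<in> G"
  shows "J U \<in> U"
proof (cases "J U \<in> Ho")
  case True
  have UC: "U \<subseteq> C" using U FF_G GC by blast
  let ?V = "(U \<inter> S) \<union> (\<Union>g\<in>U \<inter> maximal_below L G x. At g)"
  have VS: "?V \<subseteq> S \<union> At x"
    using At_mono[OF maximal_belowD(2)[OF _ x]] by blast
  have VC: "?V \<subseteq> C" using VS S_C At_C by blast
  have "J ?V = J U"
  proof (rule J_expand[OF UC VC])
    fix u assume u: "u \<in> U"
    then consider "u \<in> S" | "u \<in> maximal_below L G x" using U FF_def by blast
    then show "u \<preceq> J ?V"
    proof cases
      case 1
      then show ?thesis using u by (intro J_upper[OF VC]) blast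
    next
      case 2
      then have "J (At u) \<preceq> J ?V" using u by (intro J_mono[OF VC]) blast
      then show ?thesis using J_At u UC by auto
    qed
  next
    fix v assume "v \<in> ?V"
    then consider "v \<in> U" | g where "g \<in> U" "v \<preceq> g" unfolding At_def by blast
    then show "v \<preceq> J U"
    proof cases
      case 1
      then show ?thesis by (rule J_upper[OF UC])
    next
      case 2
      then show ?thesis using J_upper[OF UC 2(1)] lq_trans by blast
    qed
  qed
  then have "J U \<in> ?V" using n VS True unfolding nest_def by metis
  then show ?thesis using True by (auto simp: At_def)
next
  case False
  have UC: "U \<subseteq> C" using U FF_G GC by blast
  have "U \<inter> S = {}"
  proof (rule ccontr)
    assume "U \<inter> S \<noteq> {}"
    then obtain s where "s \<in> U" "s \<in> S" by blast
    then have "J U \<in> Ho" using up[of s "J U"] S h J_upper[OF UC] by blast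
    then show False using False by blast
  qed
  then have UX: "U \<subseteq> maximal_below L G x" using U FF_def by blast
  have "J U \<preceq> x" using UX maximal_belowD(2)[OF _ x] by (intro J_leqI x) blast
  have "U \<noteq> {}" using h botG by auto
  then obtain u where u: "u \<in> U" by blast
  have "u \<preceq> J U" using J_upper[OF UC u] .
  then have "J U = u" using maximal_belowD(3)[OF _ x h \<open>J U \<preceq> x\<close>] u UX by blast
  then show ?thesis using u by simp
qed

context
  fixes Sc T
  assumes Sc: "Sc \<subseteq> H" "\<forall>U\<subseteq>Sc. J U \<in> Ho \<longrightarrow> J U \<in> U" and ScS: "Sc \<inter> Ho = S" and Scx: "J (Sc \<inter> ats) = x"
    and T: "T \<subseteq> H"
begin

lemma Sc_split: "Sc = S \<union> (Sc \<inter> ats)"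
  using Sc ScS by blast

lemma Sc_C: "Sc \<subseteq> C" "T \<subseteq> C"
  using Sc T HC by blast+

lemma atom_Sc: "a \<in> Sc \<Longrightarrow> a \<in> ats \<Longrightarrow> a \<preceq> x"
  unfolding Scx[symmetric] by (rule J_upper) (use Sc_C in blast)+

text \<open>The atoms of \<open>Sc\<close> join to \<open>x\<close>, so some of them have a join in
  \<open>G\<close> above \<open>g\<close>; it is below \<open>x\<close>, hence equal to
  \<open>g\<close> by maximality.\<close>

lemma factor_J_atoms:
  assumes g: "g \<in> maximal_below L G x"
  shows "J {a \<in> Sc \<inter> ats. a \<preceq> g} = g"
proof -
  have gG: "g \<in> G" "g \<preceq> x" by (rule maximal_belowD[OF g x])+
  have AG: "Sc \<inter> ats \<subseteq> G" using atH HG by blast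
  obtain V where V: "V \<subseteq> Sc \<inter> ats" "J V \<in> G" "g \<preceq> J V"
    using building_cover[OF AG gG(1)] gG(2) Scx by auto
  have "J V \<preceq> x" using V(1) atom_Sc by (intro J_leqI x) blast
  then have Vg: "J V = g" using maximal_belowD(3)[OF g x V(2)] V(3) by blast
  have VC: "V \<subseteq> C" using V Sc_C by blast
  have DC: "{a \<in> Sc \<inter> ats. a \<preceq> g} \<subseteq> C" using Sc_C by blast
  have "V \<subseteq> {a \<in> Sc \<inter> ats. a \<preceq> g}" using V(1) J_upper[OF VC] Vg by auto
  from J_mono[OF DC this] show ?thesis using Vg by (intro J_eqI) auto
qed

text \<open>Exchanges the chosen nested set \<open>Sc\<close> for the factors. In one direction a
  factor of \<open>x\<close> is replaced by the atoms of \<open>Sc\<close> below it. In the other,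
  atoms are replaced by the factors above them; this may enlarge the join, but it stays in
  \<open>Ho\<close>, and membership then shows that it was not enlarged.\<close>

lemma nested_iff_FF:
  "(\<forall>U\<subseteq>Sc \<union> T. J U \<in> Ho \<longrightarrow> J U \<in> U) \<longleftrightarrow> (\<forall>U\<subseteq>FF \<union> T. J U \<in> Ho \<longrightarrow> J U \<in> U)"
proof (intro iffI allI impI)
  fix U assume n': "\<forall>U\<subseteq>Sc \<union> T. J U \<in> Ho \<longrightarrow> J U \<in> U" and U: "U \<subseteq> FF \<union> T" and h: "J U \<in> Ho"
  have UC: "U \<subseteq> C" using U FF_G GC Sc_C by blast
  let ?A = "\<lambda>g. {a \<in> Sc \<inter> ats. a \<preceq> g}"
  let ?V = "(U \<inter> (S \<union> T)) \<union> (\<Union>g\<in>U \<inter> maximal_below L G x. ?A g)"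
  have VS: "?V \<subseteq> Sc \<union> T" using Sc_split by blast
  have VC: "?V \<subseteq> C" using VS Sc_C by blast
  have "J ?V = J U"
  proof (rule J_expand[OF UC VC])
    fix u assume u: "u \<in> U"
    then consider "u \<in> S \<union> T" | "u \<in> maximal_below L G x" using U FF_def by blast
    then show "u \<preceq> J ?V"
    proof cases
      case 1
      then show ?thesis using u by (intro J_upper[OF VC]) blast
    next
      case 2
      then have "J (?A u) \<preceq> J ?V" using u by (intro J_mono[OF VC]) blast
      then show ?thesis using factor_J_atoms[OF 2] by simp
    qed
  next
    fix v assume "v \<in> ?V"
    then consider "v \<in> U" | g where "g \<in> U" "v \<preceq> g" by blast
    then show "v \<preceq> J U"
    proof cases
      case 1
      then show ?thesis by (rule J_upper[OF UC])
    next
      case 2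
      then show ?thesis using J_upper[OF UC 2(1)] lq_trans by blast
    qed
  qed
  then have "J U \<in> ?V" using n' VS h by metis
  then show "J U \<in> U" using h by blast
next
  fix U assume n': "\<forall>U\<subseteq>FF \<union> T. J U \<in> Ho \<longrightarrow> J U \<in> U" and U: "U \<subseteq> Sc \<union> T" and h: "J U \<in> Ho"
  have UC: "U \<subseteq> C" using U Sc_C by blast
  define Y where "Y = {r \<in> maximal_below L G x. \<exists>a\<in>U. a \<in> Sc \<inter> ats \<and> a \<preceq> r}"
  have YG: "Y \<subseteq> G" using maximal_belowD(1)[OF _ x] unfolding Y_def by blast
  have YC: "Y \<subseteq> C" using YG GC by blast
  let ?V = "(U \<inter> (S \<union> T)) \<union> Y"
  have VF: "?V \<subseteq> FF \<union> T" unfolding FF_def Y_def by blast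
  have VC: "?V \<subseteq> C" using UC YC by blast
  have hG: "J U \<in> G" using h HG by blast
  \<comment> \<open>Every factor in \<open>Y\<close> shares an atom with \<open>J U\<close>, so the
    enlarged join is still in \<open>G\<close>.\<close>
  have "J (insert (J U) Y) \<in> G"
  proof (rule J_connected[OF finS[OF YC] YG hG])
    fix y assume "y \<in> Y"
    then obtain a where a: "a \<in> U" "a \<in> ats" "a \<preceq> y" unfolding Y_def by blast
    then show "\<exists>a. a \<noteq> bt \<and> a \<preceq> y \<and> a \<preceq> J U" using atomD(2) J_upper[OF UC] by blast
  qed
  moreover have IC: "insert (J U) Y \<subseteq> C" using YC hG GC by blast
  have JJ: "J (insert (J U) Y) = J ?V"
  proof (rule J_expand[OF VC IC])
    fix u assume "u \<in> ?V"
    then consider "u \<in> U" | "u \<in> Y" by blast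
    then show "u \<preceq> J (insert (J U) Y)"
    proof cases
      case 1
      then have "u \<preceq> J U" by (rule J_upper[OF UC])
      moreover have "J U \<preceq> J (insert (J U) Y)" using J_upper[OF IC] by blast
      ultimately show ?thesis using lq_trans by blast
    next
      case 2
      then show ?thesis using J_upper[OF IC] by blast
    qed
  next
    have uV: "u \<preceq> J ?V" if u: "u \<in> U" for u
    proof (cases "u \<in> S \<union> T")
      case True
      then show ?thesis using u by (intro J_upper[OF VC]) blast
    next
      case False
      then have a: "u \<in> Sc" "u \<in> ats" using u U Sc_split by blast+
      obtain r where r: "r \<in> maximal_below L G x" "u \<preceq> r"
        using ex_factor[of u x] atom_Sc[OF a] a(2) atH HG by blast
      then have "r \<in> Y" unfolding Y_def using u a by blast
      then have "r \<preceq> J ?V" by (intro J_upper[OF VC]) blast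
      then show ?thesis using r lq_trans by blast
    qed
    fix v assume "v \<in> insert (J U) Y"
    then consider "v = J U" | "v \<in> Y" by blast
    then show "v \<preceq> J ?V"
    proof cases
      case 1
      then show ?thesis using uV by (auto intro: J_leqI J_closed[OF VC])
    next
      case 2
      then show ?thesis by (intro J_upper[OF VC]) blast
    qed
  qed
  moreover have le: "J U \<preceq> J ?V" using J_upper[OF IC] JJ by auto
  ultimately have "J ?V \<in> Ho" using up[OF h] by auto
  then have in_V: "J ?V \<in> ?V" using n' VF by blast
  \<comment> \<open>The factors in \<open>Y\<close> lie below \<open>x\<close>, where there are no
    elements of \<open>Ho\<close>.\<close>
  moreover have "J ?V \<notin> Y"
    using \<open>J ?V \<in> Ho\<close> not_Ho_below maximal_belowD(1,2)[OF _ x] unfolding Y_def by blast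
  ultimately have "J ?V \<in> U" by blast
  moreover from this have "J ?V = J U" using J_upper[OF UC] le lq_antisym by blast
  ultimately show "J U \<in> U" by simp
qed

end

end

text \<open>Condenses the blown-up lattice into conditions on joins in \<open>L\<close>. From here
  on \<open>y\<close> enters only through its set of factors.\<close>

lemma blown_structure:
  assumes ord: "blowup_order L H ps" and y: "y \<in> carrier (blown_lattice L ps)"
  obtains Sc where "DP_at L H ps y = DP_rel L H Sc" "factors L G H ps y \<subseteq> G"
    "\<forall>U\<subseteq>factors L G H ps y. J U \<in> G \<longrightarrow> J U \<in> U"
    "\<And>T. T \<subseteq> H \<Longrightarrow> Sc \<union> T \<in> nested_sets L H \<longleftrightarrow>
      (\<forall>U\<subseteq>factors L G H ps y \<union> T. J U \<in> Ho \<longrightarrow> J U \<in> U)"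
proof -
  let ?B = "blown_lattice L ps"
  define qs where "qs = rev ps"
  have qs: "distinct qs" "set qs = Ho" using ord by (auto simp: qs_def blowup_order_def)
  have bl: "blown ?B qs" unfolding qs_def by (rule blown_lattice_blown[OF ord])
  have car: "carrier ?B = {exc qs S x | S x. valid qs S x}" using bl by (simp add: blown_def)
  have le: "exc qs S x \<sqsubseteq>\<^bsub>?B\<^esub> exc qs S' x' \<longleftrightarrow> S \<subseteq> S' \<and> x \<preceq> x'"
    if "valid qs S x" "valid qs S' x'" for S x S' x' using bl that unfolding blown_def by blast
  obtain S x where yS: "y = exc qs S x" and v: "valid qs S x" using y unfolding car by blast
  have S: "S \<subseteq> Ho" and x: "x \<in> C" and n: "nest Ho S x" using v by (auto simp: valid_def qs)
  have at_emb: "At bt = {}" using atomD bt_lq lq_antisym unfolding At_def by blast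
  have emb_Ho: "blow_emb L H g = exc qs {g} bt" "valid qs {g} bt" if "g \<in> Ho" for g
  proof -
    show "blow_emb L H g = exc qs {g} bt"
      using exc_singleton[OF qs(1), of g] that qs(2) by (simp add: blow_emb_def)
    have "J U \<in> U" if U: "U \<subseteq> {g}" "J U \<in> Ho" for U
    proof -
      have "U \<noteq> {}" using U(2) bt_notin_H by auto
      then have "U = {g}" using U by blast
      then show ?thesis using J_singleton \<open>g \<in> Ho\<close> HC by auto
    qed
    then show "valid qs {g} bt" using that by (simp add: valid_def nest_def at_emb qs)
  qed
  have emb_old: "blow_emb L H g = exc qs {} g" "valid qs {} g" if g: "g \<in> G" "g \<notin> Ho" for g
  proof -
    show "blow_emb L H g = exc qs {} g" using g by (auto simp: blow_emb_def exc_empty)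
    have gC: "g \<in> C" using g GC by blast
    have no: "J U \<notin> Ho" if U: "U \<subseteq> At g" for U
    proof
      assume "J U \<in> Ho"
      moreover have "J U \<preceq> g" using U by (intro J_leqI gC) (auto simp: At_def)
      ultimately show False using up g by blast
    qed
    show "valid qs {} g" unfolding valid_def nest_def qs using gC no by blast
  qed
  have below: "blow_emb L H g \<sqsubseteq>\<^bsub>?B\<^esub> y \<longleftrightarrow> (if g \<in> Ho then g \<in> S else g \<preceq> x)" if "g \<in> G" for g
    using emb_Ho[of g] emb_old[of g] le[OF _ v] that bt_lq[OF x] yS by auto
  have fac: "factors L G H ps y = FF S x"
  proof -
    define A where "A = {g \<in> G. blow_emb L H g \<sqsubseteq>\<^bsub>?B\<^esub> y}"
    have A: "g \<in> A \<longleftrightarrow> g \<in> S \<or> (g \<in> G \<and> g \<preceq> x)" for g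
    proof (cases "g \<in> G")
      case True
      then show ?thesis
        using below[OF True] S not_Ho_below[OF S x n True] by (cases "g \<in> Ho") (auto simp: A_def)
    qed (use S HG in \<open>auto simp: A_def\<close>)
    have old: "g \<notin> Ho" if "g \<in> G" "g \<preceq> x" for g using not_Ho_below[OF S x n that] .
    have "factors L G H ps y = {g \<in> A. \<forall>h\<in>A. blow_emb L H g \<sqsubseteq>\<^bsub>?B\<^esub> blow_emb L H h \<longrightarrow> h = g}"
      by (simp add: factors_def A_def Let_def)
    also have "\<dots> = FF S x"
    proof (intro equalityI subsetI)
      fix g assume g: "g \<in> {g \<in> A. \<forall>h\<in>A. blow_emb L H g \<sqsubseteq>\<^bsub>?B\<^esub> blow_emb L H h \<longrightarrow> h = g}"
      show "g \<in> FF S x"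
      proof (cases "g \<in> S")
        case False
        then have gx: "g \<in> G" "g \<preceq> x" using g A by blast+
        have "h = g" if h: "h \<in> G" "h \<sqsubseteq>\<^bsub>L\<^esub> x" "g \<sqsubseteq>\<^bsub>L\<^esub> h" for h
        proof -
          have hx: "h \<preceq> x" "g \<preceq> h" using h gx GC x lq_iff by blast+
          have "blow_emb L H g \<sqsubseteq>\<^bsub>?B\<^esub> blow_emb L H h"
            using emb_old[OF gx(1) old[OF gx]] emb_old[OF h(1) old[OF h(1) hx(1)]] le hx(2) by simp
          then show ?thesis using g A h(1) hx(1) by blast
        qed
        then have "g \<in> maximal_below L G x" using gx unfolding maximal_below_def lq_def by blast
        then show ?thesis by (simp add: FF_def[OF S x n])
      qed (simp add: FF_def[OF S x n])
    next
      fix g assume g: "g \<in> FF S x"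
      then consider "g \<in> S" | "g \<in> maximal_below L G x" by (auto simp: FF_def[OF S x n])
      then show "g \<in> {g \<in> A. \<forall>h\<in>A. blow_emb L H g \<sqsubseteq>\<^bsub>?B\<^esub> blow_emb L H h \<longrightarrow> h = g}"
      proof cases
        case 1
        have gHo: "g \<in> Ho" using 1 S by blast
        have "h = g" if h: "h \<in> A" "blow_emb L H g \<sqsubseteq>\<^bsub>?B\<^esub> blow_emb L H h" for h
        proof (cases "h \<in> S")
          case True
          then have "h \<in> Ho" using S by blast
          then show ?thesis using h(2) emb_Ho[OF gHo] emb_Ho[of h] le by auto
        next
          case False
          then have hx: "h \<in> G" "h \<preceq> x" using h A by blast+
          then show ?thesis using h(2) emb_Ho[OF gHo] emb_old[OF hx(1) old[OF hx]] le by auto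
        qed
        then show ?thesis using A 1 by blast
      next
        case 2
        have gx: "g \<in> G" "g \<preceq> x" by (rule maximal_belowD[OF 2 x])+
        have "h = g" if h: "h \<in> A" "blow_emb L H g \<sqsubseteq>\<^bsub>?B\<^esub> blow_emb L H h" for h
        proof (cases "h \<in> S")
          case True
          then have "h \<in> Ho" using S by blast
          then have "g \<preceq> bt" using h(2) emb_Ho[of h] emb_old[OF gx(1) old[OF gx]] le by auto
          then show ?thesis using gx botG bt_lq lq_antisym lqD by metis
        next
          case False
          then have hx: "h \<in> G" "h \<preceq> x" using h A by blast+
          then have "g \<preceq> h" using h(2) emb_old[OF gx(1) old[OF gx]] emb_old[OF hx(1) old[OF hx]] le by auto
          then show ?thesis using maximal_belowD(3)[OF 2 x] hx by blast
        qed
        then show ?thesis using A gx by blast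
      qed
    qed
    finally show ?thesis .
  qed
  have split: "T = (T \<inter> Ho) \<union> (T \<inter> ats)" if "T \<subseteq> H" for T using that by blast
  have emb_at: "blow_emb L H a = exc qs {} a" "valid qs {} a" if a: "a \<in> ats" for a
    using emb_old[of a] a atH HG by blast+
  have ub: "exc qs S' x' \<in> Upper ?B (blow_emb L H ` T) \<longleftrightarrow> T \<inter> Ho \<subseteq> S' \<and> (\<forall>a\<in>T \<inter> ats. a \<preceq> x')"
    if T: "T \<subseteq> H" and v': "valid qs S' x'" for T S' x'
  proof -
    have x': "x' \<in> C" using v' by (simp add: valid_def)
    have 1: "blow_emb L H t \<in> carrier ?B" if "t \<in> H" for t
      using emb_Ho[of t] emb_at[of t] that unfolding car by blast
    have 2: "blow_emb L H t \<sqsubseteq>\<^bsub>?B\<^esub> exc qs S' x' \<longleftrightarrow> (if t \<in> Ho then t \<in> S' else t \<preceq> x')" if "t \<in> H" for t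
      using emb_Ho[of t] emb_at[of t] le[OF _ v'] that bt_lq[OF x'] by auto
    have "exc qs S' x' \<in> Upper ?B (blow_emb L H ` T) \<longleftrightarrow> (\<forall>t\<in>T. blow_emb L H t \<sqsubseteq>\<^bsub>?B\<^esub> exc qs S' x')"
      unfolding Upper_def using 1 T v' car by auto
    also have "\<dots> \<longleftrightarrow> (\<forall>t\<in>T. if t \<in> Ho then t \<in> S' else t \<preceq> x')" using 2 T by blast
    also have "\<dots> \<longleftrightarrow> T \<inter> Ho \<subseteq> S' \<and> (\<forall>a\<in>T \<inter> ats. a \<preceq> x')" using T by auto
    finally show ?thesis .
  qed
  define Q where "Q T \<longleftrightarrow> T \<in> nested_sets L H \<and> is_lub ?B y (blow_emb L H ` T)" for T
  define Sc where "Sc = (SOME T. Q T)"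
  \<comment> \<open>A nested set with join \<open>y\<close> exists, which gives meaning to the
    choice made in \<open>DP_at\<close>.\<close>
  have "Q (S \<union> At x)"
  proof -
    let ?T = "S \<union> At x"
    have TH: "?T \<subseteq> H" using S atH by (auto simp: At_def)
    have Ts: "?T \<inter> Ho = S" "?T \<inter> ats = At x" using S by (auto simp: At_def)
    have "?T \<in> nested_sets L H" unfolding nested_H using TH n by (simp add: nest_def)
    moreover have "is_lub ?B y (blow_emb L H ` ?T)"
      unfolding least_def
    proof (intro conjI ballI)
      show "Upper ?B (blow_emb L H ` ?T) \<subseteq> carrier ?B" by (auto simp: Upper_def)
      show "y \<in> Upper ?B (blow_emb L H ` ?T)" unfolding yS ub[OF TH v] Ts by (auto simp: At_def)
      fix u assume u: "u \<in> Upper ?B (blow_emb L H ` ?T)"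
      then have "u \<in> carrier ?B" by (auto simp: Upper_def)
      then obtain S' x' where u': "u = exc qs S' x'" "valid qs S' x'" unfolding car by blast
      then have *: "S \<subseteq> S'" "\<forall>a\<in>At x. a \<preceq> x'" using u ub[OF TH u'(2)] Ts by auto
      have "x' \<in> C" using u'(2) by (simp add: valid_def)
      then have "J (At x) \<preceq> x'" using * by (intro J_leqI) auto
      then show "y \<sqsubseteq>\<^bsub>?B\<^esub> u" unfolding yS u'(1) le[OF v u'(2)] using * J_At[OF x] by simp
    qed
    ultimately show ?thesis by (simp add: Q_def)
  qed
  then have "Q Sc" unfolding Sc_def by (rule someI)
  then have Scn: "Sc \<in> nested_sets L H" and lub: "is_lub ?B y (blow_emb L H ` Sc)" by (auto simp: Q_def)
  have ScH: "Sc \<subseteq> H" and Scn': "\<forall>U\<subseteq>Sc. J U \<in> Ho \<longrightarrow> J U \<in> U" using Scn unfolding nested_H by blast+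
  have yU: "Sc \<inter> Ho \<subseteq> S" "\<forall>a\<in>Sc \<inter> ats. a \<preceq> x"
    using lub ub[OF ScH v] unfolding least_def yS by blast+
  have AC: "Sc \<inter> ats \<subseteq> C" using atomD(1) by blast
  have Jx: "J (Sc \<inter> ats) \<preceq> x" using yU by (intro J_leqI x) blast
  \<comment> \<open>The element built from \<open>Sc\<close> itself is an upper bound of the
    embedded \<open>Sc\<close>. As \<open>y\<close> is the least one, its labels and its underlying
    element are those of \<open>Sc\<close>.\<close>
  have v': "valid qs (Sc \<inter> Ho) (J (Sc \<inter> ats))" by (rule valid_mono[OF v yU(1) Jx])
  have "exc qs (Sc \<inter> Ho) (J (Sc \<inter> ats)) \<in> Upper ?B (blow_emb L H ` Sc)"
    unfolding ub[OF ScH v'] using J_upper[OF AC] by blast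
  then have "y \<sqsubseteq>\<^bsub>?B\<^esub> exc qs (Sc \<inter> Ho) (J (Sc \<inter> ats))" using lub unfolding least_def by blast
  then have *: "S \<subseteq> Sc \<inter> Ho" "x \<preceq> J (Sc \<inter> ats)" unfolding yS le[OF v v'] by blast+
  have ScS: "Sc \<inter> Ho = S" using * yU by blast
  have Scx: "J (Sc \<inter> ats) = x" using * Jx lq_antisym by blast
  show thesis
  proof (rule that[of Sc])
    show "DP_at L H ps y = DP_rel L H Sc" by (simp add: DP_at_def Sc_def Q_def)
    show "factors L G H ps y \<subseteq> G" unfolding fac by (rule FF_G[OF S x n])
    show "\<forall>U\<subseteq>factors L G H ps y. J U \<in> G \<longrightarrow> J U \<in> U" unfolding fac using FF_nested[OF S x n] by blast
    show "Sc \<union> T \<in> nested_sets L H \<longleftrightarrow> (\<forall>U\<subseteq>factors L G H ps y \<union> T. J U \<in> Ho \<longrightarrow> J U \<in> U)"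
      if T: "T \<subseteq> H" for T
      unfolding nested_H fac using nested_iff_FF[OF S x n ScH Scn' ScS Scx T] ScH T by simp
  qed
qed

end

section \<open>Local intervals\<close>

locale nested_factors = geom L G H for L :: "'a gorder" and G H +
  fixes F :: "'a set"
  assumes FG: "F \<subseteq> G" and F_nested: "\<And>U. U \<subseteq> F \<Longrightarrow> J U \<in> G \<Longrightarrow> J U \<in> U"
begin

definition "Fp = F \<union> {tp}"
definition "zb g = J {f \<in> F. f \<sqsubseteq>\<^bsub>L\<^esub> g \<and> f \<noteq> g}"
definition "hat p = (THE g. least L g {g \<in> Fp. p \<sqsubseteq>\<^bsub>L\<^esub> g})"
definition "zeta p = J {p, zb (hat p)}"
definition "Lg g = interval L (zb g) g"
definition "Hg g = zeta ` H \<inter> (carrier (Lg g) - {zb g})"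
text \<open>If \<open>F\<close> is the set of factors of \<open>y\<close>, this expresses that
  \<open>T\<close> together with a nested set with join \<open>y\<close> is nested.\<close>

definition "compatible T \<longleftrightarrow> (\<forall>U\<subseteq>F \<union> T. J U \<in> Ho \<longrightarrow> J U \<in> U)"

lemma F_C: "F \<subseteq> C"
  using FG GC by blast

lemma Fp_G: "Fp \<subseteq> G" "Fp \<subseteq> C"
  using FG topG GC by (auto simp: Fp_def)

lemma Hin: "p \<in> H \<Longrightarrow> p \<in> C" "p \<in> H \<Longrightarrow> p \<in> G" "p \<in> H \<Longrightarrow> p \<noteq> bt"
  using HG HC bt_notin_H by blast+

lemma below_C: "{f \<in> F. f \<sqsubseteq>\<^bsub>L\<^esub> g \<and> f \<noteq> g} \<subseteq> C"
  using F_C by blast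

lemma below_iff: "g \<in> C \<Longrightarrow> f \<in> {f \<in> F. f \<sqsubseteq>\<^bsub>L\<^esub> g \<and> f \<noteq> g} \<longleftrightarrow> f \<in> F \<and> f \<preceq> g \<and> f \<noteq> g"
  using F_C by (auto simp: lq_def)

lemma zb_C [simp]: "zb g \<in> C"
  unfolding zb_def by (rule J_closed[OF below_C])

lemma lq_zb:
  assumes "f \<in> F" "f \<preceq> g" "f \<noteq> g"
  shows "f \<preceq> zb g"
  unfolding zb_def by (rule J_upper[OF below_C]) (use assms in \<open>simp add: lq_def\<close>)

lemma zb_lq: "g \<in> C \<Longrightarrow> zb g \<preceq> g"
  unfolding zb_def by (rule J_leqI) (use F_C in \<open>auto simp: lq_def\<close>)

text \<open>A join in \<open>G\<close> of factors below \<open>g\<close> is itself one of these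
  factors.\<close>

lemma lq_zb_cases:
  assumes q: "q \<in> G" "q \<preceq> zb g" and g: "g \<in> C"
  shows "\<exists>f\<in>F. q \<preceq> f \<and> f \<preceq> g \<and> f \<noteq> g"
proof -
  let ?D = "{f \<in> F. f \<sqsubseteq>\<^bsub>L\<^esub> g \<and> f \<noteq> g}"
  have "?D \<subseteq> G" using FG by blast
  then obtain V where V: "V \<subseteq> ?D" "J V \<in> G" "q \<preceq> J V"
    using building_cover[of ?D q] q unfolding zb_def by blast
  have "V \<subseteq> F" using V(1) by blast
  then have "J V \<in> V" using F_nested V(2) by blast
  then have "J V \<in> ?D" using V(1) by blast
  then show ?thesis using below_iff[OF g] V(3) by blast
qed

text \<open>Two factors with a common nonzero lower bound have a join in \<open>G\<close>, which
  must be one of them. So the members of \<open>Fp\<close> above a nonzero element form a chain, and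
  \<open>hat\<close> is well defined.\<close>

lemma Fp_chain:
  assumes "f \<in> Fp" "g \<in> Fp" "p \<in> C" "p \<noteq> bt" "p \<preceq> f" "p \<preceq> g"
  shows "f \<preceq> g \<or> g \<preceq> f"
proof (cases "f = tp \<or> g = tp")
  case True
  then show ?thesis using assms lq_tp Fp_G by blast
next
  case False
  then have fg: "f \<in> F" "g \<in> F" using assms by (auto simp: Fp_def)
  then have "J {f, g} \<in> G" using join_connected[of f g p] assms FG by blast
  then have "J {f, g} \<in> {f, g}" using F_nested[of "{f, g}"] fg by blast
  moreover have "f \<preceq> J {f, g}" "g \<preceq> J {f, g}" using J_upper[of "{f, g}"] fg F_C by blast+
  ultimately show ?thesis by auto
qed

lemma hat:
  assumes p: "p \<in> H"
  shows "hat p \<in> Fp" "p \<preceq> hat p" "\<And>g. g \<in> Fp \<Longrightarrow> p \<preceq> g \<Longrightarrow> hat p \<preceq> g"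
proof -
  let ?A = "{g \<in> Fp. p \<sqsubseteq>\<^bsub>L\<^esub> g}"
  have A: "g \<in> ?A \<longleftrightarrow> g \<in> Fp \<and> p \<preceq> g" for g using Fp_G Hin(1)[OF p] lq_iff by blast
  have AC: "?A \<subseteq> C" using Fp_G by blast
  have "tp \<in> ?A" unfolding A using lq_tp[OF Hin(1)[OF p]] by (simp add: Fp_def)
  then obtain m where "m \<in> ?A \<and> (\<forall>g. g \<in> ?A \<longrightarrow> card {w \<in> C. w \<preceq> m} \<le> card {w \<in> C. w \<preceq> g})"
    using ex_has_least_nat[of "\<lambda>g. g \<in> ?A" tp "\<lambda>g. card {w \<in> C. w \<preceq> g}"] by meson
  then have m: "m \<in> ?A" "\<And>g. g \<in> ?A \<Longrightarrow> card {w \<in> C. w \<preceq> m} \<le> card {w \<in> C. w \<preceq> g}"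
    by simp_all
  have least: "m \<preceq> g" if g: "g \<in> ?A" for g
  proof (rule ccontr)
    assume ng: "\<not> m \<preceq> g"
    have "m \<in> Fp" "g \<in> Fp" "p \<preceq> m" "p \<preceq> g" using m(1) g A by blast+
    then have gm: "g \<preceq> m" using Fp_chain[of m g p] Hin[OF p] ng by blast
    have "{w \<in> C. w \<preceq> g} \<subseteq> {w \<in> C. w \<preceq> m}" using gm lq_trans by blast
    moreover have "m \<in> {w \<in> C. w \<preceq> m}" "m \<notin> {w \<in> C. w \<preceq> g}"
      using ng lq_refl lqD(2)[OF gm] by simp_all
    ultimately have "{w \<in> C. w \<preceq> g} \<subset> {w \<in> C. w \<preceq> m}" by blast
    then have "card {w \<in> C. w \<preceq> g} < card {w \<in> C. w \<preceq> m}"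
      by (rule psubset_card_mono[rotated]) (simp add: finC)
    then show False using m(2)[OF g] by simp
  qed
  have lm: "least L m ?A" unfolding least_def using m(1) AC least by (auto simp: lq_def)
  have "hat p = m"
    unfolding hat_def
  proof (rule the_equality[of "\<lambda>g. least L g ?A", OF lm])
    fix g assume g: "least L g ?A"
    then have "g \<in> ?A" "g \<sqsubseteq>\<^bsub>L\<^esub> m" using m(1) unfolding least_def by blast+
    then show "g = m" using least[of g] lq_antisym[of g m] lq_iff[of g m] m(1) AC by blast
  qed
  then show "hat p \<in> Fp" "p \<preceq> hat p" "\<And>g. g \<in> Fp \<Longrightarrow> p \<preceq> g \<Longrightarrow> hat p \<preceq> g"
    using m(1) least A by blast+
qed

lemma hat_C: "p \<in> H \<Longrightarrow> hat p \<in> C"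
  using hat(1) Fp_G by blast

lemma not_lq_zb:
  assumes p: "p \<in> H"
  shows "\<not> p \<preceq> zb (hat p)"
proof
  assume "p \<preceq> zb (hat p)"
  then obtain f where f: "f \<in> F" "p \<preceq> f" "f \<preceq> hat p" "f \<noteq> hat p"
    using lq_zb_cases[OF Hin(2)[OF p] _ hat_C[OF p]] by blast
  then have "hat p \<preceq> f" using hat(3)[OF p] by (auto simp: Fp_def)
  then show False using f lq_antisym by blast
qed

lemma zeta:
  assumes p: "p \<in> H"
  shows "p \<preceq> zeta p" "zb (hat p) \<preceq> zeta p" "zeta p \<preceq> hat p" "zeta p \<noteq> zb (hat p)"
proof -
  have D: "{p, zb (hat p)} \<subseteq> C" using Hin(1)[OF p] by simp
  show 1: "p \<preceq> zeta p" and "zb (hat p) \<preceq> zeta p" unfolding zeta_def using J_upper[OF D] by blast+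
  show "zeta p \<preceq> hat p"
    unfolding zeta_def by (rule J_leqI[OF hat_C[OF p]]) (use hat(2)[OF p] zb_lq[OF hat_C[OF p]] in auto)
  show "zeta p \<noteq> zb (hat p)" using 1 not_lq_zb[OF p] by auto
qed

lemma zeta_leqI:
  assumes "p \<preceq> w" "zb (hat p) \<preceq> w"
  shows "zeta p \<preceq> w"
  unfolding zeta_def by (rule J_leqI[OF lqD(2)[OF assms(1)]]) (use assms in auto)

lemma carrier_Lg: "g \<in> C \<Longrightarrow> w \<in> carrier (Lg g) \<longleftrightarrow> zb g \<preceq> w \<and> w \<preceq> g"
  unfolding Lg_def interval_def at_least_at_most_def lq_def by auto

lemma le_Lg: "x \<sqsubseteq>\<^bsub>Lg g\<^esub> y \<longleftrightarrow> x \<sqsubseteq>\<^bsub>L\<^esub> y"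
  by (simp add: Lg_def interval_def)

lemma le_Lg_iff: "g \<in> C \<Longrightarrow> x \<in> carrier (Lg g) \<Longrightarrow> y \<in> carrier (Lg g) \<Longrightarrow> x \<sqsubseteq>\<^bsub>L\<^esub> y \<longleftrightarrow> x \<preceq> y"
  using carrier_Lg by (simp add: lq_def)

text \<open>Were \<open>hat p\<close> different from \<open>g\<close>, it would be a factor strictly
  below \<open>g\<close>, hence below \<open>zb g\<close>, and \<open>w\<close> with it.\<close>

lemma hat_eq_interval:
  assumes g: "g \<in> Fp" and p: "p \<in> H" and w: "p \<preceq> w" "zb g \<preceq> w" "w \<preceq> g" "w \<noteq> zb g"
    and wh: "w \<preceq> hat p"
  shows "hat p = g"
proof (rule ccontr)
  assume ne: "hat p \<noteq> g"
  have le: "hat p \<preceq> g" using hat(3)[OF p g] lq_trans[OF w(1,3)] by blast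
  have "hat p \<noteq> tp" using ne le lq_tp lqD(2)[OF le] lq_antisym by metis
  then have "hat p \<in> F" using hat(1)[OF p] by (simp add: Fp_def)
  then have "hat p \<preceq> zb g" using lq_zb le ne by blast
  then have "w \<preceq> zb g" using wh lq_trans by blast
  then show False using w lq_antisym by blast
qed

text \<open>The half-open interval over \<open>g\<close> receives images only from the elements
  whose least factor is \<open>g\<close>.\<close>

lemma Hg_iff:
  assumes g: "g \<in> Fp"
  shows "w \<in> Hg g \<longleftrightarrow> (\<exists>p\<in>H. hat p = g \<and> w = zeta p)"
proof
  have gC: "g \<in> C" using g Fp_G by blast
  {
    assume w: "w \<in> Hg g"
    then obtain p where p: "p \<in> H" "w = zeta p" unfolding Hg_def by blast
    have "zb g \<preceq> w" "w \<preceq> g" "w \<noteq> zb g" using w carrier_Lg[OF gC] unfolding Hg_def by blast+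
    then have "hat p = g" using hat_eq_interval[OF g p(1)] zeta[OF p(1)] p(2) by blast
    then show "\<exists>p\<in>H. hat p = g \<and> w = zeta p" using p by blast
  next
    assume "\<exists>p\<in>H. hat p = g \<and> w = zeta p"
    then obtain p where p: "p \<in> H" "hat p = g" "w = zeta p" by blast
    have "w \<in> carrier (Lg g)" "w \<noteq> zb g" using zeta(2-4)[OF p(1)] carrier_Lg[OF gC] p(2,3) by auto
    then show "w \<in> Hg g" unfolding Hg_def using p(1,3) by blast
  }
qed

lemma Hg_bounds:
  assumes "g \<in> Fp" "w \<in> Hg g"
  shows "zb g \<preceq> w \<and> w \<preceq> g \<and> w \<noteq> zb g"
proof -
  have "g \<in> C" using assms(1) Fp_G(2) by blast
  then show ?thesis using assms(2) carrier_Lg[of g w] by (simp add: Hg_def)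
qed

lemma Hg_C: "g \<in> Fp \<Longrightarrow> Hg g \<subseteq> C"
  using Hg_bounds lqD(1) by (meson subsetI)

lemma Hg_disjoint:
  assumes "g \<in> Fp" "g' \<in> Fp" "w \<in> Hg g" "w \<in> Hg g'"
  shows "g = g'"
proof -
  obtain p where p: "p \<in> H" "hat p = g" "w = zeta p" using assms Hg_iff by blast
  have "p \<preceq> w" "w \<preceq> hat p" using zeta p by blast+
  then have "hat p = g'" using hat_eq_interval[OF assms(2) p(1)] Hg_bounds[OF assms(2,4)] by blast
  then show ?thesis using p by simp
qed

lemma hat_self:
  assumes "g \<in> Fp" "g \<in> H"
  shows "hat g = g" "zeta g = g"
proof -
  show 1: "hat g = g"
    using hat(2)[OF assms(2)] hat(3)[OF assms(2,1)] lq_refl Fp_G assms(1) lq_antisym by blast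
  show "zeta g = g"
    using zeta(1,3)[OF assms(2)] 1 lq_antisym by metis
qed

section \<open>Compatible elements and the map \<open>zeta\<close>\<close>

lemma compatible_Fp:
  assumes "g \<in> Fp"
  shows "compatible {g}"
  unfolding compatible_def
proof (intro allI impI)
  fix U assume U: "U \<subseteq> F \<union> {g}" "J U \<in> Ho"
  show "J U \<in> U"
  proof (cases "tp \<in> U")
    case True
    have UC: "U \<subseteq> C" using U F_C Fp_G assms by blast
    have "J U = tp" using J_upper[OF UC True] lq_tp[OF J_closed[OF UC]] lq_antisym by blast
    then show ?thesis using True by simp
  next
    case False
    then have "U \<subseteq> F" using U(1) assms by (auto simp: Fp_def)
    then show ?thesis using F_nested U(2) HG by blast
  qed
qed

text \<open>Written as a join of elements of \<open>G\<close>, so that \<open>building_cover\<close>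
  can be applied to it.\<close>

lemma zeta_insert:
  assumes t: "t \<in> H"
  shows "zeta t = J (insert t {f \<in> F. f \<sqsubseteq>\<^bsub>L\<^esub> hat t \<and> f \<noteq> hat t})"
proof -
  let ?D = "{f \<in> F. f \<sqsubseteq>\<^bsub>L\<^esub> hat t \<and> f \<noteq> hat t}"
  have DC: "insert t ?D \<subseteq> C" using below_C Hin(1)[OF t] by blast
  have "zb (hat t) \<preceq> J (insert t ?D)" unfolding zb_def by (rule J_mono[OF DC]) blast
  then have 1: "zeta t \<preceq> J (insert t ?D)" using J_upper[OF DC] by (intro zeta_leqI) blast+
  have "u \<preceq> zeta t" if "u \<in> insert t ?D" for u
  proof (cases "u = t")
    case False
    then have "u \<preceq> zb (hat t)" using that lq_zb below_iff[OF hat_C[OF t]] by blast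
    then show ?thesis using zeta(2)[OF t] lq_trans by blast
  qed (use zeta(1)[OF t] in simp)
  then have "J (insert t ?D) \<preceq> zeta t" by (intro J_leqI) (use lqD(2) zeta(1)[OF t] in blast)+
  then show ?thesis using 1 lq_antisym by blast
qed

text \<open>Cover \<open>p\<close> by a join in \<open>G\<close> of \<open>t\<close> and factors
  strictly below \<open>hat t\<close>. This join is one of its members, and a factor is excluded, as
  it would lie above \<open>p\<close> and strictly below \<open>hat p\<close>. One of the elements
  must be in \<open>Ho\<close>, since compatibility tests no other joins: two atoms may share an
  image without being comparable.\<close>

lemma lq_compatible:
  assumes p: "p \<in> H" and t: "t \<in> H" and ct: "compatible {t}" and hat: "hat p = hat t"
    and z: "zeta p \<preceq> zeta t" and Ho: "p \<in> Ho \<or> t \<in> Ho"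
  shows "p \<preceq> t"
proof -
  let ?D = "{f \<in> F. f \<sqsubseteq>\<^bsub>L\<^esub> hat t \<and> f \<noteq> hat t}"
  have DG: "insert t ?D \<subseteq> G" using FG Hin(2)[OF t] by blast
  have "p \<preceq> J (insert t ?D)" using zeta(1)[OF p] z lq_trans zeta_insert[OF t] by metis
  then obtain V where V: "V \<subseteq> insert t ?D" "J V \<in> G" "p \<preceq> J V"
    using building_cover[OF DG Hin(2)[OF p]] by blast
  have VC: "V \<subseteq> C" using V(1) DG GC by blast
  have "J V \<in> V"
  proof (cases "t \<notin> V")
    case True
    then have "V \<subseteq> F" using V(1) by blast
    then show ?thesis using F_nested V(2) by blast
  next
    case False
    then have "t \<preceq> J V" using J_upper[OF VC] by blast
    then have "J V \<in> Ho" using Ho up V(2,3) by blast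
    moreover have "V \<subseteq> F \<union> {t}" using V(1) by blast
    ultimately show ?thesis using ct unfolding compatible_def by blast
  qed
  then consider "J V = t" | "J V \<in> F" "J V \<preceq> hat t" "J V \<noteq> hat t"
    using V(1) below_iff[OF hat_C[OF t]] by blast
  then show ?thesis
  proof cases
    case 2
    then have "hat p \<preceq> J V" using nested_factors.hat(3)[OF nested_factors_axioms p] V(3) by (auto simp: Fp_def)
    then show ?thesis using 2 hat lq_antisym by metis
  qed (use V(3) in simp)
qed

text \<open>Take \<open>q\<close> maximal among the joins in \<open>H\<close> of \<open>p\<close>
  with factors strictly below \<open>hat p\<close>. If a set violated compatibility of
  \<open>q\<close>, its join, when below \<open>hat p\<close>, would be a larger element of this
  kind; otherwise, enlarged by \<open>hat p\<close>, it would be a join of factors in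
  \<open>G\<close> that is none of them.\<close>

lemma ex_compatible:
  assumes p: "p \<in> H"
  shows "\<exists>q\<in>H. compatible {q} \<and> p \<preceq> q \<and> hat q = hat p \<and> zeta q = zeta p"
proof -
  let ?g = "hat p"
  let ?D = "{f \<in> F. f \<sqsubseteq>\<^bsub>L\<^esub> ?g \<and> f \<noteq> ?g}"
  have gC: "?g \<in> C" by (rule hat_C[OF p])
  have pC: "p \<in> C" by (rule Hin(1)[OF p])
  have DC: "insert p ?D \<subseteq> C" using pC F_C by blast
  define Q where "Q = {J V | V. V \<subseteq> insert p ?D \<and> p \<in> V \<and> J V \<in> H}"
  have "Q \<subseteq> C" using HC by (auto simp: Q_def)
  moreover have "p \<in> Q"
    unfolding Q_def using J_singleton[OF pC] p by (intro CollectI exI[of _ "{p}"]) auto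
  ultimately obtain q where q: "q \<in> Q" "p \<preceq> q" "\<forall>v\<in>Q. q \<preceq> v \<longrightarrow> v = q"
    using ex_maximal[of Q p] by blast
  obtain V where V: "V \<subseteq> insert p ?D" "p \<in> V" "q = J V" and qH: "q \<in> H" using q(1) by (auto simp: Q_def)
  have VC: "V \<subseteq> C" using V(1) DC by blast
  have Dg: "v \<preceq> ?g" if "v \<in> insert p ?D" for v using that hat(2)[OF p] below_iff[OF gC] by blast
  have qg: "q \<preceq> ?g" unfolding V(3) using Dg V(1) by (intro J_leqI gC) blast
  have qC: "q \<in> C" "q \<noteq> bt" using Hin[OF qH] by blast+
  have "compatible {q}"
    unfolding compatible_def
  proof (intro allI impI, rule ccontr)
    fix U assume U: "U \<subseteq> F \<union> {q}" and h: "J U \<in> Ho" "J U \<notin> U"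
    have UC: "U \<subseteq> C" using U F_C qC by blast
    have hG: "J U \<in> G" "J U \<in> C" using h HG HC by blast+
    have qU: "q \<in> U"
    proof (rule ccontr)
      assume "q \<notin> U"
      then have "U \<subseteq> F" using U by blast
      then show False using F_nested hG h by blast
    qed
    have qh: "q \<preceq> J U" by (rule J_upper[OF UC qU])
    show False
    proof (cases "J U \<preceq> ?g")
      case True
      have UD: "u \<in> ?D" if u: "u \<in> U" "u \<noteq> q" for u
      proof -
        have uh: "u \<preceq> J U" using J_upper[OF UC u(1)] .
        have "u \<noteq> ?g"
        proof
          assume "u = ?g"
          then have "J U = u" using uh True lq_antisym by metis
          then show False using h u by simp
        qed
        then show ?thesis using u U lq_trans[OF uh True] below_iff[OF gC] by blast
      qed
      \<comment> \<open>Since \<open>q\<close> is itself a join, it is replaced by the set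
        \<open>V\<close> from which it came.\<close>
      let ?W = "V \<union> (U - {q})"
      have WD: "?W \<subseteq> insert p ?D" using V(1) UD by blast
      have WC: "?W \<subseteq> C" using WD DC by blast
      have "J ?W = J U"
      proof (rule J_eqI)
        fix w assume "w \<in> ?W"
        then consider "w \<in> V" | "w \<in> U" by blast
        then show "w \<preceq> J U"
        proof cases
          case 1
          then have "w \<preceq> q" unfolding V(3) by (rule J_upper[OF VC])
          then show ?thesis using qh lq_trans by blast
        next
          case 2
          then show ?thesis by (rule J_upper[OF UC])
        qed
      next
        have "J V \<preceq> J ?W" by (rule J_mono[OF WC]) blast
        then have "q \<preceq> J ?W" using V(3) by simp
        then show "J U \<preceq> J ?W" using J_upper[OF WC] by (intro J_leqI J_closed[OF WC]) blast
      qed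
      then have "J U \<in> Q" unfolding Q_def using WD V(2) h by (intro CollectI exI[of _ ?W]) auto
      then have "J U = q" using q(3) qh by blast
      then show False using qU h by simp
    next
      case False
      have "?g \<noteq> tp" using False lq_tp[OF hG(2)] by metis
      then have gF: "?g \<in> F" using hat(1)[OF p] by (auto simp: Fp_def)
      let ?k = "J {J U, ?g}"
      have kC: "{J U, ?g} \<subseteq> C" using hG gC by blast
      have k: "J U \<preceq> ?k" "?g \<preceq> ?k" using J_upper[OF kC] by blast+
      have kG: "?k \<in> G" using join_connected[OF hG(1) _ qC(2) qh qg] gF FG by blast
      \<comment> \<open>The factor \<open>hat p\<close> absorbs \<open>q\<close>, so that only
        elements of \<open>F\<close> are joined.\<close>
      let ?W = "insert ?g (U - {q})"
      have WF: "?W \<subseteq> F" using U gF by blast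
      have WC: "?W \<subseteq> C" using WF F_C by blast
      have gW: "?g \<preceq> J ?W" using J_upper[OF WC] by blast
      have "J ?W = ?k"
      proof (rule J_eqI)
        fix w assume "w \<in> ?W"
        then consider "w = ?g" | "w \<in> U" by blast
        then show "w \<preceq> ?k"
        proof cases
          case 2
          then show ?thesis using J_upper[OF UC] k(1) lq_trans by blast
        qed (use k in simp)
      next
        have "u \<preceq> J ?W" if "u \<in> U" for u
        proof (cases "u = q")
          case True
          then show ?thesis using qg gW lq_trans by blast
        next
          case False
          then show ?thesis using that by (intro J_upper[OF WC]) blast
        qed
        then have "J U \<preceq> J ?W" by (intro J_leqI J_closed[OF WC])
        then show "?k \<preceq> J ?W" using gW by (intro J_leqI J_closed[OF WC]) blast
      qed
      then have "?k \<in> ?W" using F_nested[OF WF] kG by simp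
      then consider "?k = ?g" | "?k \<in> U" by blast
      then show False
      proof cases
        case 1
        then show False using k(1) False by simp
      next
        case 2
        then have "?k \<preceq> J U" by (rule J_upper[OF UC])
        then have "?k = J U" using k(1) lq_antisym by blast
        then show False using 2 h by simp
      qed
    qed
  qed
  moreover have hq: "hat q = ?g"
  proof (rule lq_antisym)
    show "hat q \<preceq> ?g" by (rule hat(3)[OF qH hat(1)[OF p] qg])
    show "?g \<preceq> hat q" by (rule hat(3)[OF p hat(1)[OF qH] lq_trans[OF q(2) hat(2)[OF qH]]])
  qed
  moreover have "zeta q = zeta p"
  proof (rule lq_antisym)
    have "q \<preceq> zeta p" unfolding V(3) zeta_insert[OF p] by (rule J_mono[OF DC V(1)])
    then show "zeta q \<preceq> zeta p" using zeta(2)[OF p] hq by (intro zeta_leqI) simp_all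
    have "p \<preceq> zeta q" using q(2) zeta(1)[OF qH] lq_trans by blast
    then show "zeta p \<preceq> zeta q" using zeta(2)[OF qH] hq by (intro zeta_leqI) simp_all
  qed
  ultimately show ?thesis using qH q(2) by blast
qed

text \<open>The factor \<open>hat p\<close> is fixed by \<open>zeta\<close>, so it and
  \<open>p\<close> have the same image, and \<open>lq_compatible\<close> puts \<open>hat p\<close>
  below \<open>p\<close>.\<close>

lemma zeta_eq_top:
  assumes p: "p \<in> H" "compatible {p}" and h: "hat p \<in> Ho" "zeta p = hat p"
  shows "p = hat p"
proof -
  have g: "hat p \<in> Fp" "hat p \<in> H" using hat(1)[OF p(1)] h by blast+
  have "hat p \<preceq> p"
    by (rule lq_compatible[OF g(2) p hat_self(1)[OF g]])
      (use hat_self(2)[OF g] h lq_refl[OF hat_C[OF p(1)]] in auto)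
  then show ?thesis using hat(2)[OF p(1)] lq_antisym by blast
qed

text \<open>As \<open>h\<close> and \<open>hat a\<close> share \<open>a\<close>, their join lies in
  \<open>G\<close> and hence in \<open>Ho\<close>; if \<open>hat a\<close> is a factor,
  compatibility makes the join one of the two.\<close>

lemma above_compatible:
  assumes a: "a \<in> H" and h: "h \<in> Ho" "compatible {h}" and ah: "a \<preceq> h"
  shows "hat a \<preceq> h \<or> hat h = hat a"
proof (rule ccontr)
  assume n: "\<not> ?thesis"
  have hH: "h \<in> H" using h by blast
  have le: "hat a \<preceq> hat h" using hat(3)[OF a hat(1)[OF hH]] lq_trans[OF ah hat(2)[OF hH]] by blast
  have "hat a \<noteq> tp" using n lq_tp[OF hat_C[OF hH]] le lq_antisym by metis
  then have gF: "hat a \<in> F" using hat(1)[OF a] by (auto simp: Fp_def)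
  let ?k = "J {h, hat a}"
  have kC: "{h, hat a} \<subseteq> C" using gF F_C Hin(1)[OF hH] by blast
  have k: "h \<preceq> ?k" "hat a \<preceq> ?k" using J_upper[OF kC] by blast+
  have "?k \<in> G" using join_connected[OF Hin(2)[OF hH] _ Hin(3)[OF a] ah hat(2)[OF a]] gF FG by blast
  then have "?k \<in> Ho" using up[OF h(1)] k(1) by blast
  moreover have "{h, hat a} \<subseteq> F \<union> {h}" using gF by blast
  ultimately have "?k \<in> {h, hat a}" using h(2) unfolding compatible_def by blast
  then consider "?k = h" | "?k = hat a" by blast
  then show False
  proof cases
    case 1
    then show False using k(2) n by simp
  next
    case 2
    then have "h \<preceq> hat a" using k(1) by simp
    then have "hat h \<preceq> hat a" using hat(3)[OF hH hat(1)[OF a]] by blast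
    then show False using le n lq_antisym by blast
  qed
qed

lemma zeta_mono:
  assumes "a \<in> H" "h \<in> H" "hat a = hat h" "a \<preceq> h"
  shows "zeta a \<preceq> zeta h"
proof (rule zeta_leqI)
  show "a \<preceq> zeta h" by (rule lq_trans[OF assms(4) zeta(1)[OF assms(2)]])
  show "zb (hat a) \<preceq> zeta h" using zeta(2)[OF assms(2)] assms(3) by simp
qed

section \<open>Atoms, joins and nested sets of the local lattices\<close>

lemma bottom_Lg:
  assumes g: "g \<in> Fp"
  shows "\<bottom>\<^bsub>Lg g\<^esub> = zb g"
proof -
  have gC: "g \<in> C" using g Fp_G by blast
  have z: "least (Lg g) (zb g) (carrier (Lg g))"
    unfolding least_def le_Lg using carrier_Lg[OF gC] zb_lq[OF gC] lq_refl[OF zb_C] by (auto simp: lq_def)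
  then have "least (Lg g) \<bottom>\<^bsub>Lg g\<^esub> (carrier (Lg g))" unfolding bottom_def by (rule someI)
  then have "\<bottom>\<^bsub>Lg g\<^esub> \<in> carrier (Lg g)" "\<bottom>\<^bsub>Lg g\<^esub> \<sqsubseteq>\<^bsub>L\<^esub> zb g"
    using z unfolding least_def le_Lg by blast+
  then have "\<bottom>\<^bsub>Lg g\<^esub> \<preceq> zb g" "zb g \<preceq> \<bottom>\<^bsub>Lg g\<^esub>" using carrier_Lg[OF gC] lq_iff lqD by (blast, blast)
  then show ?thesis by (rule lq_antisym)
qed

lemma zeta_atom_cover:
  assumes a: "a \<in> ats" and w: "zb (hat a) \<preceq> w" "w \<preceq> zeta a"
  shows "w = zb (hat a) \<or> w = zeta a"
proof -
  have "a \<in> H" using a atH by blast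
  from atom_cover[OF a zb_C not_lq_zb[OF this] w(1)] show ?thesis using w(2) unfolding zeta_def by blast
qed

text \<open>An atom of the interval lies above some atom \<open>a\<close> of \<open>L\<close> that
  is not below \<open>zb g\<close>; if \<open>hat a\<close> were smaller than \<open>g\<close>, it
  would be below \<open>zb g\<close>, and \<open>a\<close> too. The converse is
  semimodularity.\<close>

lemma atoms_Lg:
  assumes g: "g \<in> Fp"
  shows "w \<in> atoms (Lg g) \<longleftrightarrow> (\<exists>a\<in>ats. hat a = g \<and> zeta a = w)"
proof
  have gC: "g \<in> C" using g Fp_G by blast
  have at: "w \<in> atoms (Lg g) \<longleftrightarrow> zb g \<preceq> w \<and> w \<preceq> g \<and> w \<noteq> zb g \<and>
      (\<forall>v. zb g \<preceq> v \<and> v \<preceq> g \<longrightarrow> v \<preceq> w \<longrightarrow> v = zb g \<or> v = w)" for w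
  proof -
    have "w \<in> atoms (Lg g) \<longleftrightarrow> w \<in> carrier (Lg g) \<and> w \<noteq> zb g \<and>
        (\<forall>v\<in>carrier (Lg g). v \<sqsubseteq>\<^bsub>L\<^esub> w \<longrightarrow> v = zb g \<or> v = w)"
      by (simp add: atoms_def bottom_Lg[OF g] le_Lg)
    also have "\<dots> \<longleftrightarrow> w \<in> carrier (Lg g) \<and> w \<noteq> zb g \<and>
        (\<forall>v\<in>carrier (Lg g). v \<preceq> w \<longrightarrow> v = zb g \<or> v = w)"
      by (rule conj_cong[OF refl], rule conj_cong[OF refl], rule ball_cong[OF refl]) (simp add: le_Lg_iff[OF gC])
    finally show ?thesis by (auto simp: carrier_Lg[OF gC])
  qed
  {
    assume w: "w \<in> atoms (Lg g)"
    have wz: "zb g \<preceq> w" "w \<preceq> g" "w \<noteq> zb g" using w at by blast+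
    have "\<not> w \<preceq> zb g" using wz lq_antisym by blast
    then obtain a where a: "a \<in> ats" "a \<preceq> w" "\<not> a \<preceq> zb g"
      using ex_atom_not_lq[OF lqD(1)[OF wz(2)] zb_C] by blast
    have aH: "a \<in> H" using a atH by blast
    have le: "hat a \<preceq> g" using hat(3)[OF aH g] lq_trans[OF a(2) wz(2)] by blast
    have hg: "hat a = g"
    proof (rule ccontr)
      assume ne: "hat a \<noteq> g"
      have "hat a \<noteq> tp" using ne le lq_tp[OF gC] lq_antisym by metis
      then have "hat a \<in> F" using hat(1)[OF aH] by (auto simp: Fp_def)
      then have "hat a \<preceq> zb g" using lq_zb le ne by blast
      then show False using a(3) hat(2)[OF aH] lq_trans by blast
    qed
    have "zeta a \<preceq> w" by (rule zeta_leqI[OF a(2)]) (simp add: hg wz)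
    then have "zeta a = w" using w zeta(2,3,4)[OF aH] unfolding at hg by blast
    then show "\<exists>a\<in>ats. hat a = g \<and> zeta a = w" using a hg by blast
  next
    assume "\<exists>a\<in>ats. hat a = g \<and> zeta a = w"
    then obtain a where a: "a \<in> ats" "hat a = g" "zeta a = w" by blast
    have aH: "a \<in> H" using a atH by blast
    show "w \<in> atoms (Lg g)" unfolding at using zeta[OF aH] zeta_atom_cover[OF a(1)] a by blast
  }
qed

lemma atoms_Lg_Hg:
  assumes "g \<in> Fp"
  shows "atoms (Lg g) \<subseteq> Hg g"
proof
  fix w assume "w \<in> atoms (Lg g)"
  then obtain a where "a \<in> ats" "hat a = g" "zeta a = w" using atoms_Lg[OF assms] by blast
  then show "w \<in> Hg g" using Hg_iff[OF assms] atH by blast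
qed

text \<open>Below an element of \<open>G\<close> outside \<open>Ho\<close>, all elements of
  \<open>H\<close> are atoms, by upward closedness.\<close>

lemma Hg_trivial:
  assumes g: "g \<in> Fp" "g \<notin> Ho" and w: "w \<in> Hg g"
  shows "w \<in> atoms (Lg g)"
proof -
  obtain p where p: "p \<in> H" "hat p = g" "w = zeta p" using w Hg_iff[OF g(1)] by blast
  have "p \<preceq> g" using hat(2)[OF p(1)] p by simp
  then have "p \<notin> Ho" using up[of p g] g Fp_G by blast
  then show ?thesis using atoms_Lg[OF g(1)] p by blast
qed

text \<open>A nonempty join of elements of the interval stays in it. The empty join would be
  \<open>bt\<close> in \<open>L\<close> but \<open>zb g\<close> in the interval.\<close>

lemma sup_Lg:
  assumes g: "g \<in> Fp" and U: "U \<subseteq> Hg g" "U \<noteq> {}"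
  shows "\<Squnion>\<^bsub>Lg g\<^esub>U = J U"
proof -
  have gC: "g \<in> C" using g Fp_G by blast
  have UC: "U \<subseteq> C" using U Hg_C[OF g] by blast
  have Ub: "zb g \<preceq> u" "u \<preceq> g" if "u \<in> U" for u using Hg_bounds[OF g] U(1) that by blast+
  obtain u where u: "u \<in> U" using U by blast
  have "zb g \<preceq> J U" using lq_trans[OF Ub(1)[OF u] J_upper[OF UC u]] .
  moreover have "J U \<preceq> g" using Ub by (intro J_leqI gC)
  ultimately have JL: "J U \<in> carrier (Lg g)" using carrier_Lg[OF gC] by blast
  have ULg: "U \<subseteq> carrier (Lg g)" using Ub carrier_Lg[OF gC] by blast
  have upper: "v \<in> Upper (Lg g) U \<longleftrightarrow> v \<in> carrier (Lg g) \<and> (\<forall>u\<in>U. u \<preceq> v)" for v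
  proof -
    have "v \<in> Upper (Lg g) U \<longleftrightarrow> v \<in> carrier (Lg g) \<and> (\<forall>u\<in>U. u \<sqsubseteq>\<^bsub>L\<^esub> v)"
      unfolding Upper_def le_Lg using ULg by auto
    also have "\<dots> \<longleftrightarrow> v \<in> carrier (Lg g) \<and> (\<forall>u\<in>U. u \<preceq> v)"
      by (rule conj_cong[OF refl], rule ball_cong[OF refl]) (use ULg in \<open>auto simp: le_Lg_iff[OF gC]\<close>)
    finally show ?thesis .
  qed
  have lub: "is_lub (Lg g) (J U) U"
    unfolding least_def le_Lg
  proof (intro conjI ballI)
    show "Upper (Lg g) U \<subseteq> carrier (Lg g)" by (auto simp: Upper_def)
    show "J U \<in> Upper (Lg g) U" unfolding upper using JL J_upper[OF UC] by blast
    fix v assume "v \<in> Upper (Lg g) U"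
    then have v: "v \<in> carrier (Lg g)" "\<forall>u\<in>U. u \<preceq> v" unfolding upper by blast+
    have "v \<in> C" using v(1) carrier_Lg[OF gC] lqD by blast
    then have "J U \<preceq> v" by (rule J_leqI) (use v(2) in simp)
    then show "J U \<sqsubseteq>\<^bsub>L\<^esub> v" by (simp add: lq_def)
  qed
  then have s: "is_lub (Lg g) (\<Squnion>\<^bsub>Lg g\<^esub>U) U" unfolding sup_def by (rule someI)
  have "\<Squnion>\<^bsub>Lg g\<^esub>U \<in> carrier (Lg g)" using s unfolding least_def by blast
  then have sC: "\<Squnion>\<^bsub>Lg g\<^esub>U \<in> C" using carrier_Lg[OF gC] lqD by blast
  have JC: "J U \<in> C" by (rule J_closed[OF UC])
  have "\<Squnion>\<^bsub>Lg g\<^esub>U \<sqsubseteq>\<^bsub>L\<^esub> J U" "J U \<sqsubseteq>\<^bsub>L\<^esub> \<Squnion>\<^bsub>Lg g\<^esub>U"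
    using s lub unfolding least_def by (simp_all add: le_Lg)
  then show ?thesis using sC JC lq_iff lq_antisym by blast
qed

lemma nested_Lg:
  assumes g: "g \<in> Fp" and W: "W \<subseteq> Hg g"
  shows "W \<in> nested_sets (Lg g) (Hg g) \<longleftrightarrow> (\<forall>U\<subseteq>W. U \<noteq> {} \<longrightarrow> J U \<in> Hg g \<longrightarrow> J U \<in> U)"
proof -
  have "W \<in> nested_sets (Lg g) (Hg g) \<longleftrightarrow> W \<subseteq> Hg g \<and> (\<forall>U\<subseteq>W. U \<noteq> {} \<longrightarrow> J U \<in> Hg g \<longrightarrow> J U \<in> U)"
  proof (rule nested_crit)
    show WC: "W \<subseteq> C" using W Hg_C[OF g] by blast
    show "x \<sqsubseteq>\<^bsub>Lg g\<^esub> y \<longleftrightarrow> x \<preceq> y" if "x \<in> W" "y \<in> W" for x y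
      unfolding le_Lg using that WC lq_iff by blast
    show "\<Squnion>\<^bsub>Lg g\<^esub>U = J U" if "U \<subseteq> W" "U \<noteq> {}" for U
      by (rule sup_Lg[OF g]) (use that W in blast)+
  qed
  then show ?thesis using W by blast
qed

text \<open>The offending join \<open>h\<close> belongs to the factor \<open>g = hat h\<close>.
  Members of the offending set outside this factor lie below \<open>zb g\<close>, so the images of
  the others join to \<open>zeta h\<close>. Were \<open>zeta h\<close> among these images,
  \<open>lq_compatible\<close> would make \<open>h\<close> a member of the set.\<close>

lemma not_compatible_local:
  assumes T: "T \<subseteq> H" "\<And>t. t \<in> T \<Longrightarrow> compatible {t}" and nT: "\<not> compatible T"
  shows "\<exists>g\<in>Fp \<inter> Ho. \<exists>T'\<subseteq>T - F. (\<forall>t\<in>T'. hat t = g) \<and> zeta ` T' \<subseteq> Hg g \<and>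
    zeta ` T' \<notin> nested_sets (Lg g) (Hg g)"
proof -
  obtain U where U: "U \<subseteq> F \<union> T" "J U \<in> Ho" "J U \<notin> U" using nT unfolding compatible_def by blast
  let ?h = "J U"
  have hH: "?h \<in> H" using U by blast
  let ?g = "hat ?h"
  have g: "?g \<in> Fp" "?h \<preceq> ?g" using hat[OF hH] by blast+
  have gC: "?g \<in> C" "?g \<in> G" using g Fp_G by blast+
  have gHo: "?g \<in> Ho" using up[OF U(2) gC(2) g(2)] .
  have UC: "U \<subseteq> C" using U(1) F_C T(1) HC by blast
  have Uh: "u \<preceq> ?h" if "u \<in> U" for u using J_upper[OF UC that] .
  have ug: "u \<noteq> ?g" if "u \<in> U" for u
  proof
    assume "u = ?g"
    then have "?h = u" using Uh[OF that] g(2) lq_antisym by metis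
    then show False using that U(3) by simp
  qed
  have UF: "u \<preceq> zb ?g" if "u \<in> U" "u \<in> F" for u
    using lq_zb[OF that(2) lq_trans[OF Uh[OF that(1)] g(2)] ug[OF that(1)]] .
  define T' where "T' = {t \<in> U \<inter> T. hat t = ?g}"
  have Ut: "u \<preceq> zb ?g" if u: "u \<in> U" "u \<notin> T'" for u
  proof (cases "u \<in> F")
    case False
    then have uT: "u \<in> T" "hat u \<noteq> ?g" using u U(1) by (auto simp: T'_def)
    have uH: "u \<in> H" using uT T by blast
    have le: "hat u \<preceq> ?g" using hat(3)[OF uH g(1)] lq_trans[OF Uh[OF u(1)] g(2)] by blast
    have "hat u \<noteq> tp" using uT(2) le lq_tp[OF gC(1)] lq_antisym by metis
    then have "hat u \<in> F" using hat(1)[OF uH] by (auto simp: Fp_def)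
    then have "hat u \<preceq> zb ?g" using lq_zb le uT(2) by blast
    then show ?thesis using hat(2)[OF uH] lq_trans by blast
  qed (use UF u in blast)
  have T'H: "T' \<subseteq> H" using T by (auto simp: T'_def)
  have T'F: "T' \<inter> F = {}"
  proof (rule ccontr)
    assume "T' \<inter> F \<noteq> {}"
    then obtain t where t: "t \<in> T'" "t \<in> F" by blast
    then have "hat t = t" using hat_self(1)[of t] T'H by (auto simp: Fp_def)
    then show False using t ug by (auto simp: T'_def)
  qed
  have sub: "zeta ` T' \<subseteq> Hg ?g" using Hg_iff[OF g(1)] T'H by (auto simp: T'_def)
  have T'C: "zeta ` T' \<subseteq> C" using sub Hg_C[OF g(1)] by blast
  have ne: "T' \<noteq> {}"
  proof
    assume "T' = {}"
    then have "?h \<preceq> zb ?g" using Ut by (intro J_leqI zb_C) blast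
    then show False using not_lq_zb[OF hH] by blast
  qed
  have t1: "t \<preceq> zeta t" "zb ?g \<preceq> zeta t" "zeta t \<preceq> zeta ?h" if t: "t \<in> T'" for t
  proof -
    have tH: "t \<in> H" "hat t = ?g" "t \<preceq> ?h" using t T'H Uh by (auto simp: T'_def)
    show "t \<preceq> zeta t" "zb ?g \<preceq> zeta t" using zeta(1,2)[OF tH(1)] tH(2) by auto
    show "zeta t \<preceq> zeta ?h" by (rule zeta_mono[OF tH(1) hH tH(2,3)])
  qed
  have Jz: "J (zeta ` T') = zeta ?h"
  proof (rule J_eqI)
    show "w \<preceq> zeta ?h" if "w \<in> zeta ` T'" for w using that t1(3) by blast
    let ?j = "J (zeta ` T')"
    have jt: "zeta t \<preceq> ?j" if "t \<in> T'" for t using J_upper[OF T'C] that by blast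
    obtain t0 where "t0 \<in> T'" using ne by blast
    then have zj: "zb ?g \<preceq> ?j" using t1(2) jt lq_trans by blast
    have "u \<preceq> ?j" if u: "u \<in> U" for u
    proof (cases "u \<in> T'")
      case True
      then show ?thesis using t1(1) jt lq_trans by blast
    next
      case False
      then show ?thesis using Ut u zj lq_trans by blast
    qed
    then have "?h \<preceq> ?j" by (intro J_leqI J_closed[OF T'C])
    then show "zeta ?h \<preceq> ?j" using zj by (intro zeta_leqI)
  qed
  have "zeta ` T' \<notin> nested_sets (Lg ?g) (Hg ?g)"
  proof
    assume n: "zeta ` T' \<in> nested_sets (Lg ?g) (Hg ?g)"
    have "J (zeta ` T') \<in> Hg ?g" unfolding Jz using Hg_iff[OF g(1)] hH by blast
    then have "J (zeta ` T') \<in> zeta ` T'" using n nested_Lg[OF g(1) sub] ne by blast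
    then obtain t where t: "t \<in> T'" "zeta ?h = zeta t" unfolding Jz by blast
    have tT: "t \<in> T" "t \<in> U" "hat t = ?g" "t \<in> H" using t T'H by (auto simp: T'_def)
    have "?h \<preceq> t"
      by (rule lq_compatible[OF hH tT(4) T(2)[OF tT(1)]]) (use tT t U lq_refl lqD(1)[OF zeta(3)[OF hH]] in auto)
    then have "?h = t" using Uh[OF tT(2)] lq_antisym by blast
    then show False using U(3) tT(2) by simp
  qed
  moreover have "T' \<subseteq> T - F" using T'F by (auto simp: T'_def)
  moreover have "\<forall>t\<in>T'. hat t = ?g" by (simp add: T'_def)
  ultimately show ?thesis using g(1) gHo sub by blast
qed

text \<open>The transfer in the other direction, from a factor back to \<open>H\<close>. A set
  containing the top \<open>g\<close> has join \<open>g\<close> and violates nothing, so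
  \<open>V\<close> avoids \<open>g\<close>; this is needed because \<open>bwd\<close> sends
  \<open>g\<close> to a sum instead of a variable.\<close>

lemma not_nested_lift:
  assumes g: "g \<in> Fp" "g \<in> Ho" and W: "W \<subseteq> Hg g" "W \<notin> nested_sets (Lg g) (Hg g)"
    and q: "\<And>w. w \<in> W \<Longrightarrow> q w \<in> H \<and> compatible {q w} \<and> hat (q w) = g \<and> zeta (q w) = w"
  shows "\<exists>V\<subseteq>W. g \<notin> V \<and> \<not> compatible (q ` V)"
proof -
  obtain V where V: "V \<subseteq> W" "V \<noteq> {}" "J V \<in> Hg g" "J V \<notin> V" using W nested_Lg[OF g(1) W(1)] by blast
  have VC: "V \<subseteq> C" using V(1) W(1) Hg_C[OF g(1)] by blast
  have gC: "g \<in> C" using g Fp_G by blast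
  have Vb: "zb g \<preceq> v" "v \<preceq> g" "v \<noteq> zb g" if "v \<in> V" for v using Hg_bounds[OF g(1)] V(1) W(1) that by blast+
  have w0: "zb g \<preceq> J V" "J V \<preceq> g" using Hg_bounds[OF g(1) V(3)] by blast+
  have gV: "g \<notin> V"
  proof
    assume gV: "g \<in> V"
    then have "g \<preceq> J V" by (rule J_upper[OF VC])
    then have "J V = g" using w0(2) lq_antisym by blast
    then show False using gV V(4) by simp
  qed
  obtain p where p: "p \<in> H" "hat p = g" "J V = zeta p" using V(3) Hg_iff[OF g(1)] by blast
  \<comment> \<open>If \<open>p\<close> were an atom, \<open>zeta p\<close> would cover
    \<open>zb g\<close>, and any member of \<open>V\<close> would coincide with the join of
    \<open>V\<close>.\<close>
  have pHo: "p \<in> Ho"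
  proof (rule ccontr)
    assume "p \<notin> Ho"
    then have pa: "p \<in> ats" using p by blast
    obtain v where v: "v \<in> V" using V(2) by blast
    have "v \<preceq> zeta p" using J_upper[OF VC v] p(3) by simp
    then have "v = zeta p" using zeta_atom_cover[OF pa, of v] Vb[OF v] p(2) by blast
    then show False using V(4) v p(3) by simp
  qed
  have qv: "q v \<in> H" "compatible {q v}" "hat (q v) = g" "zeta (q v) = v" if "v \<in> V" for v using q V(1) that by blast+
  have "\<not> compatible (q ` V)"
  proof
    assume c: "compatible (q ` V)"
    let ?D = "{f \<in> F. f \<sqsubseteq>\<^bsub>L\<^esub> g \<and> f \<noteq> g}"
    let ?U = "q ` V \<union> ?D"
    have UG: "?U \<subseteq> G" using qv(1) Hin(2) FG by blast
    have UC: "?U \<subseteq> C" using UG GC by blast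
    have zU: "zb g \<preceq> J ?U" unfolding zb_def by (rule J_mono[OF UC]) blast
    have "v \<preceq> J ?U" if v: "v \<in> V" for v
    proof -
      have "q v \<preceq> J ?U" using v by (intro J_upper[OF UC]) blast
      then have "zeta (q v) \<preceq> J ?U" using zU qv(3)[OF v] by (intro zeta_leqI) simp_all
      then show ?thesis using qv(4)[OF v] by simp
    qed
    then have "J V \<preceq> J ?U" by (intro J_leqI J_closed[OF UC])
    moreover have "p \<preceq> J V" using zeta(1)[OF p(1)] p(3) by simp
    ultimately have "p \<preceq> J ?U" using lq_trans by blast
    then obtain V2 where V2: "V2 \<subseteq> ?U" "J V2 \<in> G" "p \<preceq> J V2"
      using building_cover[OF UG Hin(2)[OF p(1)]] by blast
    have "J V2 \<in> Ho" using up[OF pHo V2(2,3)] .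
    moreover have "V2 \<subseteq> F \<union> q ` V" using V2(1) by blast
    ultimately have "J V2 \<in> V2" using c unfolding compatible_def by blast
    then consider v where "v \<in> V" "J V2 = q v" | "J V2 \<in> F" "J V2 \<preceq> g" "J V2 \<noteq> g"
      using V2(1) below_iff[OF gC] by blast
    then show False
    proof cases
      case 1
      then have "p \<preceq> q v" using V2(3) by simp
      then have "zeta p \<preceq> zeta (q v)" using zeta_mono[OF p(1) qv(1)[OF 1(1)]] p(2) qv(3)[OF 1(1)] by simp
      then have "J V \<preceq> v" using p(3) qv(4)[OF 1(1)] by simp
      then have "J V = v" using J_upper[OF VC 1(1)] lq_antisym by blast
      then show False using V(4) 1(1) by simp
    next
      case 2
      then have "hat p \<preceq> J V2" using hat(3)[OF p(1)] V2(3) by (auto simp: Fp_def)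
      then show False using 2 p(2) lq_antisym by metis
    qed
  qed
  then show ?thesis using V(1) gV by blast
qed

end

section \<open>The substitutions\<close>

lemma DP_rels_carrier: "DP_rels M K S \<subseteq> carrier (poly_algebra K)"
  unfolding DP_rels_def DP_lin_def
  by (auto intro!: poly_carrier_prod poly_carrier_sum poly_carrier_pvar)

context nested_factors
begin

lemma finH: "finite H"
  by (rule finS[OF HC])

lemma finHg: "g \<in> Fp \<Longrightarrow> finite (Hg g)"
  by (rule finS[OF Hg_C])

lemma finFp: "finite Fp"
  by (rule finS[OF Fp_G(2)])

definition "upper_sum g = (\<Sum>h\<in>{h \<in> H. g \<preceq> h}. pvar h)"
definition "strict_upper p = {h \<in> H. p \<preceq> h \<and> h \<noteq> p}"

lemma DP_lin_lin: "g \<in> C \<Longrightarrow> DP_lin L H g = upper_sum g"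
  unfolding DP_lin_def upper_sum_def by (rule sum.cong) (use HC in \<open>auto simp: lq_def\<close>)

lemma finite_above: "finite (strict_upper p)"
  using finH by (simp add: strict_upper_def)

lemma lq_split: "p \<in> H \<Longrightarrow> {h \<in> H. p \<preceq> h} = insert p (strict_upper p)"
  using lq_refl[OF Hin(1)] by (auto simp: strict_upper_def)

lemma sum_lq: "p \<in> H \<Longrightarrow> (\<Sum>h\<in>{h \<in> H. p \<preceq> h}. f h) = f p + (\<Sum>h\<in>strict_upper p. f h)"
  unfolding lq_split by (rule sum.insert[OF finite_above]) (simp add: strict_upper_def)

text \<open>The source is \<open>DP_y\<close>, the target the tensor product. The substitution is forced on
  the elements of \<open>F\<close> and on the trivial factors by the requirement that \<open>c_g\<close> maps to
  \<open>x_g\<close>, respectively to \<open>0\<close>.\<close>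

definition fwd_step :: "('a \<Rightarrow> ('a \<Rightarrow>\<^sub>0 nat) \<Rightarrow>\<^sub>0 rat) \<Rightarrow> 'a \<Rightarrow> ('a \<Rightarrow>\<^sub>0 nat) \<Rightarrow>\<^sub>0 rat" where
  "fwd_step s p =
     (if p \<in> F \<inter> Ho \<or> hat p \<notin> Ho then (if p \<in> F \<inter> Ho then pvar p else 0) - (\<Sum>h\<in>strict_upper p. s h)
      else if compatible {p} then pvar (zeta p) else 0)"

definition "above_rel = {(h, p). p \<preceq> h \<and> h \<noteq> p}"
definition "fwd = wfrec above_rel fwd_step"
text \<open>The choice is ambiguous only between atoms with the same image, whose variables agree
  modulo the ideal.\<close>

definition "compatible_rep w = (SOME q. q \<in> H \<and> compatible {q} \<and> zeta q = w)"
definition "bwd w = (if hat (compatible_rep w) \<notin> Ho then 0 else if w = hat (compatible_rep w) then upper_sum w else pvar (compatible_rep w))"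

text \<open>The recursion of \<open>fwd\<close> runs from larger to smaller elements; a strictly
  larger element has fewer elements above it.\<close>

lemma wf_above: "wf above_rel"
proof (rule wf_subset[OF wf_measure])
  show "above_rel \<subseteq> measure (\<lambda>p. card {w \<in> C. p \<preceq> w})"
  proof
    fix x assume "x \<in> above_rel"
    then obtain h p where x: "x = (h, p)" "p \<preceq> h" "h \<noteq> p" by (auto simp: above_rel_def)
    have "{w \<in> C. h \<preceq> w} \<subseteq> {w \<in> C. p \<preceq> w}" using x lq_trans by blast
    moreover have "p \<in> {w \<in> C. p \<preceq> w}" "p \<notin> {w \<in> C. h \<preceq> w}"
      using x lq_refl lqD(1)[OF x(2)] lq_antisym by blast+
    ultimately have "{w \<in> C. h \<preceq> w} \<subset> {w \<in> C. p \<preceq> w}" by blast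
    then have "card {w \<in> C. h \<preceq> w} < card {w \<in> C. p \<preceq> w}"
      by (rule psubset_card_mono[rotated]) (simp add: finC)
    then show "x \<in> measure (\<lambda>p. card {w \<in> C. p \<preceq> w})" by (simp add: x)
  qed
qed

lemma fwd: "fwd p = fwd_step fwd p"
proof -
  have "(\<Sum>h\<in>strict_upper p. cut fwd above_rel p h) = (\<Sum>h\<in>strict_upper p. fwd h)"
    by (rule sum.cong) (auto simp: strict_upper_def above_rel_def cut_def)
  then have "fwd_step (cut fwd above_rel p) p = fwd_step fwd p" by (simp add: fwd_step_def)
  moreover have "fwd p = fwd_step (cut fwd above_rel p) p"
    by (rule def_wfrec[OF eq_reflection[OF fwd_def] wf_above])
  ultimately show ?thesis by simp
qed

lemma fwd_sum:
  assumes "p \<in> H" "p \<in> F \<inter> Ho \<or> hat p \<notin> Ho"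
  shows "fwd p + (\<Sum>h\<in>strict_upper p. fwd h) = (if p \<in> F \<inter> Ho then pvar p else 0)"
  using fwd[of p] assms(2) by (simp add: fwd_step_def)

lemma fwd_zeta:
  assumes "p \<notin> F" "hat p \<in> Ho"
  shows "fwd p = (if compatible {p} then pvar (zeta p) else 0)"
  using fwd[of p] assms by (simp add: fwd_step_def)

lemma above_H: "h \<in> strict_upper p \<Longrightarrow> h \<in> H"
  by (simp add: strict_upper_def)

lemma above_induct [consumes 1, case_names less]:
  assumes "p \<in> H" "\<And>p. p \<in> H \<Longrightarrow> (\<And>h. h \<in> strict_upper p \<Longrightarrow> P h) \<Longrightarrow> P p"
  shows "P p"
  using wf_above assms(1)
proof (induction p rule: wf_induct_rule)
  case (less p)
  show ?case
  proof (rule assms(2)[OF less.prems])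
    fix h assume "h \<in> strict_upper p"
    then show "P h" using less.IH[of h] by (auto simp: strict_upper_def above_rel_def)
  qed
qed

text \<open>The choice prescribes only the image; since the local building sets are disjoint, the
  image determines the factor.\<close>

lemma compatible_rep:
  assumes g: "g \<in> Fp" and w: "w \<in> Hg g"
  shows "compatible_rep w \<in> H" "compatible {compatible_rep w}" "zeta (compatible_rep w) = w" "hat (compatible_rep w) = g"
proof -
  obtain p where p: "p \<in> H" "hat p = g" "w = zeta p" using w Hg_iff[OF g] by blast
  have "\<exists>q. q \<in> H \<and> compatible {q} \<and> zeta q = w" using ex_compatible[OF p(1)] p(3) by blast
  then have *: "compatible_rep w \<in> H \<and> compatible {compatible_rep w} \<and> zeta (compatible_rep w) = w" unfolding compatible_rep_def by (rule someI_ex)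
  then show "compatible_rep w \<in> H" "compatible {compatible_rep w}" "zeta (compatible_rep w) = w" by blast+
  have h: "hat (compatible_rep w) \<in> Fp" using * hat(1) by blast
  have "w \<in> Hg (hat (compatible_rep w))"
    unfolding Hg_iff[OF h] by (rule bexI[of _ "compatible_rep w"]) (use * in simp_all)
  then show "hat (compatible_rep w) = g" using Hg_disjoint[OF h g _ w] by blast
qed

lemma Fp_Hg:
  assumes "g \<in> Fp" "g \<in> Ho"
  shows "g \<in> Hg g"
proof -
  have gH: "g \<in> H" using assms(2) by blast
  show ?thesis unfolding Hg_iff[OF assms(1)] using hat_self[OF assms(1) gH] gH by auto
qed

text \<open>Below a factor outside \<open>Ho\<close> all elements of \<open>H\<close> are atoms, so
  a compatible element above \<open>p\<close> with the same factor is \<open>p\<close>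
  itself.\<close>

lemma trivial_compatible:
  assumes p: "p \<in> H" "hat p \<notin> Ho"
  shows "p \<in> ats" "compatible {p}"
proof -
  have at: "q \<in> ats" if q: "q \<in> H" "hat q \<notin> Ho" for q
  proof -
    have "hat q \<in> G" using hat(1)[OF q(1)] Fp_G by blast
    then have "q \<notin> Ho" using up[of q "hat q"] hat(2)[OF q(1)] q(2) by blast
    then show ?thesis using q(1) by blast
  qed
  show pa: "p \<in> ats" by (rule at[OF p])
  obtain q where q: "q \<in> H" "compatible {q}" "p \<preceq> q" "hat q = hat p" using ex_compatible[OF p(1)] by blast
  have "q \<in> ats" by (rule at) (use q p in simp_all)
  then have "p = q" using atom_lq_atom[OF pa] q(3) by blast
  then show "compatible {p}" using q(2) by simp
qed

text \<open>For \<open>g\<close> in \<open>F\<close> this is the recursion of \<open>fwd\<close>.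
  Otherwise \<open>g\<close> is the top of \<open>L\<close>, and the sum has a single term.\<close>

lemma fwd_lin_Fp:
  assumes g: "g \<in> Fp" "g \<in> Ho"
  shows "(\<Sum>h\<in>{h \<in> H. g \<preceq> h}. fwd h) = pvar g"
proof (cases "g \<in> F")
  case True
  then show ?thesis using fwd_sum[of g] g sum_lq[of g fwd] by auto
next
  case False
  then have gt: "g = tp" using g by (simp add: Fp_def)
  have gH: "g \<in> H" using g by blast
  have "strict_upper g = {}"
    unfolding strict_upper_def gt using lq_tp lqD(2) lq_antisym by blast
  then have "(\<Sum>h\<in>{h \<in> H. g \<preceq> h}. fwd h) = fwd g" using sum_lq[OF gH, of fwd] by simp
  also have "\<dots> = pvar g"
    using fwd_zeta[OF False] hat_self[OF g(1) gH] g(2) compatible_Fp[OF g(1)] by simp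
  finally show ?thesis .
qed

text \<open>The sum is cut at \<open>hat a\<close>. The part above it gives the variable of
  \<open>hat a\<close>; the rest is summed over \<open>X\<close>, where only the compatible elements
  \<open>Y\<close> survive, and these are matched by \<open>zeta\<close> with
  \<open>Z\<close>.\<close>

lemma fwd_lin_atom:
  assumes a: "a \<in> ats" and g: "hat a \<in> Ho"
  shows "(\<Sum>h\<in>{h \<in> H. a \<preceq> h}. fwd h) = (\<Sum>w\<in>{w \<in> Hg (hat a). zeta a \<preceq> w}. pvar w)"
proof -
  let ?g = "hat a"
  have aH: "a \<in> H" using a atH by blast
  have gF: "?g \<in> Fp" and ag: "a \<preceq> ?g" using hat[OF aH] by blast+
  have gH: "?g \<in> H" using g by blast
  have gHg: "?g \<in> Hg ?g" by (rule Fp_Hg[OF gF g])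
  define X where "X = {h \<in> H. a \<preceq> h \<and> \<not> ?g \<preceq> h}"
  define Y where "Y = {h \<in> X. compatible {h}}"
  define Z where "Z = {w \<in> Hg ?g. zeta a \<preceq> w \<and> w \<noteq> ?g}"
  have finX: "finite X" using finH by (simp add: X_def)
  have sp: "{h \<in> H. a \<preceq> h} = {h \<in> H. ?g \<preceq> h} \<union> X" "{h \<in> H. ?g \<preceq> h} \<inter> X = {}"
    unfolding X_def using ag lq_trans by blast+
  have fX: "fwd h = (if compatible {h} then pvar (zeta h) else 0)" if h: "h \<in> X" for h
  proof (rule fwd_zeta)
    have hH: "h \<in> H" "a \<preceq> h" "\<not> ?g \<preceq> h" using h by (auto simp: X_def)
    show "h \<notin> F"
    proof
      assume "h \<in> F"
      then have "?g \<preceq> h" using hat(3)[OF aH _ hH(2)] by (auto simp: Fp_def)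
      then show False using hH by blast
    qed
    have "?g \<preceq> hat h" using hat(3)[OF aH hat(1)[OF hH(1)] lq_trans[OF hH(2) hat(2)[OF hH(1)]]] .
    moreover have "hat h \<in> G" using hat(1)[OF hH(1)] Fp_G by blast
    ultimately show "hat h \<in> Ho" using up[OF g] by blast
  qed
  have Y: "h \<in> H" "a \<preceq> h" "\<not> ?g \<preceq> h" "compatible {h}" "hat h = ?g" "h = a \<or> h \<in> Ho" if h: "h \<in> Y" for h
  proof -
    show 1: "h \<in> H" "a \<preceq> h" "\<not> ?g \<preceq> h" "compatible {h}" using h by (auto simp: X_def Y_def)
    \<comment> \<open>The only atom above \<open>a\<close> is \<open>a\<close>. So of two different
      elements of \<open>Y\<close> one lies in \<open>Ho\<close>, which is what makes
      \<open>zeta\<close> injective there.\<close>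
    show 2: "h = a \<or> h \<in> Ho" using 1 atom_lq_atom[OF a, of h] by blast
    show "hat h = ?g" using 2 above_compatible[OF aH _ 1(4,2)] 1(3) by blast
  qed
  have bij: "bij_betw zeta Y Z"
    unfolding bij_betw_def
  proof
    show "inj_on zeta Y"
    proof (rule inj_onI)
      fix h h' assume h: "h \<in> Y" "h' \<in> Y" "zeta h = zeta h'"
      have zz: "zeta h \<preceq> zeta h'" "zeta h' \<preceq> zeta h"
        using h(3) lq_refl[OF lqD(1)[OF zeta(3)[OF Y(1)[OF h(1)]]]] by simp_all
      show "h = h'"
      proof (cases "h \<in> Ho \<or> h' \<in> Ho")
        case True
        have "h \<preceq> h'"
          by (rule lq_compatible[OF Y(1)[OF h(1)] Y(1,4)[OF h(2)] _ zz(1)]) (use True Y(5) h in auto)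
        moreover have "h' \<preceq> h"
          by (rule lq_compatible[OF Y(1)[OF h(2)] Y(1,4)[OF h(1)] _ zz(2)]) (use True Y(5) h in auto)
        ultimately show ?thesis by (rule lq_antisym)
      next
        case False
        then show ?thesis using Y(6)[OF h(1)] Y(6)[OF h(2)] by blast
      qed
    qed
    show "zeta ` Y = Z"
    proof (intro equalityI subsetI)
      fix w assume "w \<in> zeta ` Y"
      then obtain h where h: "h \<in> Y" "w = zeta h" by blast
      note Yh = Y[OF h(1)]
      have "w \<in> Hg ?g" using Hg_iff[OF gF] Yh h(2) by blast
      moreover have "zeta a \<preceq> w" unfolding h(2) by (rule zeta_mono[OF aH Yh(1)]) (use Yh in auto)
      moreover have "w \<noteq> ?g"
      proof
        assume "w = ?g"
        then have "h = ?g" using zeta_eq_top[OF Yh(1,4)] Yh(5) g h(2) by simp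
        then show False using Yh(3) lq_refl Hin(1)[OF gH] by simp
      qed
      ultimately show "w \<in> Z" by (simp add: Z_def)
    next
      fix w assume "w \<in> Z"
      then have w: "w \<in> Hg ?g" "zeta a \<preceq> w" "w \<noteq> ?g" by (auto simp: Z_def)
      have "\<exists>q\<in>H. compatible {q} \<and> a \<preceq> q \<and> hat q = ?g \<and> zeta q = w"
      proof (cases "w = zeta a")
        case True
        \<comment> \<open>The atom \<open>a\<close> need not be compatible; a compatible element
          above it with the same image takes its place.\<close>
        then show ?thesis using ex_compatible[OF aH] by auto
      next
        case False
        note q = compatible_rep[OF gF w(1)]
        \<comment> \<open>Otherwise \<open>w\<close> would cover the bottom of the interval and
          leave no room for \<open>zeta a\<close> strictly below it.\<close>
        have "compatible_rep w \<notin> ats"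
        proof
          assume ra: "compatible_rep w \<in> ats"
          have "zb (hat (compatible_rep w)) \<preceq> zeta a" "zeta a \<preceq> zeta (compatible_rep w)" using zeta(2)[OF aH] q w(2) by simp_all
          then have "zeta a = zb ?g \<or> zeta a = w" using zeta_atom_cover[OF ra] q by auto
          then show False using zeta(4)[OF aH] False by simp
        qed
        then have "compatible_rep w \<in> Ho" using q(1) by blast
        then have "a \<preceq> compatible_rep w" using lq_compatible[OF aH q(1,2)] q w(2) by simp
        then show ?thesis using q by blast
      qed
      then obtain q where q: "q \<in> H" "compatible {q}" "a \<preceq> q" "hat q = ?g" "zeta q = w" by blast
      have "\<not> ?g \<preceq> q"
      proof
        assume "?g \<preceq> q"
        then have "q = ?g" using hat(2)[OF q(1)] q(4) lq_antisym by metis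
        then show False using q(5) hat_self(2)[OF gF gH] w(3) by simp
      qed
      then have "q \<in> Y" using q by (simp add: Y_def X_def)
      then show "w \<in> zeta ` Y" using q(5) by blast
    qed
  qed
  have finHg': "finite (Hg ?g)" by (rule finHg[OF gF])
  have "(\<Sum>h\<in>{h \<in> H. a \<preceq> h}. fwd h) = (\<Sum>h\<in>{h \<in> H. ?g \<preceq> h}. fwd h) + (\<Sum>h\<in>X. fwd h)"
    unfolding sp(1) by (rule sum.union_disjoint) (use finH finX sp(2) in auto)
  also have "(\<Sum>h\<in>{h \<in> H. ?g \<preceq> h}. fwd h) = pvar ?g" by (rule fwd_lin_Fp[OF gF g])
  also have "(\<Sum>h\<in>X. fwd h) = (\<Sum>h\<in>Y. pvar (zeta h))"
    unfolding Y_def by (rule sum.mono_neutral_cong_right) (use finX fX in auto)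
  also have "\<dots> = (\<Sum>w\<in>Z. pvar w)" by (rule sum.reindex_bij_betw[OF bij])
  also have "pvar ?g + (\<Sum>w\<in>Z. pvar w) = (\<Sum>w\<in>insert ?g Z. pvar w)"
    using finHg' by (simp add: Z_def)
  also have "insert ?g Z = {w \<in> Hg ?g. zeta a \<preceq> w}"
    unfolding Z_def using gHg zeta(3)[OF aH] by blast
  finally show ?thesis .
qed

lemma DP_lin_Lg:
  assumes g: "g \<in> Fp" and w: "w \<in> Hg g"
  shows "DP_lin (Lg g) (Hg g) w = (\<Sum>v\<in>{v \<in> Hg g. w \<preceq> v}. pvar v)"
  unfolding DP_lin_def le_Lg
  by (rule sum.cong) (use w Hg_C[OF g] in \<open>auto simp: lq_def\<close>)

end

section \<open>The isomorphism between the two presentations\<close>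

locale factor_presentation = nested_factors L G H F for L :: "'a gorder" and G H F +
  fixes I Sc :: "'a set"
  assumes I: "Fp \<inter> Ho \<subseteq> I" "I \<subseteq> Fp"
    and Sc: "\<And>T. T \<subseteq> H \<Longrightarrow> Sc \<union> T \<in> nested_sets L H \<longleftrightarrow> compatible T"
begin

definition "local_rels g = DP_rels (Lg g) (Hg g) {}"

sublocale T: presented_family I Hg local_rels
proof
  show "finite I" by (rule finite_subset[OF I(2) finFp])
  show "disjoint_family_on Hg I"
    unfolding disjoint_family_on_def
  proof (intro ballI impI)
    fix m n assume "m \<in> I" "n \<in> I" "m \<noteq> n"
    moreover from this have "m \<in> Fp" "n \<in> Fp" using I(2) by blast+
    ultimately show "Hg m \<inter> Hg n = {}" using Hg_disjoint[of m n] by blast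
  qed
  show "local_rels i \<subseteq> carrier (poly_algebra (Hg i))" if "i \<in> I" for i
    unfolding local_rels_def by (rule DP_rels_carrier)
qed

definition "Iy = Idl\<^bsub>poly_algebra H\<^esub> (DP_rels L H Sc)"

lemma Iy: "ideal Iy (poly_algebra H)" "DP_rels L H Sc \<subseteq> Iy"
  unfolding Iy_def by (rule poly_genideal[OF DP_rels_carrier])+

lemma rels_T: "g \<in> I \<Longrightarrow> local_rels g \<subseteq> T.J"
  unfolding T.J_def using poly_genideal(2)[OF T.R_W] by blast

lemma Iy_prod:
  assumes "S \<subseteq> H" "\<not> compatible S"
  shows "(\<Prod>p\<in>S. pvar p) \<in> Iy"
proof -
  have "Sc \<union> S \<notin> nested_sets L H" using Sc[OF assms(1)] assms(2) by simp
  then have "(\<Prod>p\<in>S. pvar p) \<in> DP_rels L H Sc" unfolding DP_rels_def using assms(1) by blast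
  then show ?thesis using Iy(2) by blast
qed

lemma Iy_lin:
  assumes "a \<in> ats"
  shows "upper_sum a \<in> Iy"
proof -
  have "DP_lin L H a \<in> DP_rels L H Sc" unfolding DP_rels_def using assms by blast
  then show ?thesis using Iy(2) DP_lin_lin[OF atomD(1)[OF assms]] by auto
qed

lemma Iy_pvar: "p \<in> H \<Longrightarrow> \<not> compatible {p} \<Longrightarrow> pvar p \<in> Iy"
  using Iy_prod[of "{p}"] by simp

text \<open>Only variables of nontrivial factors occur in \<open>fwd\<close>, so its values lie in
  the target for every index set that contains these factors.\<close>

lemma fwd_grade:
  assumes "p \<in> H"
  shows "fwd p \<in> grade (poly_algebra T.W) 2"
  using assms
proof (induction p rule: above_induct)
  case (less p)
  have W: "w \<in> T.W" if "g \<in> Fp" "g \<in> Ho" "w \<in> Hg g" for g w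
  proof -
    have "g \<in> I" using I(1) that(1,2) by blast
    then show ?thesis unfolding T.W_def using that(3) by blast
  qed
  have 1: "pvar p \<in> grade (poly_algebra T.W) 2" if p: "p \<in> F \<inter> Ho"
  proof -
    have "p \<in> Fp" using p by (simp add: Fp_def)
    then show ?thesis using W[of p p] Fp_Hg[of p] p by (intro grade_poly_pvar) simp
  qed
  have 2: "pvar (zeta p) \<in> grade (poly_algebra T.W) 2" if "hat p \<in> Ho"
  proof (rule grade_poly_pvar[OF W[OF hat(1)[OF less(1)] that]])
    show "zeta p \<in> Hg (hat p)" unfolding Hg_iff[OF hat(1)[OF less(1)]] using less(1) by blast
  qed
  have 3: "(\<Sum>h\<in>strict_upper p. fwd h) \<in> grade (poly_algebra T.W) 2" using less.IH by (rule grade_poly_sum)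
  show ?case
    unfolding fwd[of p] fwd_step_def using 1 2 3 by (auto intro: grade_poly_diff grade_poly_uminus)
qed

lemma lin_grade: "upper_sum g \<in> grade (poly_algebra H) 2"
  unfolding upper_sum_def by (intro grade_poly_sum grade_poly_pvar) simp

lemma bwd_grade:
  assumes "w \<in> T.W"
  shows "bwd w \<in> grade (poly_algebra H) 2"
proof -
  obtain g where g: "g \<in> Fp" "w \<in> Hg g" using assms I(2) unfolding T.W_def by blast
  show ?thesis unfolding bwd_def using compatible_rep(1)[OF g] by (auto intro: lin_grade grade_poly_pvar)
qed

text \<open>An element incompatible by itself is sent to 0. If all are compatible singly, the
  failure shows in one nontrivial factor, on elements outside \<open>F\<close>, and there
  \<open>fwd\<close> gives variables.\<close>

lemma fwd_prod:
  assumes S: "S \<subseteq> H" and nS: "\<not> compatible S"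
  shows "(\<Prod>p\<in>S. fwd p) \<in> T.J"
proof (cases "\<forall>p\<in>S. compatible {p}")
  case False
  then obtain p where p: "p \<in> S" "\<not> compatible {p}" by blast
  have pH: "p \<in> H" using p S by blast
  have "hat p \<in> Ho" using trivial_compatible(2)[OF pH] p(2) by blast
  moreover have "p \<notin> F" using compatible_Fp[of p] p(2) by (auto simp: Fp_def)
  ultimately have "fwd p = 0" using fwd_zeta p(2) by simp
  then have "(\<Prod>p\<in>S. fwd p) = 0" using p(1) finite_subset[OF S finH] by (intro prod_zero) auto
  then show ?thesis using poly_ideal_0[OF T.J] by simp
next
  case True
  have cp: "compatible {t}" if "t \<in> S" for t using True that by blast
  obtain g where "g \<in> Fp \<inter> Ho" and ex: "\<exists>S'\<subseteq>S - F. (\<forall>t\<in>S'. hat t = g) \<and> zeta ` S' \<subseteq> Hg g \<and>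
      zeta ` S' \<notin> nested_sets (Lg g) (Hg g)"
    using not_compatible_local[OF S cp nS] by (rule bexE)
  then have g: "g \<in> Fp" "g \<in> Ho" by blast+
  from ex obtain S' where S': "S' \<subseteq> S - F" "\<forall>t\<in>S'. hat t = g"
    "zeta ` S' \<subseteq> Hg g" "zeta ` S' \<notin> nested_sets (Lg g) (Hg g)" by (elim exE conjE)
  have gI: "g \<in> I" using g I(1) by blast
  \<comment> \<open>Different elements of \<open>S'\<close> may have the same image, while the
    relation contains each variable once; so one preimage of each is kept.\<close>
  obtain U where U: "U \<subseteq> S'" "inj_on zeta U" "zeta ` S' = zeta ` U"
    using subset_image_inj[of "zeta ` S'" zeta S'] by blast
  have US: "U \<subseteq> S" using U(1) S'(1) by blast
  have "(\<Prod>p\<in>U. fwd p) = (\<Prod>p\<in>U. pvar (zeta p))"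
  proof (rule prod.cong[OF refl])
    fix p assume "p \<in> U"
    then have "p \<in> S'" using U(1) by blast
    then have "p \<notin> F" "hat p = g" "compatible {p}" using S'(1,2) cp by auto
    then have "p \<notin> F" "hat p \<in> Ho" "compatible {p}" using g(2) by auto
    then show "fwd p = pvar (zeta p)" using fwd_zeta by simp
  qed
  also have "\<dots> = (\<Prod>w\<in>zeta ` S'. pvar w)" unfolding U(3) by (simp add: prod.reindex[OF U(2)])
  also have "\<dots> \<in> T.J"
  proof -
    have "(\<Prod>w\<in>zeta ` S'. pvar w) \<in> local_rels g"
      unfolding local_rels_def DP_rels_def using S'(3,4) by auto
    then show ?thesis using rels_T[OF gI] by blast
  qed
  finally show ?thesis
    by (rule poly_ideal_prod_dvd[OF T.J US finite_subset[OF S finH]])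
      (use S fwd_grade grade_poly_carrier in blast)
qed

lemma fwd_rels:
  assumes "r \<in> DP_rels L H Sc"
  shows "psubst fwd r \<in> T.J"
proof -
  from assms consider S where "S \<subseteq> H" "Sc \<union> S \<notin> nested_sets L H" "r = (\<Prod>p\<in>S. pvar p)"
    | a where "a \<in> ats" "r = DP_lin L H a"
    unfolding DP_rels_def by blast
  then show ?thesis
  proof cases
    case 1
    then show ?thesis using fwd_prod[OF 1(1)] Sc[OF 1(1)] by (simp add: psubst_prod)
  next
    case 2
    have aH: "a \<in> H" using 2 atH by blast
    have eq: "psubst fwd r = (\<Sum>h\<in>{h \<in> H. a \<preceq> h}. fwd h)"
      unfolding 2(2) DP_lin_lin[OF Hin(1)[OF aH]] upper_sum_def psubst_sum by simp
    show ?thesis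
    proof (cases "hat a \<in> Ho")
      case True
      have gF: "hat a \<in> Fp" by (rule hat(1)[OF aH])
      have za: "zeta a \<in> atoms (Lg (hat a))" using atoms_Lg[OF gF] 2(1) by blast
      then have "zeta a \<in> Hg (hat a)" using atoms_Lg_Hg[OF gF] by blast
      then have "psubst fwd r = DP_lin (Lg (hat a)) (Hg (hat a)) (zeta a)"
        unfolding eq fwd_lin_atom[OF 2(1) True] by (rule DP_lin_Lg[OF gF, symmetric])
      moreover have "hat a \<in> I" using I(1) gF True by blast
      ultimately show ?thesis using rels_T[of "hat a"] za unfolding local_rels_def DP_rels_def by auto
    next
      case False
      \<comment> \<open>For an atom in a trivial factor the recursion is set up so that
        \<open>c_a\<close> has image 0.\<close>
      then have "psubst fwd r = 0" unfolding eq sum_lq[OF aH] using fwd_sum[OF aH] 2(1) by simp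
      then show ?thesis using poly_ideal_0[OF T.J] by simp
    qed
  qed
qed

lemma lin_above: "p \<in> H \<Longrightarrow> upper_sum p = pvar p + (\<Sum>h\<in>strict_upper p. pvar h)"
  unfolding upper_sum_def by (rule sum_lq)

text \<open>Two atoms with the same image in the interval lie below the same compatible non-atoms.\<close>

lemma atoms_same_zeta:
  assumes p: "p \<in> ats" "compatible {p}" and q: "q \<in> ats" "compatible {q}"
    and hpq: "hat p = hat q" and z: "zeta p = zeta q"
  shows "pvar q - pvar p \<in> Iy"
proof -
  have sub: "h \<in> strict_upper q" if pa: "p \<in> ats" "q \<in> ats" and e: "hat p = hat q" "zeta p = zeta q"
    and h: "h \<in> strict_upper p" "compatible {h}" for p q h
  proof -
    have H: "p \<in> H" "q \<in> H" "h \<in> H" "p \<preceq> h" "h \<noteq> p" using pa atH h by (auto simp: strict_upper_def)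
    have hHo: "h \<in> Ho" using atom_lq_atom[OF pa(1)] H by blast
    have "q \<preceq> h"
      using above_compatible[OF H(1) hHo h(2) H(4)]
    proof
      assume "hat p \<preceq> h"
      then show ?thesis using hat(2)[OF H(2)] e(1) lq_trans by metis
    next
      assume hh: "hat h = hat p"
      then have "zeta p \<preceq> zeta h" using zeta_mono[OF H(1,3)] H(4) by simp
      then show ?thesis using lq_compatible[OF H(2,3) h(2)] hh e hHo by simp
    qed
    then show ?thesis using H(3) hHo pa(2) by (auto simp: strict_upper_def)
  qed
  have tail: "(\<Sum>h\<in>strict_upper p. pvar h) - (\<Sum>h\<in>{h \<in> strict_upper p. compatible {h}}. pvar h) \<in> Iy" for p
  proof -
    have "(\<Sum>h\<in>strict_upper p. pvar h) - (\<Sum>h\<in>{h \<in> strict_upper p. compatible {h}}. pvar h) =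
        (\<Sum>h\<in>strict_upper p - {h \<in> strict_upper p. compatible {h}}. pvar h)"
      using finite_above by (simp add: sum_diff)
    also have "\<dots> \<in> Iy" by (rule poly_ideal_sum[OF Iy(1)]) (auto intro: Iy_pvar above_H)
    finally show ?thesis .
  qed
  have "{h \<in> strict_upper p. compatible {h}} = {h \<in> strict_upper q. compatible {h}}"
    using sub[OF p(1) q(1) hpq z] sub[OF q(1) p(1) hpq[symmetric] z[symmetric]] by blast
  then have "(\<Sum>h\<in>strict_upper p. pvar h) - (\<Sum>h\<in>strict_upper q. pvar h) \<in> Iy"
    using poly_ideal_diff[OF Iy(1) tail[of p] tail[of q]] by simp
  moreover have "upper_sum q - upper_sum p \<in> Iy" using poly_ideal_diff[OF Iy(1)] Iy_lin p(1) q(1) by blast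
  ultimately have "(upper_sum q - upper_sum p) + ((\<Sum>h\<in>strict_upper p. pvar h) - (\<Sum>h\<in>strict_upper q. pvar h)) \<in> Iy"
    by (intro poly_ideal_add[OF Iy(1)])
  moreover have "p \<in> H" "q \<in> H" using p(1) q(1) atH by blast+
  ultimately show ?thesis by (simp add: lin_above algebra_simps)
qed

lemma bwd_top: "g \<in> Fp \<Longrightarrow> g \<in> Ho \<Longrightarrow> bwd g = upper_sum g"
  using compatible_rep(4)[OF _ Fp_Hg] by (simp add: bwd_def)

lemma bwd_rp:
  assumes "g \<in> Fp" "g \<in> Ho" "w \<in> Hg g" "w \<noteq> g"
  shows "bwd w = pvar (compatible_rep w)"
  using compatible_rep(4)[OF assms(1,3)] assms by (simp add: bwd_def)

lemma bwd_trivial: "g \<in> Fp \<Longrightarrow> g \<notin> Ho \<Longrightarrow> w \<in> Hg g \<Longrightarrow> bwd w = 0"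
  using compatible_rep(4) by (simp add: bwd_def)

text \<open>The induction descends like the recursion of \<open>fwd\<close>. In the recursive case
  the summands above \<open>p\<close> are settled by induction, and there remains the comparison of
  \<open>c_p\<close> with \<open>bwd\<close> of the prescribed value: \<open>c_p\<close> itself for
  \<open>p\<close> in \<open>F\<close>, and 0 for an atom of a trivial factor, whose
  \<open>c_p\<close> is a relation.\<close>

lemma bwd_fwd:
  assumes "p \<in> H"
  shows "psubst bwd (fwd p) - pvar p \<in> Iy"
  using assms
proof (induction p rule: above_induct)
  case (less p)
  show ?case
  proof (cases "p \<in> F \<inter> Ho \<or> hat p \<notin> Ho")
    case True
    let ?e = "if p \<in> F \<inter> Ho then pvar p else 0"
    have f: "fwd p = ?e - (\<Sum>h\<in>strict_upper p. fwd h)" using fwd_sum[OF less(1) True] by (simp add: eq_diff_eq)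
    have "psubst bwd (fwd p) - pvar p =
        (psubst bwd ?e - upper_sum p) - (\<Sum>h\<in>strict_upper p. psubst bwd (fwd h) - pvar h)"
      unfolding f lin_above[OF less(1)] psubst_diff psubst_sum sum_subtractf by simp
    moreover have "psubst bwd ?e - upper_sum p \<in> Iy"
    proof (cases "p \<in> F \<inter> Ho")
      case pF: True
      then have "p \<in> Fp" by (simp add: Fp_def)
      then show ?thesis using pF bwd_top[of p] poly_ideal_0[OF Iy(1)] by simp
    next
      case False
      then have "p \<in> ats" using trivial_compatible(1)[OF less(1)] True by blast
      then show ?thesis using False poly_ideal_uminus[OF Iy(1) Iy_lin] by simp
    qed
    moreover have "(\<Sum>h\<in>strict_upper p. psubst bwd (fwd h) - pvar h) \<in> Iy"
      using less.IH by (rule poly_ideal_sum[OF Iy(1)])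
    ultimately show ?thesis using poly_ideal_diff[OF Iy(1)] by simp
  next
    case False
    then have g: "hat p \<in> Ho" "hat p \<in> Fp" using hat(1)[OF less(1)] by blast+
    have pF: "p \<notin> F"
    proof
      assume "p \<in> F"
      then have "hat p = p" using hat_self(1)[of p] less(1) by (simp add: Fp_def)
      then show False using False \<open>p \<in> F\<close> g(1) by simp
    qed
    show ?thesis
    proof (cases "compatible {p}")
      case cp: True
      have f: "fwd p = pvar (zeta p)" using fwd_zeta[OF pF g(1)] cp by simp
      have w: "zeta p \<in> Hg (hat p)" using Hg_iff[OF g(2)] less(1) by blast
      note q = compatible_rep[OF g(2) w]
      show ?thesis
      proof (cases "zeta p = hat p")
        case True
        \<comment> \<open>A compatible \<open>p\<close> outside \<open>F\<close> whose image is the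
          top of its factor must be the top of \<open>L\<close>, and there \<open>c_p\<close> is
          just the variable.\<close>
        then have pg: "p = hat p" using zeta_eq_top[OF less(1) cp g(1)] by simp
        then have "p \<in> Fp" "p \<in> Ho" using g by simp_all
        then have pt: "p = tp" using pF by (simp add: Fp_def)
        have "strict_upper p = {}" unfolding strict_upper_def pt using lq_tp lqD(2) lq_antisym by blast
        then have "upper_sum p = pvar p" using lin_above[OF less(1)] by simp
        then have "psubst bwd (fwd p) = pvar p"
          using f True pg bwd_top[OF \<open>p \<in> Fp\<close> \<open>p \<in> Ho\<close>] by simp
        then show ?thesis using poly_ideal_0[OF Iy(1)] by simp
      next
        case False
        have b: "psubst bwd (fwd p) = pvar (compatible_rep (zeta p))" unfolding f using bwd_rp[OF g(2,1) w False] by simp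
        have zz: "zeta p \<preceq> zeta p" using lq_refl[OF lqD(1)[OF zeta(3)[OF less(1)]]] .
        show ?thesis
        proof (cases "p \<in> Ho \<or> compatible_rep (zeta p) \<in> Ho")
          case True
          have "p \<preceq> compatible_rep (zeta p)" by (rule lq_compatible[OF less(1) q(1,2)]) (use True q zz in auto)
          moreover have "compatible_rep (zeta p) \<preceq> p" by (rule lq_compatible[OF q(1) less(1) cp]) (use True q zz in auto)
          ultimately have "compatible_rep (zeta p) = p" using lq_antisym by blast
          then show ?thesis using b poly_ideal_0[OF Iy(1)] by simp
        next
          case False
          then have "p \<in> ats" "compatible_rep (zeta p) \<in> ats" using less(1) q(1) by blast+
          then show ?thesis unfolding b using atoms_same_zeta[OF _ cp _ q(2)] q by simp
        qed
      qed
    next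
      case nc: False
      then have "fwd p = 0" using fwd_zeta[OF pF g(1)] by simp
      then show ?thesis using poly_ideal_uminus[OF Iy(1) Iy_pvar[OF less(1) nc]] by simp
    qed
  qed
qed

lemma fwd_carrier: "p \<in> H \<Longrightarrow> fwd p \<in> carrier (poly_algebra T.W)"
  by (rule grade_poly_carrier[OF fwd_grade])

lemma bwd_carrier: "w \<in> T.W \<Longrightarrow> bwd w \<in> carrier (poly_algebra H)"
  by (rule grade_poly_carrier[OF bwd_grade])

text \<open>In a nontrivial factor nestedness already fails on a subset without the top, which
  \<open>bwd\<close> turns into the variables of an incompatible set. In a trivial factor all
  variables go to 0, and a non-nested set is nonempty.\<close>

lemma bwd_prod:
  assumes g: "g \<in> I" and W: "W \<subseteq> Hg g" "W \<notin> nested_sets (Lg g) (Hg g)"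
  shows "(\<Prod>w\<in>W. bwd w) \<in> Iy"
proof -
  have gF: "g \<in> Fp" using g I(2) by blast
  have finW: "finite W" using W(1) finHg[OF gF] finite_subset by blast
  show ?thesis
  proof (cases "g \<in> Ho")
    case True
    obtain V where V: "V \<subseteq> W" "g \<notin> V" "\<not> compatible (compatible_rep ` V)"
      using not_nested_lift[OF gF True W, of compatible_rep] compatible_rep[OF gF] W(1) by blast
    have r: "compatible_rep w \<in> H" "zeta (compatible_rep w) = w" if "w \<in> V" for w using compatible_rep[OF gF] V(1) W(1) that by blast+
    have "(\<Prod>w\<in>V. bwd w) = (\<Prod>w\<in>V. pvar (compatible_rep w))"
    proof (rule prod.cong[OF refl])
      fix w assume "w \<in> V"
      then show "bwd w = pvar (compatible_rep w)" using bwd_rp[OF gF True, of w] V W(1) by blast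
    qed
    also have "\<dots> = (\<Prod>p\<in>compatible_rep ` V. pvar p)"
    proof -
      have "inj_on compatible_rep V" by (rule inj_on_inverseI[of _ zeta]) (rule r(2))
      then show ?thesis by (simp add: prod.reindex)
    qed
    also have "\<dots> \<in> Iy" by (rule Iy_prod[OF _ V(3)]) (use r in blast)
    finally show ?thesis
    proof (rule poly_ideal_prod_dvd[OF Iy(1) V(1) finW])
      fix w assume "w \<in> W"
      then show "bwd w \<in> carrier (poly_algebra H)" using W(1) g by (intro bwd_carrier) (auto simp: T.W_def)
    qed
  next
    case False
    have "W \<noteq> {}" using W(2) nested_Lg[OF gF W(1)] by blast
    then obtain w where "w \<in> W" by blast
    moreover from this have "bwd w = 0" using bwd_trivial[OF gF False] W(1) by blast
    ultimately have "(\<Prod>w\<in>W. bwd w) = 0" using finW by (intro prod_zero) auto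
    then show ?thesis using poly_ideal_0[OF Iy(1)] by simp
  qed
qed

text \<open>In a nontrivial factor the linear form is the image of \<open>c_a\<close> under
  \<open>fwd\<close>, for an atom \<open>a\<close> with image \<open>w\<close>; so
  \<open>bwd\<close> brings it back to \<open>c_a\<close> modulo the ideal.\<close>

lemma bwd_lin:
  assumes g: "g \<in> I" and w: "w \<in> atoms (Lg g)"
  shows "psubst bwd (DP_lin (Lg g) (Hg g) w) \<in> Iy"
proof -
  have gF: "g \<in> Fp" using g I(2) by blast
  have wH: "w \<in> Hg g" using w atoms_Lg_Hg[OF gF] by blast
  have eq: "DP_lin (Lg g) (Hg g) w = (\<Sum>v\<in>{v \<in> Hg g. w \<preceq> v}. pvar v)" by (rule DP_lin_Lg[OF gF wH])
  show ?thesis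
  proof (cases "g \<in> Ho")
    case True
    obtain a where a: "a \<in> ats" "hat a = g" "zeta a = w" using w atoms_Lg[OF gF] by blast
    have "psubst fwd (upper_sum a) = DP_lin (Lg g) (Hg g) w"
      unfolding eq upper_sum_def psubst_sum using fwd_lin_atom[OF a(1)] a True by simp
    moreover have "psubst bwd (psubst fwd (upper_sum a)) - upper_sum a \<in> Iy"
      by (rule psubst_psubst_cong[OF fwd_carrier bwd_carrier Iy(1) bwd_fwd grade_poly_carrier[OF lin_grade]])
    ultimately have "psubst bwd (DP_lin (Lg g) (Hg g) w) - upper_sum a \<in> Iy" by simp
    from poly_ideal_add[OF Iy(1) this Iy_lin[OF a(1)]] show ?thesis by simp
  next
    case False
    have "psubst bwd (DP_lin (Lg g) (Hg g) w) = (\<Sum>v\<in>{v \<in> Hg g. w \<preceq> v}. bwd v)"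
      unfolding eq psubst_sum by simp
    also have "\<dots> = 0" using bwd_trivial[OF gF False] by (intro sum.neutral) blast
    finally show ?thesis using poly_ideal_0[OF Iy(1)] by simp
  qed
qed

lemma bwd_rels:
  assumes "r \<in> (\<Union>g\<in>I. local_rels g)"
  shows "psubst bwd r \<in> Iy"
proof -
  from assms obtain g where g: "g \<in> I" "r \<in> local_rels g" by blast
  then consider W where "W \<subseteq> Hg g" "W \<notin> nested_sets (Lg g) (Hg g)" "r = (\<Prod>w\<in>W. pvar w)"
    | w where "w \<in> atoms (Lg g)" "r = DP_lin (Lg g) (Hg g) w"
    unfolding local_rels_def DP_rels_def by auto
  then show ?thesis
  proof cases
    case 1
    then show ?thesis using bwd_prod[OF g(1) 1(1,2)] by (simp add: psubst_prod)
  next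
    case 2
    then show ?thesis using bwd_lin[OF g(1)] by simp
  qed
qed

lemma fwd_bwd:
  assumes "w \<in> T.W"
  shows "psubst fwd (bwd w) - pvar w \<in> T.J"
proof -
  obtain g where g: "g \<in> I" "w \<in> Hg g" using assms unfolding T.W_def by blast
  have gF: "g \<in> Fp" using g I(2) by blast
  note q = compatible_rep[OF gF g(2)]
  show ?thesis
  proof (cases "g \<in> Ho")
    case True
    have "psubst fwd (bwd w) = pvar w"
    proof (cases "w = g")
      case wg: True
      then have "psubst fwd (bwd w) = (\<Sum>h\<in>{h \<in> H. g \<preceq> h}. fwd h)"
        using bwd_top[OF gF True] by (simp add: upper_sum_def psubst_sum)
      then show ?thesis using fwd_lin_Fp[OF gF True] wg by simp
    next
      case False
      have "compatible_rep w \<notin> F"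
      proof
        assume "compatible_rep w \<in> F"
        then have "compatible_rep w \<in> Fp" by (simp add: Fp_def)
        then have "hat (compatible_rep w) = compatible_rep w" "zeta (compatible_rep w) = compatible_rep w" using hat_self[OF _ q(1)] by blast+
        then show False using q False by simp
      qed
      then have "fwd (compatible_rep w) = pvar w" using fwd_zeta[of "compatible_rep w"] q True by simp
      then show ?thesis using bwd_rp[OF gF True g(2) False] by simp
    qed
    then show ?thesis using poly_ideal_0[OF T.J] by simp
  next
    case False
    \<comment> \<open>The local building set of a trivial factor consists of atoms, so the linear
      relation of \<open>w\<close> is the variable of \<open>w\<close> alone.\<close>
    have wa: "w \<in> atoms (Lg g)" by (rule Hg_trivial[OF gF False g(2)])
    have wC: "w \<in> C" using g(2) Hg_C[OF gF] by blast
    have "v = w" if v: "v \<in> Hg g" "w \<preceq> v" for v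
    proof -
      obtain a where a: "a \<in> ats" "hat a = g" "zeta a = v"
        using Hg_trivial[OF gF False v(1)] atoms_Lg[OF gF] by blast
      have "w = zb g \<or> w = v" using zeta_atom_cover[OF a(1), of w] a v(2) Hg_bounds[OF gF g(2)] by simp
      then show ?thesis using Hg_bounds[OF gF g(2)] by blast
    qed
    then have "{v \<in> Hg g. w \<preceq> v} = {w}" using g(2) lq_refl[OF wC] by blast
    then have "pvar w = DP_lin (Lg g) (Hg g) w" using DP_lin_Lg[OF gF g(2)] by simp
    also have "\<dots> \<in> T.J" using rels_T[OF g(1)] wa unfolding local_rels_def DP_rels_def by blast
    finally have "- pvar w \<in> T.J" by (rule poly_ideal_uminus[OF T.J])
    then show ?thesis using bwd_trivial[OF gF False g(2)] by simp
  qed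
qed

lemma DP_rel_iso: "DP_rel L H Sc \<cong>\<^sub>g\<^sub>r quot_algebra (poly_algebra T.W) T.J"
  unfolding DP_rel_def T.J_def
proof (rule presentation_iso[where s = fwd and t = bwd])
  show "DP_rels L H Sc \<subseteq> carrier (poly_algebra H)" by (rule DP_rels_carrier)
  show "(\<Union>g\<in>I. local_rels g) \<subseteq> carrier (poly_algebra T.W)" by (rule T.R_W)
qed (fold T.J_def Iy_def, simp_all only: fwd_grade bwd_grade fwd_rels bwd_rels bwd_fwd fwd_bwd)

lemma local_A: "T.A g = DP (Lg g) (Hg g)"
  by (simp add: T.A_def T.N_def DP_def DP_rel_def local_rels_def)

lemma DP_rel_tensor_iso:
  "DP_rel L H Sc \<cong>\<^sub>g\<^sub>r tensor_algebra I (\<lambda>g. DP (Lg g) (Hg g))"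
  "tensor_algebra I (\<lambda>g. DP (Lg g) (Hg g)) \<cong>\<^sub>g\<^sub>r DP_rel L H Sc"
proof -
  have A: "(\<lambda>g. DP (Lg g) (Hg g)) = T.A" by (rule ext) (simp add: local_A)
  have "good_algebra (DP_rel L H Sc)"
    unfolding DP_rel_def by (rule good_quot_algebra[OF good_poly_algebra poly_genideal(1)[OF DP_rels_carrier]])
  moreover show "DP_rel L H Sc \<cong>\<^sub>g\<^sub>r tensor_algebra I (\<lambda>g. DP (Lg g) (Hg g))"
    unfolding A by (rule graded_iso_trans[OF DP_rel_iso graded_iso_sym[OF T.good_tensor T.tensor_iso]])
  ultimately show "tensor_algebra I (\<lambda>g. DP (Lg g) (Hg g)) \<cong>\<^sub>g\<^sub>r DP_rel L H Sc" by (rule graded_iso_sym)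
qed

end

theorem theorem4p1p7:
  fixes L :: "'a gorder" and G H :: "'a set" and ps :: "'a list" and y :: "'a blow"
  assumes "geometric_lattice L"
    and "partial_building_set L G H"
    and "blowup_order L H ps"
    and "y \<in> carrier (blown_lattice L ps)"
    and "blown_proj L ps y \<noteq> \<top>\<^bsub>L\<^esub>"
  shows "DP_at L H ps y \<cong>\<^sub>g\<^sub>r
           tensor_algebra (factors_top L G H ps y) (\<lambda>g. local_DP L G H ps y g)
       \<and> tensor_algebra (factors_top L G H ps y) (\<lambda>g. local_DP L G H ps y g) \<cong>\<^sub>g\<^sub>r
           tensor_algebra (factors_top L G H ps y \<inter> (H - atoms L)) (\<lambda>g. local_DP L G H ps y g)"
proof -
  interpret geom L G H by (rule geom.intro[OF assms(1,2)])
  let ?F = "factors L G H ps y"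
  obtain Sc where Sc: "DP_at L H ps y = DP_rel L H Sc" "?F \<subseteq> G" "\<forall>U\<subseteq>?F. J U \<in> G \<longrightarrow> J U \<in> U"
    "\<And>T. T \<subseteq> H \<Longrightarrow> Sc \<union> T \<in> nested_sets L H \<longleftrightarrow> (\<forall>U\<subseteq>?F \<union> T. J U \<in> Ho \<longrightarrow> J U \<in> U)"
    using blown_structure[OF assms(3,4)] by blast
  interpret nested_factors L G H ?F
    by unfold_locales (use Sc in blast)+
  \<comment> \<open>The local data depend on \<open>y\<close> only through its factors, so they
    agree with those of the locale.\<close>
  have Fp: "factors_top L G H ps y = Fp" by (simp add: factors_top_def Fp_def)
  have zb: "local_bot L G H ps y = zb" by (simp add: fun_eq_iff local_bot_def zb_def J_def)
  have Lg: "local_lattice L G H ps y = Lg" by (simp add: fun_eq_iff local_lattice_def Lg_def zb)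
  have hat: "factor_over L G H ps y = hat" by (simp add: fun_eq_iff factor_over_def hat_def Fp)
  have zeta: "local_map L G H ps y = zeta"
    by (simp add: fun_eq_iff local_map_def zeta_def zb hat join_J)
  have Hg: "local_building L G H ps y = Hg"
    by (simp add: fun_eq_iff local_building_def Hg_def zeta Lg zb)
  have DP: "local_DP L G H ps y = (\<lambda>g. DP (Lg g) (Hg g))"
    by (simp add: fun_eq_iff local_DP_def Lg Hg)
  \<comment> \<open>Applied to all of F^+ and to the nontrivial factors; the second isomorphism
    passes through the algebra at \<open>y\<close>.\<close>
  have fp: "factor_presentation L G H ?F I Sc" if "Fp \<inter> Ho \<subseteq> I" "I \<subseteq> Fp" for I
    by unfold_locales (use that Sc(4) in \<open>auto simp: compatible_def\<close>)
  note iso = factor_presentation.DP_rel_tensor_iso[OF fp]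
  show ?thesis
    unfolding Fp DP Sc(1)
    by (intro conjI iso(1) graded_iso_trans[OF iso(2) iso(1)]) auto
qed

end
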